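(* Let $(M,\langle\cdot,\cdot\rangle)$ be a Riemannian manifold and $k\ge1$. If $\Gamma$ is a $k$-horizontal geodesic on $(T^{(k)}M,g^{(k)})$, then $\tau^{(k)}_{k-1}\circ\Gamma$ is a geodesic on $(T^{(k-1)}M,g^{(k-1)})$, where $g^{(k)}$ and $g^{(k-1)}$ are the Sasaki metrics of order $k$ and $k-1$.
   Context: $\nabla$ is the Levi--Civita connection of $M$. $T^{(k)}M$ is the manifold of $k$-jets $u=j^k_0(q)$ at $0$ of smooth curves $q$ in $M$, with projections $\tau_k(j^k_0q)=q(0)$ and $\tau^{(k)}_{k-1}:T^{(k)}M\to T^{(k-1)}M$, $j^k_0q\mapsto j^{k-1}_0q$; $T^{(0)}M=M$ with $g^{(0)}=\langle\cdot,\cdot\rangle$. For $W\in T_uT^{(k)}M$ choose a family of curves $\gamma_s(t)=\gamma(s,t)$ on $M$ such that $s\mapsto j^k_0(\gamma_s)$ passes through $u$ at $s=0$ with velocity $W$, and set $K_0(W)=\tau_{k*}W$ and $K_\alpha(W)=\frac1{\alpha!}\nabla^\alpha_{\partial\gamma/\partial t}\frac{\partial\gamma}{\partial s}\big|_{(s,t)=(0,0)}$ for $\alpha=1,\ldots,k$. These are well defined and $(K_0,\ldots,K_k):T_uT^{(k)}M\to(T_{\tau_k(u)}M)^{k+1}$ is a linear isomorphism. The $k$-Sasaki metric $g^{(k)}$ on $T^{(k)}M$ is $g^{(k)}_u(W,W')=\sum_{\alpha=0}^k\langle K_\alpha(W),K_\alpha(W')\rangle$. A curve $\Gamma$ on $T^{(k)}M$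 is $k$-horizontal if $K_k\circ\dot\Gamma=0$. *)

theory Defs
  imports "HOL-Analysis.Analysis"
begin

section \<open>Smooth functions on open subsets of \<open>\<real>\<^sup>n\<close>\<close>

text \<open>
  The model space \<open>\<real>\<^sup>n\<close> is the library's \<^const>\<open>Euclidean_space\<close> \<open>n\<close>, i.e. the functions
  \<open>nat \<Rightarrow> real\<close> vanishing from index \<open>n\<close> on. The dimension is thus an ordinary number,
  which is needed because the dimension of the bundle of \<open>k\<close>-jets depends on \<open>k\<close>.
\<close>

definition partial :: "nat \<Rightarrow> ((nat \<Rightarrow> real) \<Rightarrow> real) \<Rightarrow> (nat \<Rightarrow> real) \<Rightarrow> real" where
  "partial i f x = deriv (\<lambda>s. f (x(i := s))) (x i)"

fun C_on :: "nat \<Rightarrow> nat \<Rightarrow> (nat \<Rightarrow> real) set \<Rightarrow> ((nat \<Rightarrow> real) \<Rightarrow> real) \<Rightarrow> bool" where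
  "C_on 0 n S f \<longleftrightarrow> continuous_map (subtopology (Euclidean_space n) S) euclideanreal f"
| "C_on (Suc r) n S f \<longleftrightarrow>
     continuous_map (subtopology (Euclidean_space n) S) euclideanreal f \<and>
     (\<forall>i<n. (\<forall>x\<in>S. (\<lambda>s. f (x(i := s))) differentiable (at (x i))) \<and> C_on r n S (partial i f))"

definition smooth_on :: "nat \<Rightarrow> (nat \<Rightarrow> real) set \<Rightarrow> ((nat \<Rightarrow> real) \<Rightarrow> real) \<Rightarrow> bool" where
  "smooth_on n S f \<longleftrightarrow> openin (Euclidean_space n) S \<and> (\<forall>r. C_on r n S f)"


section \<open>Smooth manifolds\<close>

type_synonym 'a chart = "'a set \<times> ('a \<Rightarrow> nat \<Rightarrow> real)"

record 'a manifold =
  mdim :: nat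
  atlas :: "'a chart set"

definition mcarrier :: "'a manifold \<Rightarrow> 'a set" where
  "mcarrier M = (\<Union>C\<in>atlas M. fst C)"

definition mtopology :: "'a manifold \<Rightarrow> 'a topology" where
  "mtopology M = topology_generated_by
     {S. \<exists>C\<in>atlas M. S \<subseteq> fst C \<and> openin (Euclidean_space (mdim M)) (snd C ` S)}"

abbreviation chart_inv :: "'a chart \<Rightarrow> (nat \<Rightarrow> real) \<Rightarrow> 'a" where
  "chart_inv C \<equiv> inv_into (fst C) (snd C)"

text \<open>
  Because the charts are injective and overlap images are open, the topology generated by the
  atlas makes every chart a homeomorphism from an open set onto an open subset of \<open>\<real>\<^sup>n\<close>.
\<close>

definition smooth_manifold :: "'a manifold \<Rightarrow> bool" where
  "smooth_manifold M \<longleftrightarrow>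
     (\<forall>C\<in>atlas M. inj_on (snd C) (fst C) \<and>
        openin (Euclidean_space (mdim M)) (snd C ` fst C)) \<and>
     (\<forall>C\<in>atlas M. \<forall>D\<in>atlas M.
        openin (Euclidean_space (mdim M)) (snd C ` (fst C \<inter> fst D)) \<and>
        (\<forall>j<mdim M. smooth_on (mdim M) (snd C ` (fst C \<inter> fst D))
           (\<lambda>x. snd D (chart_inv C x) j))) \<and>
     Hausdorff_space (mtopology M) \<and> second_countable (mtopology M)"

definition smooth_curve :: "'a manifold \<Rightarrow> real set \<Rightarrow> (real \<Rightarrow> 'a) \<Rightarrow> bool" where
  "smooth_curve M I c \<longleftrightarrow> open I \<and>
     (\<forall>t\<in>I. c t \<in> mcarrier M \<and>
        (\<forall>C\<in>atlas M. c t \<in> fst C \<longrightarrow>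
           (\<forall>\<^sub>F s in nhds t. c s \<in> fst C) \<and>
           (\<forall>i<mdim M. \<forall>r. (deriv ^^ r) (\<lambda>s. snd C (c s) i) differentiable (at t))))"

definition smooth_germ :: "'a manifold \<Rightarrow> (real \<Rightarrow> 'a) \<Rightarrow> bool" where
  "smooth_germ M q \<longleftrightarrow> (\<exists>e>0. smooth_curve M {-e<..<e} q)"

text \<open>
  A family \<open>\<gamma> s t\<close> that is jointly smooth in \<open>(s, t)\<close> near \<open>(0, 0)\<close>; the pair \<open>(s, t)\<close> is the
  point \<open>z\<close> of \<open>\<real>\<^sup>2\<close> with \<open>z 0 = s\<close> and \<open>z 1 = t\<close>.
\<close>

definition smooth_family :: "'a manifold \<Rightarrow> (real \<Rightarrow> real \<Rightarrow> 'a) \<Rightarrow> bool" where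
  "smooth_family M \<gamma> \<longleftrightarrow> \<gamma> 0 0 \<in> mcarrier M \<and>
     (\<forall>C\<in>atlas M. \<gamma> 0 0 \<in> fst C \<longrightarrow>
        (\<exists>e>0. (\<forall>s t. \<bar>s\<bar> < e \<and> \<bar>t\<bar> < e \<longrightarrow> \<gamma> s t \<in> fst C) \<and>
           (\<forall>i<mdim M. smooth_on 2
              {z \<in> topspace (Euclidean_space 2). \<bar>z 0\<bar> < e \<and> \<bar>z 1\<bar> < e}
              (\<lambda>z. snd C (\<gamma> (z 0) (z 1)) i))))"


section \<open>Jets of curves and tangent vectors\<close>

type_synonym 'a jet = "(real \<Rightarrow> 'a) set"

definition jet :: "'a manifold \<Rightarrow> nat \<Rightarrow> (real \<Rightarrow> 'a) \<Rightarrow> 'a jet" where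
  "jet M k q = {q'. smooth_germ M q' \<and> q' 0 = q 0 \<and>
     (\<forall>C\<in>atlas M. q 0 \<in> fst C \<longrightarrow>
        (\<forall>i<mdim M. \<forall>r\<le>k.
           (deriv ^^ r) (\<lambda>t. snd C (q' t) i) 0 = (deriv ^^ r) (\<lambda>t. snd C (q t) i) 0))}"

definition jets :: "'a manifold \<Rightarrow> nat \<Rightarrow> 'a jet set" where
  "jets M k = {jet M k q | q. smooth_germ M q}"

definition rep :: "'a jet \<Rightarrow> real \<Rightarrow> 'a" where
  "rep u = (SOME q. q \<in> u)"

definition jet_base :: "'a jet \<Rightarrow> 'a" where  \<comment> \<open>the projection \<open>\<tau>\<^sub>k\<close>\<close>
  "jet_base u = rep u 0"

definition jet_trunc :: "'a manifold \<Rightarrow> nat \<Rightarrow> 'a jet \<Rightarrow> 'a jet" where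
  "jet_trunc M l u = jet M l (rep u)"

text \<open>
  The natural chart of the jet bundle over a chart of \<open>M\<close>: with \<open>n = dim M\<close>, the coordinate of
  index \<open>n * r + i\<close> (\<open>i < n\<close>, \<open>r \<le> k\<close>) is the \<open>r\<close>-th derivative of the \<open>i\<close>-th coordinate.
\<close>

definition jet_chart :: "'a manifold \<Rightarrow> nat \<Rightarrow> 'a chart \<Rightarrow> 'a jet chart" where
  "jet_chart M k C =
     ({u \<in> jets M k. jet_base u \<in> fst C},
      \<lambda>u j. if j < mdim M * (k + 1)
            then (deriv ^^ (j div mdim M)) (\<lambda>t. snd C (rep u t) (j mod mdim M)) 0
            else 0)"

text \<open>
  The bundle of order 0 is by convention \<open>M\<close> itself with its given metric. As \<^const>\<open>jets\<close> \<open>M 0\<close>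
  has a different type from \<open>M\<close>, use \<open>M\<close> and \<^const>\<open>jet_base\<close> directly in place of the
  0-jet bundle and the truncation to order 0.
\<close>

definition jet_bundle :: "nat \<Rightarrow> 'a manifold \<Rightarrow> 'a jet manifold" where
  "jet_bundle k M = \<lparr>mdim = mdim M * (k + 1), atlas = jet_chart M k ` atlas M\<rparr>"

text \<open>Tangent vectors are 1-jets of curves.\<close>

definition tspace :: "'a manifold \<Rightarrow> 'a \<Rightarrow> 'a jet set" where
  "tspace M p = {v \<in> jets M 1. jet_base v = p}"

definition velocity :: "'a manifold \<Rightarrow> (real \<Rightarrow> 'a) \<Rightarrow> real \<Rightarrow> 'a jet" where
  "velocity M c t = jet M 1 (\<lambda>s. c (t + s))"

definition zero_vec :: "'a manifold \<Rightarrow> 'a \<Rightarrow> 'a jet" where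
  "zero_vec M p = jet M 1 (\<lambda>_. p)"

definition scale_vec :: "'a manifold \<Rightarrow> real \<Rightarrow> 'a jet \<Rightarrow> 'a jet" where
  "scale_vec M a v = jet M 1 (\<lambda>t. rep v (a * t))"

definition pushforward :: "'b manifold \<Rightarrow> ('a \<Rightarrow> 'b) \<Rightarrow> 'a jet \<Rightarrow> 'b jet" where
  "pushforward N f v = jet N 1 (\<lambda>t. f (rep v t))"

definition vcomp :: "'a chart \<Rightarrow> 'a jet \<Rightarrow> nat \<Rightarrow> real" where
  "vcomp C v i = deriv (\<lambda>t. snd C (rep v t) i) 0"

definition coord_vec :: "'a manifold \<Rightarrow> 'a chart \<Rightarrow> 'a \<Rightarrow> nat \<Rightarrow> 'a jet" where
  "coord_vec M C p i = jet M 1 (\<lambda>t. chart_inv C ((snd C p)(i := snd C p i + t)))"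


section \<open>Riemannian metrics, the Levi-Civita connection, geodesics\<close>

type_synonym 'a metric = "'a \<Rightarrow> 'a jet \<Rightarrow> 'a jet \<Rightarrow> real"

definition metric_coeff ::
  "'a manifold \<Rightarrow> 'a metric \<Rightarrow> 'a chart \<Rightarrow> nat \<Rightarrow> nat \<Rightarrow> (nat \<Rightarrow> real) \<Rightarrow> real" where
  "metric_coeff M g C i j x =
     (let p = chart_inv C x in g p (coord_vec M C p i) (coord_vec M C p j))"

text \<open>
  The vector space structure of a tangent space is the one given by components in a chart, so
  bilinearity is the expansion of \<open>g p v w\<close> in the coordinate frame.
\<close>

definition riemannian_metric :: "'a manifold \<Rightarrow> 'a metric \<Rightarrow> bool" where
  "riemannian_metric M g \<longleftrightarrow>
     (\<forall>p\<in>mcarrier M. \<forall>v\<in>tspace M p. \<forall>w\<in>tspace M p.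
        g p v w = g p w v \<and> (v \<noteq> zero_vec M p \<longrightarrow> g p v v > 0)) \<and>
     (\<forall>C\<in>atlas M. \<forall>p\<in>fst C. \<forall>v\<in>tspace M p. \<forall>w\<in>tspace M p.
        g p v w = (\<Sum>i<mdim M. \<Sum>j<mdim M.
          vcomp C v i * vcomp C w j * g p (coord_vec M C p i) (coord_vec M C p j))) \<and>
     (\<forall>C\<in>atlas M. \<forall>i<mdim M. \<forall>j<mdim M.
        smooth_on (mdim M) (snd C ` fst C) (metric_coeff M g C i j))"

definition riemannian_manifold :: "'a manifold \<Rightarrow> 'a metric \<Rightarrow> bool" where
  "riemannian_manifold M g \<longleftrightarrow> smooth_manifold M \<and> riemannian_metric M g"

text \<open>
  Coefficients \<open>\<Gamma> m i j\<close> of a connection at the point with coordinates \<open>x\<close>, with the convention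
  \<open>\<nabla>\<^sub>i \<partial>\<^sub>j = \<Sum>\<^sub>m \<Gamma> m i j \<partial>\<^sub>m\<close>. The two conditions say that the connection is torsion-free and
  compatible with the metric; for a Riemannian metric they determine \<open>\<Gamma> m i j\<close>
  for \<open>m, i, j < dim M\<close> uniquely.
\<close>

definition levi_civita_coeffs ::
  "'a manifold \<Rightarrow> 'a metric \<Rightarrow> 'a chart \<Rightarrow> (nat \<Rightarrow> real) \<Rightarrow> (nat \<Rightarrow> nat \<Rightarrow> nat \<Rightarrow> real) \<Rightarrow> bool" where
  "levi_civita_coeffs M g C x \<Gamma> \<longleftrightarrow>
     (\<forall>m<mdim M. \<forall>i<mdim M. \<forall>j<mdim M. \<Gamma> m i j = \<Gamma> m j i) \<and>
     (\<forall>l<mdim M. \<forall>i<mdim M. \<forall>j<mdim M.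
        partial l (metric_coeff M g C i j) x =
          (\<Sum>m<mdim M. \<Gamma> m l i * metric_coeff M g C m j x) +
          (\<Sum>m<mdim M. \<Gamma> m l j * metric_coeff M g C i m x))"

definition christoffel ::
  "'a manifold \<Rightarrow> 'a metric \<Rightarrow> 'a chart \<Rightarrow> (nat \<Rightarrow> real) \<Rightarrow> nat \<Rightarrow> nat \<Rightarrow> nat \<Rightarrow> real" where
  "christoffel M g C x = (SOME \<Gamma>. levi_civita_coeffs M g C x \<Gamma>)"

text \<open>\<open>w\<close> is the covariant derivative at time \<open>t\<close> of the vector field \<open>V\<close> along the curve \<open>c\<close>.\<close>

definition has_cov_deriv ::
  "'a manifold \<Rightarrow> 'a metric \<Rightarrow> (real \<Rightarrow> 'a) \<Rightarrow> (real \<Rightarrow> 'a jet) \<Rightarrow> real \<Rightarrow> 'a jet \<Rightarrow> bool" where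
  "has_cov_deriv M g c V t w \<longleftrightarrow>
     (\<forall>\<^sub>F s in nhds t. V s \<in> tspace M (c s)) \<and> w \<in> tspace M (c t) \<and>
     (\<forall>C\<in>atlas M. c t \<in> fst C \<longrightarrow>
        (\<forall>m<mdim M. (\<lambda>s. vcomp C (V s) m) differentiable (at t) \<and>
           vcomp C w m = deriv (\<lambda>s. vcomp C (V s) m) t +
             (\<Sum>i<mdim M. \<Sum>j<mdim M. christoffel M g C (snd C (c t)) m i j *
                vcomp C (velocity M c t) i * vcomp C (V t) j)))"

definition cov_deriv ::
  "'a manifold \<Rightarrow> 'a metric \<Rightarrow> (real \<Rightarrow> 'a) \<Rightarrow> (real \<Rightarrow> 'a jet) \<Rightarrow> real \<Rightarrow> 'a jet" where
  "cov_deriv M g c V t = (THE w. has_cov_deriv M g c V t w)"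

definition geodesic :: "'a manifold \<Rightarrow> 'a metric \<Rightarrow> real set \<Rightarrow> (real \<Rightarrow> 'a) \<Rightarrow> bool" where
  "geodesic M g I c \<longleftrightarrow> smooth_curve M I c \<and>
     (\<forall>t\<in>I. has_cov_deriv M g c (velocity M c) t (zero_vec M (c t)))"


section \<open>The Sasaki metrics of higher order\<close>

text \<open>
  \<open>\<gamma>\<close> is a family of curves such that \<open>s \<mapsto> j\<^sup>k\<^sub>0(\<gamma>\<^sub>s)\<close> has velocity \<open>W\<close> at \<open>s = 0\<close>.
  As \<open>W\<close> is a 1-jet, this includes passing through its base point \<open>u\<close>.
\<close>

definition family_for ::
  "'a manifold \<Rightarrow> nat \<Rightarrow> 'a jet jet \<Rightarrow> (real \<Rightarrow> real \<Rightarrow> 'a) \<Rightarrow> bool" where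
  "family_for M k W \<gamma> \<longleftrightarrow>
     smooth_family M \<gamma> \<and> velocity (jet_bundle k M) (\<lambda>s. jet M k (\<gamma> s)) 0 = W"

definition K_map :: "'a manifold \<Rightarrow> 'a metric \<Rightarrow> nat \<Rightarrow> nat \<Rightarrow> 'a jet jet \<Rightarrow> 'a jet" where
  "K_map M g k \<alpha> W =
     (if \<alpha> = 0 then pushforward M jet_base W
      else let \<gamma> = (SOME \<gamma>. family_for M k W \<gamma>) in
        scale_vec M (1 / fact \<alpha>)
          ((cov_deriv M g (\<gamma> 0) ^^ \<alpha>) (\<lambda>t. velocity M (\<lambda>s. \<gamma> s t) 0) 0))"

definition sasaki :: "nat \<Rightarrow> 'a manifold \<Rightarrow> 'a metric \<Rightarrow> 'a jet metric" where
  "sasaki k M g u W W' =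
     (\<Sum>\<alpha>\<le>k. g (jet_base u) (K_map M g k \<alpha> W) (K_map M g k \<alpha> W'))"

definition k_horizontal ::
  "'a manifold \<Rightarrow> 'a metric \<Rightarrow> nat \<Rightarrow> real set \<Rightarrow> (real \<Rightarrow> 'a jet) \<Rightarrow> bool" where
  "k_horizontal M g k I \<Gamma> \<longleftrightarrow>
     (\<forall>t\<in>I. K_map M g k k (velocity (jet_bundle k M) \<Gamma> t) = zero_vec M (jet_base (\<Gamma> t)))"

end

theory Submission
  imports Defs
begin

text \<open>
  In the natural charts the components of \<open>K\<^sub>\<alpha>\<close> are one-forms \<open>\<theta>\<^sub>\<alpha>\<close> that involve only the
  coordinates of order at most \<open>\<alpha>\<close>. Hence \<open>g\<^sup>(\<^sup>k\<^sup>)\<close> is the pullback of \<open>g\<^sup>(\<^sup>k\<^sup>-\<^sup>1\<^sup>)\<close> plus the square of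
  \<open>\<theta>\<^sub>k\<close>. In the geodesic equation with lowered index, every contribution of this square contains
  \<open>\<theta>\<^sub>k\<close> applied to the velocity, or the derivative of that quantity along the curve, and so vanishes
  for a \<open>k\<close>-horizontal curve. What remains, for the indices of order below \<open>k\<close>, is the geodesic
  equation of \<open>g\<^sup>(\<^sup>k\<^sup>-\<^sup>1\<^sup>)\<close> for the projected curve.
\<close>

subsection \<open>Calculus on open subsets of \<open>\<real>\<^sup>n\<close>\<close>

text \<open>Lowering the index is what lets the splitting of the metric act: the lowered equation is
  additive in the metric and contains only the coefficients and their first partial derivatives,
  whereas the Christoffel symbols of \<open>g^(k)\<close> involve the inverse of the whole
  coefficient matrix. Most of the work lies in reaching a coordinate formula for
  \<open>K_map\<close>. Jets and covariant derivatives are constrained in all charts at once, so a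
  computation in one chart is admissible only after the prolongation of transition maps and the
  transformation law of the Christoffel symbols are available. Moreover \<open>christoffel\<close>,
  \<open>cov_deriv\<close> and \<open>K_map\<close> are defined by choice or description, so a
  family must be shown to exist for every \<open>W\<close>, and the value must not depend on it. The
  formula itself comes from the time jet of the variation field: mixed partial derivatives commute,
  so this jet has the components of \<open>W\<close> as coordinates, and repeated covariant
  differentiation acts on it linearly, with coefficients depending on the jet of the curve.\<close>

abbreviation EE :: "nat \<Rightarrow> (nat \<Rightarrow> real) set" where
  "EE n \<equiv> topspace (Euclidean_space n)"

lemma EE_iff: "x \<in> EE n \<longleftrightarrow> (\<forall>i\<ge>n. x i = 0)"
  by (simp add: topspace_Euclidean_space)

lemma Euclidean_space_eq: "Euclidean_space n = top_of_set (EE n)"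
  by (simp add: Euclidean_space_def euclidean_product_topology)

lemma openin_EE: "openin (Euclidean_space n) S \<longleftrightarrow> openin (top_of_set (EE n)) S"
  by (subst Euclidean_space_eq) simp

lemma openin_EE_subset: "openin (Euclidean_space n) S \<Longrightarrow> S \<subseteq> EE n"
  by (rule openin_subset)

lemma continuous_map_EE:
  assumes "S \<subseteq> EE n"
  shows "continuous_map (subtopology (Euclidean_space n) S) euclideanreal f \<longleftrightarrow> continuous_on S f"
  using assms by (subst Euclidean_space_eq) (simp add: subtopology_subtopology Int_absorb1)

lemma tendsto_coordinatewise:
  fixes f :: "'a \<Rightarrow> nat \<Rightarrow> real"
  assumes "\<And>i. ((\<lambda>s. f s i) \<longlongrightarrow> x i) F"
  shows "(f \<longlongrightarrow> x) F"
proof -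
  have "limitin (powertop_real UNIV) f x F"
    using assms by (simp add: limitin_componentwise)
  then show ?thesis
    by (simp add: euclidean_product_topology)
qed

lemma openin_EE_eventually:
  assumes "openin (Euclidean_space n) S" "(f \<longlongrightarrow> x) F" "x \<in> S" "\<forall>\<^sub>F s in F. f s \<in> EE n"
  shows "\<forall>\<^sub>F s in F. f s \<in> S"
proof -
  obtain T where T: "open T" "S = EE n \<inter> T"
    using assms(1) unfolding openin_EE openin_open by blast
  then have "\<forall>\<^sub>F s in F. f s \<in> T"
    using assms(2,3) by (auto intro: topological_tendstoD)
  with assms(4) show ?thesis
    by eventually_elim (use T in auto)
qed

text \<open>A basic open set of the product topology restricts the coordinates separately, and
  inside \<open>EE n\<close> only the first \<open>n\<close> of them can vary, so a single radius,
  the minimum over these, is enough.\<close>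

lemma openin_EE_box:
  assumes S: "openin (Euclidean_space n) S" and x: "x \<in> S"
  shows "\<exists>e>0. \<forall>y\<in>EE n. (\<forall>j<n. \<bar>y j - x j\<bar> < e) \<longrightarrow> y \<in> S"
proof -
  obtain T where T: "open T" "S = EE n \<inter> T"
    using assms(1) unfolding openin_EE openin_open by blast
  have "openin (powertop_real UNIV) T"
    using T(1) by (simp add: euclidean_product_topology)
  moreover have "x \<in> T" using x T by auto
  ultimately obtain X where X: "x \<in> Pi\<^sub>E UNIV X" "\<And>i. open (X i)" "Pi\<^sub>E UNIV X \<subseteq> T"
    using product_topology_open_contains_basis[of "\<lambda>_. euclideanreal" UNIV T x] by auto
  have "\<exists>e>0. \<forall>u. \<bar>u - x i\<bar> < e \<longrightarrow> u \<in> X i" for i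
  proof -
    have "x i \<in> X i" using X(1) by auto
    then obtain e where "e > 0" "ball (x i) e \<subseteq> X i"
      using X(2)[of i] open_contains_ball by blast
    then show ?thesis
      by (intro exI[of _ e]) (auto simp: dist_real_def subset_iff abs_minus_commute)
  qed
  then obtain e where e: "\<And>i. e i > 0" "\<And>i u. \<bar>u - x i\<bar> < e i \<Longrightarrow> u \<in> X i" by metis
  \<comment> \<open>\<open>insert 1\<close> keeps the minimum defined for
    \<open>n = 0\<close>.\<close>
  define d where "d = Min (insert 1 (e ` {..<n}))"
  have d: "d > 0" using e(1) by (auto simp: d_def)
  have dle: "d \<le> e j" if "j < n" for j using that by (auto simp: d_def)
  have "y \<in> S" if y: "y \<in> EE n" and b: "\<forall>j<n. \<bar>y j - x j\<bar> < d" for y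
  proof -
    have "y j \<in> X j" for j
    proof (cases "j < n")
      case True
      then show ?thesis using b dle[of j] e(2)[of "y j" j] by force
    next
      case False
      have "x \<in> EE n" using x openin_EE_subset[OF S] by auto
      then have "y j = x j" using y False by (auto simp: EE_iff)
      then show ?thesis using X(1) by auto
    qed
    then have "y \<in> T" using X(3) by auto
    then show ?thesis using T y by auto
  qed
  then show ?thesis using d by blast
qed

lemma EE_update [simp]: "x \<in> EE n \<Longrightarrow> i < n \<Longrightarrow> x(i := s) \<in> EE n"
  by (auto simp: EE_iff)

lemma eventually_update_in:
  assumes S: "openin (Euclidean_space n) S" and x: "x \<in> S" and i: "i < n"
  shows "\<forall>\<^sub>F s in nhds (x i). x(i := s) \<in> S"
proof (rule openin_EE_eventually[OF S _ x])
  show "((\<lambda>s. x(i := s)) \<longlongrightarrow> x) (nhds (x i))"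
  proof (rule tendsto_coordinatewise)
    fix j show "((\<lambda>s. (x(i := s)) j) \<longlongrightarrow> x j) (nhds (x i))"
      by (cases "j = i") (auto simp: filterlim_ident)
  qed
  show "\<forall>\<^sub>F s in nhds (x i). x(i := s) \<in> EE n"
    using openin_EE_subset[OF S] x i by (intro always_eventually) auto
qed

section \<open>Chain rule along curves from continuous partial derivatives\<close>

lemma C_on_continuous: "C_on r n S f \<Longrightarrow> S \<subseteq> EE n \<Longrightarrow> continuous_on S f"
  by (cases r) (auto simp: continuous_map_EE)

lemma C_on_partial_deriv:
  assumes "C_on (Suc r) n S f" "x \<in> S" "i < n"
  shows "((\<lambda>s. f (x(i := s))) has_real_derivative partial i f x) (at (x i))"
  using assms by (auto simp: partial_def DERIV_deriv_iff_real_differentiable)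

text \<open>Moves from \<open>x\<close> to \<open>y\<close> by changing one coordinate at a time and
  applies the one-dimensional mean value theorem on each edge. Only partial derivatives are assumed;
  the bounds on the intermediate points allow them to be squeezed towards \<open>x\<close>
  later.\<close>

lemma mean_value_telescope:
  assumes x: "x \<in> EE n" and y: "y \<in> EE n"
    and box: "\<And>z. z \<in> EE n \<Longrightarrow> (\<And>j. \<bar>z j - x j\<bar> \<le> \<bar>y j - x j\<bar>) \<Longrightarrow> z \<in> S"
    and f: "\<And>i z. i < n \<Longrightarrow> z \<in> S \<Longrightarrow>
      ((\<lambda>s. f (z(i := s))) has_real_derivative partial i f z) (at (z i))"
  shows "\<exists>z. (\<forall>i<n. z i \<in> S \<and> (\<forall>j. \<bar>z i j - x j\<bar> \<le> \<bar>y j - x j\<bar>)) \<and>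
    f y - f x = (\<Sum>i<n. partial i f (z i) * (y i - x i))"
proof -
  \<comment> \<open>\<open>m i\<close> is the corner reached after \<open>i\<close> edges: its first
    \<open>i\<close> coordinates are already those of \<open>y\<close>.\<close>
  define m where "m i = (\<lambda>j. if j < i then y j else x j)" for i :: nat
  have tele: "f y - f x = (\<Sum>i<n. f (m (Suc i)) - f (m i))"
  proof -
    have "m 0 = x" "m n = y" using x y by (auto simp: m_def EE_iff fun_eq_iff)
    then show ?thesis using sum_lessThan_telescope[of "\<lambda>i. f (m i)" n] by simp
  qed
  have "\<exists>z. z \<in> S \<and> (\<forall>j. \<bar>z j - x j\<bar> \<le> \<bar>y j - x j\<bar>) \<and>
     f (m (Suc i)) - f (m i) = partial i f z * (y i - x i)" if i: "i < n" for i
  proof -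
    have mE: "(m i)(i := s) \<in> EE n" for s
      using x y i by (auto simp: m_def EE_iff)
    have between: "\<bar>((m i)(i := s)) j - x j\<bar> \<le> \<bar>y j - x j\<bar>"
      if "min (x i) (y i) \<le> s" "s \<le> max (x i) (y i)" for s j
      using that by (auto simp: m_def min_def max_def split: if_splits)
    have inS: "(m i)(i := s) \<in> S" if "min (x i) (y i) \<le> s" "s \<le> max (x i) (y i)" for s
      using box[OF mE between[OF that]] .
    have der: "((\<lambda>s. f ((m i)(i := s))) has_real_derivative partial i f ((m i)(i := s))) (at s)"
      if "min (x i) (y i) \<le> s" "s \<le> max (x i) (y i)" for s
      using f[OF i inS[OF that]] by simp
    have e1: "m (Suc i) = (m i)(i := y i)" "m i = (m i)(i := x i)"
      by (auto simp: m_def fun_eq_iff less_Suc_eq)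
    let ?a = "min (x i) (y i)" and ?b = "max (x i) (y i)"
    show ?thesis
    proof (cases "?a < ?b")
      case True
      have "\<exists>z. ?a < z \<and> z < ?b \<and>
        f ((m i)(i := ?b)) - f ((m i)(i := ?a)) = (?b - ?a) * partial i f ((m i)(i := z))"
        by (rule MVT2[OF True]) (rule der, simp_all)
      then obtain z where z: "?a < z" "z < ?b"
        "f ((m i)(i := ?b)) - f ((m i)(i := ?a)) = (?b - ?a) * partial i f ((m i)(i := z))" by blast
      have "f ((m i)(i := y i)) - f ((m i)(i := x i)) = partial i f ((m i)(i := z)) * (y i - x i)"
        using z(3) by (cases "x i \<le> y i") (auto simp: min_def max_def algebra_simps)
      then have "f (m (Suc i)) - f (m i) = partial i f ((m i)(i := z)) * (y i - x i)"
        using e1 by metis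
      then show ?thesis using z inS[of z] between[of z]
        by (intro exI[of _ "(m i)(i := z)"]) auto
    next
      case False
      \<comment> \<open>A degenerate edge contributes zero, so any point of \<open>S\<close> within
        the bounds can serve as intermediate point.\<close>
      then have "x i = y i" by auto
      then have "m (Suc i) = m i" using e1 by metis
      moreover have "x \<in> S" using box[OF x] by auto
      ultimately show ?thesis using \<open>x i = y i\<close> by (intro exI[of _ x]) auto
    qed
  qed
  then obtain z where z: "\<And>i. i < n \<Longrightarrow> z i \<in> S \<and> (\<forall>j. \<bar>z i j - x j\<bar> \<le> \<bar>y j - x j\<bar>) \<and>
     f (m (Suc i)) - f (m i) = partial i f (z i) * (y i - x i)" by metis
  have "f y - f x = (\<Sum>i<n. partial i f (z i) * (y i - x i))"
    unfolding tele by (rule sum.cong) (use z in auto)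
  with z show ?thesis by blast
qed

text \<open>\<open>C_on\<close> speaks of partial derivatives only. The difference quotient along
  the curve is the sum of the partial derivatives at the points of
  \<open>mean_value_telescope\<close> times the quotients of the coordinates; those points tend to
  \<open>c t\<close>, and the partial derivatives are continuous.\<close>

lemma C_on_chain_curve:
  assumes S: "openin (Euclidean_space n) S" and f: "C_on (Suc r) n S f" and ct: "c t \<in> S"
    and ev: "\<forall>\<^sub>F s in at t. c s \<in> EE n"
    and c': "\<And>i. i < n \<Longrightarrow> ((\<lambda>s. c s i) has_real_derivative c' i) (at t)"
  shows "((\<lambda>s. f (c s)) has_real_derivative (\<Sum>i<n. partial i f (c t) * c' i)) (at t)"
proof -
  have SE: "S \<subseteq> EE n" using S by (rule openin_EE_subset)
  obtain e where e: "e > 0" "\<And>y. y \<in> EE n \<Longrightarrow> (\<And>j. j < n \<Longrightarrow> \<bar>y j - c t j\<bar> < e) \<Longrightarrow> y \<in> S"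
    using openin_EE_box[OF S ct] by blast
  have lim: "((\<lambda>s. c s j) \<longlongrightarrow> c t j) (at t)" for j
  proof (cases "j < n")
    case True
    then show ?thesis using DERIV_isCont[OF c'[OF True]] by (simp add: isCont_def)
  next
    case False
    have "\<forall>\<^sub>F s in at t. c s j = c t j"
      using ev by eventually_elim (use False SE ct in \<open>auto simp: EE_iff subset_iff\<close>)
    then show ?thesis by (rule tendsto_eventually)
  qed
  have "\<forall>\<^sub>F s in at t. \<bar>c s j - c t j\<bar> < e" for j
    using tendstoD[OF lim[of j] e(1)] by (simp add: dist_real_def)
  then have "\<forall>\<^sub>F s in at t. \<forall>j\<in>{..<n}. \<bar>c s j - c t j\<bar> < e"
    by (intro eventually_ball_finite) auto
  define P where "P s z \<longleftrightarrow> (\<forall>i<n. z i \<in> S \<and> (\<forall>j. \<bar>z i j - c t j\<bar> \<le> \<bar>c s j - c t j\<bar>)) \<and>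
    f (c s) - f (c t) = (\<Sum>i<n. partial i f (z i) * (c s i - c t i))" for s z
  have "\<forall>\<^sub>F s in at t. \<exists>z. P s z"
    using \<open>\<forall>\<^sub>F s in at t. \<forall>j\<in>{..<n}. \<bar>c s j - c t j\<bar> < e\<close> ev
  proof eventually_elim
    case (elim s)
    show ?case unfolding P_def
    proof (rule mean_value_telescope)
      show "c t \<in> EE n" using ct SE by auto
      show "c s \<in> EE n" by fact
      show "z \<in> S" if "z \<in> EE n" "\<And>j. \<bar>z j - c t j\<bar> \<le> \<bar>c s j - c t j\<bar>" for z
        using that elim(1) by (intro e(2)) (auto intro: le_less_trans)
      show "((\<lambda>s. f (z(i := s))) has_real_derivative partial i f z) (at (z i))"
        if "i < n" "z \<in> S" for i z
        using C_on_partial_deriv[OF f] that by auto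
    qed
  qed
  define Z where "Z s = (SOME z. P s z)" for s
  have PZ: "P s (Z s)" if "\<exists>z. P s z" for s
    using that unfolding Z_def by (rule someI_ex)
  have Z: "\<forall>\<^sub>F s in at t. P s (Z s)"
    by (rule eventually_mono[OF \<open>\<forall>\<^sub>F s in at t. \<exists>z. P s z\<close> PZ])
  have limZ: "((\<lambda>s. partial i f (Z s i)) \<longlongrightarrow> partial i f (c t)) (at t)" if i: "i < n" for i
  proof (rule continuous_on_tendsto_compose[of S "partial i f" _ "c t"])
    have "C_on r n S (partial i f)" using f i by auto
    then show "continuous_on S (partial i f)" using SE by (rule C_on_continuous)
    show "c t \<in> S" by fact
    show "\<forall>\<^sub>F s in at t. Z s i \<in> S" using Z by eventually_elim (use i in \<open>auto simp: P_def\<close>)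
    show "((\<lambda>s. Z s i) \<longlongrightarrow> c t) (at t)"
    proof (rule tendsto_coordinatewise)
      fix j
      have l0: "((\<lambda>s. c s j - c t j) \<longlongrightarrow> 0) (at t)" using LIM_zero[OF lim[of j]] .
      have "((\<lambda>s. Z s i j - c t j) \<longlongrightarrow> 0) (at t)"
      proof (rule Lim_null_comparison[OF _ tendsto_rabs_zero[OF l0]])
        show "\<forall>\<^sub>F s in at t. norm (Z s i j - c t j) \<le> \<bar>c s j - c t j\<bar>"
          using Z by eventually_elim (use i in \<open>auto simp: P_def\<close>)
      qed
      then show "((\<lambda>s. Z s i j) \<longlongrightarrow> c t j) (at t)" by (rule LIM_zero_cancel)
    qed
  qed
  have "((\<lambda>s. \<Sum>i<n. partial i f (Z s i) * ((c s i - c t i) / (s - t))) \<longlongrightarrow>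
      (\<Sum>i<n. partial i f (c t) * c' i)) (at t)"
    using c' by (intro tendsto_sum tendsto_mult limZ) (auto simp: has_field_derivative_iff)
  then have "((\<lambda>s. (f (c s) - f (c t)) / (s - t)) \<longlongrightarrow> (\<Sum>i<n. partial i f (c t) * c' i)) (at t)"
  proof (rule Lim_transform_eventually)
    show "\<forall>\<^sub>F s in at t. (\<Sum>i<n. partial i f (Z s i) * ((c s i - c t i) / (s - t))) =
        (f (c s) - f (c t)) / (s - t)"
      using Z by eventually_elim (simp add: P_def sum_divide_distrib)
  qed
  then show ?thesis by (simp add: has_field_derivative_iff)
qed

text \<open>A partial derivative at a point of \<open>S\<close> sees only values on
  \<open>S\<close>, because \<open>S\<close> is open and a small change of one coordinate stays
  inside.\<close>

lemma C_on_cong_imp: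
  assumes S: "openin (Euclidean_space n) S"
  shows "C_on r n S f \<Longrightarrow> (\<And>x. x \<in> S \<Longrightarrow> f x = g x) \<Longrightarrow> C_on r n S g"
proof (induction r arbitrary: f g)
  case 0
  then show ?case using openin_EE_subset[OF S]
    by (simp add: continuous_map_EE cong: continuous_on_cong)
next
  case (Suc r)
  have ev: "\<forall>\<^sub>F s in nhds (x i). f (x(i := s)) = g (x(i := s))" if "x \<in> S" "i < n" for x i
    using eventually_update_in[OF S that] by eventually_elim (use Suc.prems in auto)
  have D: "((\<lambda>s. g (x(i := s))) has_real_derivative partial i f x) (at (x i))" if "x \<in> S" "i < n" for x i
    using C_on_partial_deriv[OF Suc.prems(1) that] DERIV_cong_ev[OF refl ev[OF that] refl] by blast
  have "partial i f x = partial i g x" if "x \<in> S" "i < n" for x i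
    using DERIV_imp_deriv[OF D[OF that]] by (simp add: partial_def)
  moreover have "continuous_on S g"
    using C_on_continuous[OF Suc.prems(1) openin_EE_subset[OF S]] Suc.prems(2)
    by (simp cong: continuous_on_cong)
  ultimately show ?case
    using Suc.prems(1) Suc.IH openin_EE_subset[OF S]
    by (auto simp: continuous_map_EE real_differentiable_def simp del: fun_upd_apply intro: D)
qed

lemma C_on_Suc_D: "C_on (Suc r) n S f \<Longrightarrow> C_on r n S f"
  by (induction r arbitrary: f) auto

text \<open>Lets the derivative be given by a formula valid on \<open>S\<close> only; elsewhere
  \<open>partial i f\<close> may be anything, and \<open>C_on_cong_imp\<close> bridges the
  difference.\<close>

lemma C_on_SucI:
  assumes S: "openin (Euclidean_space n) S" and "continuous_on S f"
    and D: "\<And>i x. i < n \<Longrightarrow> x \<in> S \<Longrightarrow> ((\<lambda>s. f (x(i := s))) has_real_derivative f' i x) (at (x i))"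
    and "\<And>i. i < n \<Longrightarrow> C_on r n S (f' i)"
  shows "C_on (Suc r) n S f"
proof -
  have "partial i f x = f' i x" if "i < n" "x \<in> S" for i x
    using DERIV_imp_deriv[OF D[OF that]] by (simp add: partial_def)
  then have "C_on r n S (partial i f)" if "i < n" for i
    using C_on_cong_imp[OF S assms(4)[OF that], of "partial i f"] that by auto
  then show ?thesis using assms openin_EE_subset[OF S]
    by (auto simp: continuous_map_EE real_differentiable_def)
qed

section \<open>Closure properties of \<open>C_on\<close> and \<open>smooth_on\<close>\<close>

lemma C_on_const: "openin (Euclidean_space n) S \<Longrightarrow> C_on r n S (\<lambda>_. a)"
proof (induction r arbitrary: a)
  case 0 then show ?case by simp
next
  case (Suc r)
  show ?case by (rule C_on_SucI[where f'="\<lambda>_ _. 0"]) (use Suc in auto)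
qed

lemma C_on_coord: "openin (Euclidean_space n) S \<Longrightarrow> C_on r n S (\<lambda>x. x j)"
proof (cases r)
  case 0
  assume S: "openin (Euclidean_space n) S"
  have "continuous_on S (\<lambda>x. x j)" for S :: "(nat \<Rightarrow> real) set"
    by (rule continuous_on_product_then_coordinatewise[OF continuous_on_id])
  then show ?thesis using 0 openin_EE_subset[OF S] by (simp add: continuous_map_EE)
next
  case (Suc r)
  assume S: "openin (Euclidean_space n) S"
  show ?thesis unfolding Suc
  proof (rule C_on_SucI[OF S, where f'="\<lambda>i x. if i = j then 1 else 0"])
    show "continuous_on S (\<lambda>x. x j)"
      by (rule continuous_on_product_then_coordinatewise[OF continuous_on_id])
  qed (auto intro!: C_on_const S derivative_eq_intros)
qed

lemma C_on_add:
  assumes S: "openin (Euclidean_space n) S"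
  shows "C_on r n S f \<Longrightarrow> C_on r n S g \<Longrightarrow> C_on r n S (\<lambda>x. f x + g x)"
proof (induction r arbitrary: f g)
  case 0
  then show ?case using openin_EE_subset[OF S]
    by (auto simp: continuous_map_EE intro: continuous_on_add)
next
  case (Suc r)
  show ?case
  proof (rule C_on_SucI[OF S, where f'="\<lambda>i x. partial i f x + partial i g x"])
    show "continuous_on S (\<lambda>x. f x + g x)"
      using Suc.prems openin_EE_subset[OF S] by (intro continuous_on_add C_on_continuous)
    show "((\<lambda>s. f (x(i := s)) + g (x(i := s))) has_real_derivative
        partial i f x + partial i g x) (at (x i))" if "i < n" "x \<in> S" for i x
      by (rule DERIV_add[OF C_on_partial_deriv[OF Suc.prems(1) that(2,1)] C_on_partial_deriv[OF Suc.prems(2) that(2,1)]])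
    show "C_on r n S (\<lambda>x. partial i f x + partial i g x)" if "i < n" for i
      using Suc.prems that by (intro Suc.IH) auto
  qed
qed

lemma C_on_partial: "C_on (Suc r) n S f \<Longrightarrow> i < n \<Longrightarrow> C_on r n S (partial i f)"
  by simp

lemma C_on_mult:
  assumes S: "openin (Euclidean_space n) S"
  shows "C_on r n S f \<Longrightarrow> C_on r n S g \<Longrightarrow> C_on r n S (\<lambda>x. f x * g x)"
proof (induction r arbitrary: f g)
  case 0
  then show ?case using openin_EE_subset[OF S]
    by (auto simp: continuous_map_EE intro: continuous_on_mult)
next
  case (Suc r)
  show ?case
  proof (rule C_on_SucI[OF S, where f'="\<lambda>i x. partial i f x * g x + f x * partial i g x"])
    show "continuous_on S (\<lambda>x. f x * g x)"
      using Suc.prems openin_EE_subset[OF S] by (intro continuous_on_mult C_on_continuous)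
    show "((\<lambda>s. f (x(i := s)) * g (x(i := s))) has_real_derivative
        partial i f x * g x + f x * partial i g x) (at (x i))" if "i < n" "x \<in> S" for i x
      using DERIV_mult[OF C_on_partial_deriv[OF Suc.prems(1) that(2,1)] C_on_partial_deriv[OF Suc.prems(2) that(2,1)]]
      by (simp add: ac_simps del: fun_upd_apply)
    show "C_on r n S (\<lambda>x. partial i f x * g x + f x * partial i g x)" if "i < n" for i
      using Suc.prems that by (intro C_on_add[OF S] Suc.IH) (auto intro: C_on_Suc_D C_on_partial)
  qed
qed

lemma C_on_inverse:
  assumes S: "openin (Euclidean_space n) S"
  shows "C_on r n S f \<Longrightarrow> (\<And>x. x \<in> S \<Longrightarrow> f x \<noteq> 0) \<Longrightarrow> C_on r n S (\<lambda>x. inverse (f x))"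
proof (induction r arbitrary: f)
  case 0
  then show ?case using openin_EE_subset[OF S]
    by (auto simp: continuous_map_EE intro: continuous_on_inverse)
next
  case (Suc r)
  show ?case
  \<comment> \<open>Written as a product of a constant, \<open>partial i f\<close> and two copies of
    the inverse, so that the product rule and the induction hypothesis at order \<open>r\<close>
    apply.\<close>
  proof (rule C_on_SucI[OF S, where f'="\<lambda>i x. (-1) * (inverse (f x) * partial i f x * inverse (f x))"])
    show "continuous_on S (\<lambda>x. inverse (f x))"
      using C_on_continuous[OF Suc.prems(1) openin_EE_subset[OF S]] Suc.prems(2)
      by (intro continuous_on_inverse) auto
    show "((\<lambda>s. inverse (f (x(i := s)))) has_real_derivative
        (-1) * (inverse (f x) * partial i f x * inverse (f x))) (at (x i))" if "i < n" "x \<in> S" for i x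
      using DERIV_inverse'[OF C_on_partial_deriv[OF Suc.prems(1) that(2,1)]] Suc.prems(2) that
      by (simp del: fun_upd_apply)
    show "C_on r n S (\<lambda>x. (-1) * (inverse (f x) * partial i f x * inverse (f x)))" if "i < n" for i
      using Suc.prems that by (intro C_on_mult[OF S] Suc.IH C_on_const[OF S]) (auto intro: C_on_Suc_D C_on_partial)
  qed
qed

lemma C_on_subset:
  assumes "openin (Euclidean_space n) T" "T \<subseteq> S" "S \<subseteq> EE n"
  shows "C_on r n S f \<Longrightarrow> C_on r n T f"
proof (induction r arbitrary: f)
  case 0
  then show ?case using assms by (auto simp: continuous_map_EE intro: continuous_on_subset)
next
  case (Suc r)
  then show ?case using assms by (auto simp: continuous_map_EE intro: continuous_on_subset)
qed

lemma smooth_on_openin: "smooth_on n S f \<Longrightarrow> openin (Euclidean_space n) S"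
  by (simp add: smooth_on_def)

lemma smooth_on_cong:
  assumes "smooth_on n S f" "\<And>x. x \<in> S \<Longrightarrow> f x = g x"
  shows "smooth_on n S g"
  using assms C_on_cong_imp[of n S _ f g] unfolding smooth_on_def by blast

lemma smooth_on_subset:
  assumes "smooth_on n S f" "openin (Euclidean_space n) T" "T \<subseteq> S"
  shows "smooth_on n T f"
  using assms C_on_subset openin_EE_subset by (auto simp: smooth_on_def)

lemma smooth_on_const: "openin (Euclidean_space n) S \<Longrightarrow> smooth_on n S (\<lambda>_. a)"
  by (simp add: smooth_on_def C_on_const)

lemma smooth_on_coord: "openin (Euclidean_space n) S \<Longrightarrow> smooth_on n S (\<lambda>x. x j)"
  by (simp add: smooth_on_def C_on_coord)

lemma smooth_on_add: "smooth_on n S f \<Longrightarrow> smooth_on n S g \<Longrightarrow> smooth_on n S (\<lambda>x. f x + g x)"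
  by (simp add: smooth_on_def C_on_add)

lemma smooth_on_mult: "smooth_on n S f \<Longrightarrow> smooth_on n S g \<Longrightarrow> smooth_on n S (\<lambda>x. f x * g x)"
  by (simp add: smooth_on_def C_on_mult)

lemma smooth_on_diff:
  assumes "smooth_on n S f" "smooth_on n S g" shows "smooth_on n S (\<lambda>x. f x - g x)"
  using smooth_on_add[OF assms(1) smooth_on_mult[OF smooth_on_const[of n S "-1"] assms(2)]] assms
  by (simp add: smooth_on_openin)

lemma smooth_on_divide:
  assumes "smooth_on n S f" "smooth_on n S g" "\<And>x. x \<in> S \<Longrightarrow> g x \<noteq> 0"
  shows "smooth_on n S (\<lambda>x. f x / g x)"
  unfolding divide_inverse using assms by (auto simp: smooth_on_def intro!: C_on_mult C_on_inverse)

lemma smooth_on_sum: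
  assumes "openin (Euclidean_space n) S" "\<And>i. i \<in> A \<Longrightarrow> smooth_on n S (f i)"
  shows "smooth_on n S (\<lambda>x. \<Sum>i\<in>A. f i x)"
  using assms
  by (induction A rule: infinite_finite_induct) (auto intro: smooth_on_const smooth_on_add)

lemma smooth_on_partial: "smooth_on n S f \<Longrightarrow> i < n \<Longrightarrow> smooth_on n S (partial i f)"
  using C_on_partial by (auto simp: smooth_on_def simp del: C_on.simps)

lemma smooth_on_continuous: "smooth_on n S f \<Longrightarrow> continuous_on S f"
  using C_on_continuous openin_EE_subset unfolding smooth_on_def by metis

lemma smooth_on_chain_curve:
  assumes "smooth_on n S f" "c t \<in> S" "\<forall>\<^sub>F s in at t. c s \<in> EE n"
    "\<And>i. i < n \<Longrightarrow> ((\<lambda>s. c s i) has_real_derivative c' i) (at t)"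
  shows "((\<lambda>s. f (c s)) has_real_derivative (\<Sum>i<n. partial i f (c t) * c' i)) (at t)"
  using assms C_on_chain_curve[of n S 0 f c t c'] unfolding smooth_on_def by blast

lemma smooth_on_partial_deriv:
  assumes "smooth_on n S f" "x \<in> S" "i < n"
  shows "((\<lambda>s. f (x(i := s))) has_real_derivative partial i f x) (at (x i))"
  using assms C_on_partial_deriv[of 0 n S f x i] unfolding smooth_on_def by blast

lemma partial_cong:
  assumes "openin (Euclidean_space n) S" "x \<in> S" "i < n" "\<And>y. y \<in> S \<Longrightarrow> f y = g y"
  shows "partial i f x = partial i g x"
proof -
  have "\<forall>\<^sub>F s in nhds (x i). f (x(i := s)) = g (x(i := s))"
    using eventually_update_in[OF assms(1-3)] by eventually_elim (use assms(4) in auto)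
  then show ?thesis unfolding partial_def by (rule deriv_cong_ev) simp
qed

text \<open>The induction on the order varies \<open>f\<close> and keeps \<open>h\<close>: a partial
  derivative of the composite is a sum of products of \<open>partial j f\<close> composed with
  \<open>h\<close>, covered by the induction hypothesis, and a partial derivative of
  \<open>h\<close>, smooth to every order. Hence \<open>f\<close> is assumed smooth rather than of
  class \<open>r\<close>.\<close>

lemma smooth_on_compose:
  assumes T: "openin (Euclidean_space m) T"
    and h: "\<And>j. j < n \<Longrightarrow> smooth_on m T (\<lambda>y. h y j)" and hS: "\<And>y. y \<in> T \<Longrightarrow> h y \<in> S"
    and f: "smooth_on n S f"
  shows "smooth_on m T (\<lambda>y. f (h y))"
proof -
  have S: "openin (Euclidean_space n) S" using f by (rule smooth_on_openin)
  have hE: "h y \<in> EE n" if "y \<in> T" for y using openin_EE_subset[OF S] hS that by auto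
  have hc: "continuous_on T h"
  proof (rule continuous_on_coordinatewise_then_product)
    fix j show "continuous_on T (\<lambda>y. h y j)"
    proof (cases "j < n")
      case True then show ?thesis using h smooth_on_continuous by blast
    next
      case False
      then have "continuous_on T (\<lambda>y. h y j) \<longleftrightarrow> continuous_on T (\<lambda>y. 0::real)"
        using hE by (intro continuous_on_cong) (auto simp: EE_iff)
      then show ?thesis by simp
    qed
  qed
  have "C_on r m T (\<lambda>y. f (h y))" for r
    using f
  proof (induction r arbitrary: f)
    case 0
    have "continuous_on T (\<lambda>y. f (h y))"
      using hS by (intro continuous_on_compose2[OF smooth_on_continuous[OF 0] hc]) auto
    then show ?case using openin_EE_subset[OF T] by (simp add: continuous_map_EE)
  next
    case (Suc r)
    show ?case
    proof (rule C_on_SucI[OF T, where f'="\<lambda>i y. \<Sum>j<n. partial j f (h y) * partial i (\<lambda>y. h y j) y"])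
      show "continuous_on T (\<lambda>y. f (h y))"
        using hS by (intro continuous_on_compose2[OF smooth_on_continuous[OF Suc.prems] hc]) auto
      fix i assume i: "i < m"
      show "((\<lambda>s. f (h (y(i := s)))) has_real_derivative
          (\<Sum>j<n. partial j f (h y) * partial i (\<lambda>y. h y j) y)) (at (y i))" if y: "y \<in> T" for y
      proof -
        have "\<forall>\<^sub>F s in at (y i). h (y(i := s)) \<in> EE n"
          using eventually_nhds_conv_at[THEN iffD1, OF eventually_update_in[OF T y i]] hE
          by (auto elim: eventually_mono)
        then have "((\<lambda>s. f (h (y(i := s)))) has_real_derivative
          (\<Sum>j<n. partial j f (h (y(i := y i))) * partial i (\<lambda>y. h y j) y)) (at (y i))"
          by (intro smooth_on_chain_curve[OF Suc.prems, where c="\<lambda>s. h (y(i := s))"])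
            (use hS y i smooth_on_partial_deriv[OF h] in auto)
        then show ?thesis by simp
      qed
      have 1: "C_on r m T (partial i (\<lambda>y. h y j))" if "j < n" for j
        using smooth_on_partial[OF h[OF that] i] by (simp add: smooth_on_def)
      have 2: "C_on r m T (\<lambda>y. partial j f (h y))" if "j < n" for j
        using Suc.IH[OF smooth_on_partial[OF Suc.prems that]] .
      have "C_on r m T (\<lambda>y. \<Sum>j\<in>A. F j y)" if "finite A" "\<And>j. j \<in> A \<Longrightarrow> C_on r m T (F j)"
        for A :: "nat set" and F
        using that by (induction A rule: finite_induct) (auto intro: C_on_add[OF T] C_on_const[OF T])
      note sum_rule = this
      show "C_on r m T (\<lambda>y. \<Sum>j<n. partial j f (h y) * partial i (\<lambda>y. h y j) y)"
        using 1 2 by (intro sum_rule C_on_mult[OF T]) auto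
    qed
  qed
  then show ?thesis using T by (simp add: smooth_on_def)
qed

subsection \<open>Smooth functions of one variable\<close>

text \<open>The form in which \<open>smooth_curve\<close> states smoothness, by iterated
  \<open>deriv\<close>. \<open>smooth1_iff\<close> identifies it with \<open>smooth_on\<close> in
  dimension one, from which sums, products and compositions are inherited.\<close>

definition smooth1 :: "real set \<Rightarrow> (real \<Rightarrow> real) \<Rightarrow> bool" where
  "smooth1 I f \<longleftrightarrow> open I \<and> (\<forall>t\<in>I. \<forall>r. (deriv ^^ r) f differentiable (at t))"

definition line_domain :: "real set \<Rightarrow> (nat \<Rightarrow> real) set" where
  "line_domain I = {x \<in> EE (Suc 0). x 0 \<in> I}"

lemma openin_coord_preimage:
  assumes "open I"
  shows "openin (Euclidean_space n) {x \<in> EE n. x i \<in> I}"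
proof -
  have "continuous_map (Euclidean_space n) euclideanreal (\<lambda>x. x i)"
    unfolding continuous_map_Euclidean_space_iff
    by (rule continuous_on_product_then_coordinatewise[OF continuous_on_id])
  from openin_continuous_map_preimage[OF this, of I] assms show ?thesis by simp
qed

lemma openin_line_domain: "open I \<Longrightarrow> openin (Euclidean_space (Suc 0)) (line_domain I)"
  unfolding line_domain_def by (rule openin_coord_preimage)

lemma partial_fun_of_coord: "partial i (\<lambda>x. f (x i)) = (\<lambda>x. deriv f (x i))"
  by (simp add: partial_def fun_eq_iff)

lemma smooth1_deriv: "smooth1 I f \<Longrightarrow> smooth1 I (deriv f)"
  unfolding smooth1_def
  by (metis comp_apply funpow_Suc_right)

lemma smooth1_D:
  assumes "smooth1 I f" "t \<in> I"
  shows "(f has_real_derivative deriv f t) (at t)"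
proof -
  have "(deriv ^^ 0) f differentiable (at t)"
    using assms unfolding smooth1_def by blast
  then show ?thesis by (simp add: DERIV_deriv_iff_real_differentiable)
qed

lemma smooth1_open: "smooth1 I f \<Longrightarrow> open I"
  by (simp add: smooth1_def)

lemma smooth1_higher_deriv: "smooth1 I f \<Longrightarrow> smooth1 I ((deriv ^^ r) f)"
  by (induction r) (auto intro: smooth1_deriv)

lemma smooth1_imp_smooth_on_coord:
  assumes "smooth1 I f" "i < n"
  shows "smooth_on n {x \<in> EE n. x i \<in> I} (\<lambda>x. f (x i))"
proof -
  have S: "openin (Euclidean_space n) {x \<in> EE n. x i \<in> I}"
    using openin_coord_preimage smooth1_open[OF assms(1)] by blast
  have "C_on r n {x \<in> EE n. x i \<in> I} (\<lambda>x. f (x i))" for r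
    using assms(1)
  proof (induction r arbitrary: f)
    case 0
    have "continuous_on I f"
      using smooth1_D[OF 0] by (meson DERIV_continuous continuous_at_imp_continuous_on)
    then have "continuous_on {x \<in> EE n. x i \<in> I} (\<lambda>x. f (x i))"
      by (rule continuous_on_compose2) (auto intro: continuous_on_product_then_coordinatewise[OF continuous_on_id])
    then show ?case using openin_EE_subset[OF S] by (simp add: continuous_map_EE)
  next
    case (Suc r)
    have "continuous_on I f"
      using smooth1_D[OF Suc.prems] by (meson DERIV_continuous continuous_at_imp_continuous_on)
    then have c: "continuous_on {x \<in> EE n. x i \<in> I} (\<lambda>x. f (x i))"
      by (rule continuous_on_compose2) (auto intro: continuous_on_product_then_coordinatewise[OF continuous_on_id])
    show ?case
    proof (rule C_on_SucI[OF S c, where f'="\<lambda>j x. if j = i then deriv f (x i) else 0"])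
      fix j x assume "j < n" "x \<in> {x \<in> EE n. x i \<in> I}"
      then show "((\<lambda>s. f ((x(j := s)) i)) has_real_derivative (if j = i then deriv f (x i) else 0)) (at (x j))"
        using smooth1_D[OF Suc.prems] by (cases "j = i") auto
    next
      fix j assume "j < n"
      show "C_on r n {x \<in> EE n. x i \<in> I} (\<lambda>x. if j = i then deriv f (x i) else 0)"
        using Suc.IH[OF smooth1_deriv[OF Suc.prems]] C_on_const[OF S] by (cases "j = i") auto
    qed
  qed
  then show ?thesis using S by (simp add: smooth_on_def)
qed

lemma smooth1_iff:
  assumes "open I"
  shows "smooth1 I f \<longleftrightarrow> smooth_on (Suc 0) (line_domain I) (\<lambda>x. f (x 0))"
proof
  assume "smooth1 I f"
  then show "smooth_on (Suc 0) (line_domain I) (\<lambda>x. f (x 0))"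
    unfolding line_domain_def by (rule smooth1_imp_smooth_on_coord) simp
next
  assume f: "smooth_on (Suc 0) (line_domain I) (\<lambda>x. f (x 0))"
  have s: "smooth_on (Suc 0) (line_domain I) (\<lambda>x. (deriv ^^ r) f (x 0))" for r
  proof (induction r)
    case 0 then show ?case using f by simp
  next
    case (Suc r)
    then show ?case using smooth_on_partial[OF Suc, of 0] by (simp add: partial_fun_of_coord)
  qed
  have "(deriv ^^ r) f differentiable (at t)" if "t \<in> I" for r t
  proof -
    have "(\<lambda>j. if j = 0 then t else 0) \<in> line_domain I" using that by (auto simp: line_domain_def EE_iff)
    from smooth_on_partial_deriv[OF s this, of 0 r] show ?thesis
      by (auto simp: real_differentiable_def)
  qed
  then show "smooth1 I f" using assms by (simp add: smooth1_def)
qed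

lemma smooth1_cong:
  assumes "smooth1 I f" "\<And>t. t \<in> I \<Longrightarrow> f t = g t"
  shows "smooth1 I g"
proof -
  have "open I" using assms(1) by (rule smooth1_open)
  then show ?thesis
    using assms smooth_on_cong[of "Suc 0" "line_domain I" "\<lambda>x. f (x 0)" "\<lambda>x. g (x 0)"]
    by (simp add: smooth1_iff line_domain_def)
qed

lemma smooth1_subset: "smooth1 I f \<Longrightarrow> open J \<Longrightarrow> J \<subseteq> I \<Longrightarrow> smooth1 J f"
  by (auto simp: smooth1_def)

lemma smooth1_const: "open I \<Longrightarrow> smooth1 I (\<lambda>_. a)"
  by (simp add: smooth1_iff smooth_on_const openin_line_domain)

lemma smooth1_ident: "open I \<Longrightarrow> smooth1 I (\<lambda>t. t)"
  by (simp add: smooth1_iff smooth_on_coord openin_line_domain)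

lemma smooth1_add: "smooth1 I f \<Longrightarrow> smooth1 I g \<Longrightarrow> smooth1 I (\<lambda>t. f t + g t)"
  using smooth1_open[of I f] by (simp add: smooth1_iff smooth_on_add)

lemma smooth1_mult: "smooth1 I f \<Longrightarrow> smooth1 I g \<Longrightarrow> smooth1 I (\<lambda>t. f t * g t)"
  using smooth1_open[of I f] by (simp add: smooth1_iff smooth_on_mult)

lemma smooth1_sum: "open I \<Longrightarrow> (\<And>i. i \<in> A \<Longrightarrow> smooth1 I (f i)) \<Longrightarrow> smooth1 I (\<lambda>t. \<Sum>i\<in>A. f i t)"
  by (simp add: smooth1_iff smooth_on_sum openin_line_domain)

lemma smooth1_compose:
  assumes "smooth_on n S f" "open I" "\<And>i. i < n \<Longrightarrow> smooth1 I (\<lambda>t. c t i)" "\<And>t. t \<in> I \<Longrightarrow> c t \<in> S"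
  shows "smooth1 I (\<lambda>t. f (c t))"
proof -
  have "smooth_on (Suc 0) (line_domain I) (\<lambda>x. f (c (x 0)))"
    by (rule smooth_on_compose[OF openin_line_domain[OF assms(2)] _ _ assms(1)])
      (use assms in \<open>auto simp: smooth1_iff line_domain_def\<close>)
  then show ?thesis using assms(2) by (simp add: smooth1_iff)
qed

lemma smooth1_comp:
  assumes "smooth1 I f" "smooth1 J h" "\<And>t. t \<in> J \<Longrightarrow> h t \<in> I"
  shows "smooth1 J (\<lambda>t. f (h t))"
proof -
  have f: "smooth_on (Suc 0) (line_domain I) (\<lambda>x. f (x 0))"
    using assms(1) smooth1_iff smooth1_open by blast
  show ?thesis
    using smooth1_compose[OF f smooth1_open[OF assms(2)], of "\<lambda>t j. if j = 0 then h t else 0"] assms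
    by (simp add: line_domain_def EE_iff)
qed

lemma smooth_on_comp_smooth1:
  assumes "smooth1 I f" "smooth_on n S h" "\<And>x. x \<in> S \<Longrightarrow> h x \<in> I"
  shows "smooth_on n S (\<lambda>x. f (h x))"
proof -
  have f: "smooth_on (Suc 0) (line_domain I) (\<lambda>x. f (x 0))"
    using assms(1) smooth1_iff smooth1_open by blast
  show ?thesis
    using smooth_on_compose[OF smooth_on_openin[OF assms(2)] _ _ f, of "\<lambda>x j. if j = 0 then h x else 0"] assms
    by (simp add: line_domain_def EE_iff)
qed

lemma smooth1_chain:
  assumes f: "smooth_on n S f" and I: "open I" and c: "\<And>i. i < n \<Longrightarrow> smooth1 I (\<lambda>t. c t i)"
    and cS: "\<And>t. t \<in> I \<Longrightarrow> c t \<in> S" and t: "t \<in> I"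
  shows "((\<lambda>s. f (c s)) has_real_derivative (\<Sum>i<n. partial i f (c t) * deriv (\<lambda>s. c s i) t)) (at t)"
proof (rule smooth_on_chain_curve[OF f])
  show "c t \<in> S" using cS t .
  have "\<forall>\<^sub>F s in at t. s \<in> I" using I t by (rule eventually_at_in_open')
  then show "\<forall>\<^sub>F s in at t. c s \<in> EE n"
    by eventually_elim (use cS openin_EE_subset[OF smooth_on_openin[OF f]] in auto)
qed (use smooth1_D[OF c t] in auto)

lemma higher_deriv_shift: "(deriv ^^ r) (\<lambda>t. f (a + t)) = (\<lambda>t. (deriv ^^ r) f (a + t :: real))"
proof (induction r)
  case (Suc r)
  have "deriv (\<lambda>t. F (a + t)) = (\<lambda>t. deriv F (a + t))" for F :: "real \<Rightarrow> real"
    using DERIV_shift[of F _ _ a] by (auto simp: deriv_def fun_eq_iff add.commute)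
  then show ?case using Suc by simp
qed simp

lemma smooth1_shift:
  assumes "smooth1 I f" shows "smooth1 {t. a + t \<in> I} (\<lambda>t. f (a + t))"
proof -
  have "open {t. a + t \<in> I}"
    using open_vimage[OF smooth1_open[OF assms], of "\<lambda>t. a + t"]
    by (simp add: vimage_def continuous_on_add)
  moreover have "smooth1 {t. a + t \<in> I} (\<lambda>t. a + t)"
    by (intro smooth1_add smooth1_const smooth1_ident calculation)
  ultimately show ?thesis by (intro smooth1_comp[OF assms]) auto
qed

lemma deriv_cong_open:
  assumes "open I" "t \<in> I" "\<And>s. s \<in> I \<Longrightarrow> f s = g s"
  shows "(deriv ^^ r) f t = (deriv ^^ r) g t"
  using eventually_nhds_in_open[OF assms(1,2)] assms(3)
  by (intro higher_deriv_cong_ev) (auto elim: eventually_mono)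

lemma higher_deriv_poly: "(deriv ^^ r) (poly p) = poly ((pderiv ^^ r) p)" for p :: "real poly"
proof (induction r)
  case (Suc r)
  have "deriv (poly q) = poly (pderiv q)" for q :: "real poly"
    by (intro ext DERIV_imp_deriv poly_DERIV)
  then show ?case using Suc by simp
qed simp

lemma smooth1_poly: "smooth1 UNIV (poly p)"
  unfolding smooth1_def higher_deriv_poly by (auto simp: real_differentiable_def intro: poly_DERIV)

text \<open>The Taylor polynomial does it. Such polynomials supply the curves and families with
  prescribed jet coordinates in \<open>jet_exists\<close> and \<open>family_exists\<close>.\<close>

lemma poly_with_derivs:
  fixes a :: "nat \<Rightarrow> real"
  shows "\<exists>p. \<forall>r\<le>k. (deriv ^^ r) (poly p) 0 = a r"
proof (intro exI allI impI)
  fix r assume "r \<le> k"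
  let ?p = "Poly (map (\<lambda>r. a r / fact r) [0..<Suc k])"
  have "coeff ?p r = a r / fact r"
    using \<open>r \<le> k\<close> by (simp add: nth_default_def less_Suc_eq_le del: upt_Suc)
  then show "(deriv ^^ r) (poly ?p) 0 = a r"
    by (simp add: higher_deriv_poly poly_0_coeff_0 coeff_higher_pderiv pochhammer_fact[symmetric])
qed


subsection \<open>Symmetry of second partial derivatives\<close>

text \<open>The mean value theorem is used twice: in direction \<open>i\<close> for the difference
  over an edge in direction \<open>j\<close>, then in direction \<open>j\<close> for
  \<open>partial i f\<close>. The point is that the second difference on the left is symmetric in
  \<open>i\<close> and \<open>j\<close>.\<close>

lemma mixed_difference:
  assumes f: "smooth_on n S f" and ij: "i < n" "j < n" "i \<noteq> j" and x: "x \<in> EE n" and h: "h > 0"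
    and box: "\<And>y. y \<in> EE n \<Longrightarrow> (\<And>l. \<bar>y l - x l\<bar> \<le> h) \<Longrightarrow> y \<in> S"
  shows "\<exists>z\<in>S. (\<forall>l. \<bar>z l - x l\<bar> \<le> h) \<and>
    f (x(i := x i + h, j := x j + h)) - f (x(i := x i + h)) - f (x(j := x j + h)) + f x
      = h * (h * partial j (partial i f) z)"
proof -
  define w where "w s t = x(i := s, j := t)" for s t
  have wS: "w s t \<in> S" if "x i \<le> s" "s \<le> x i + h" "x j \<le> t" "t \<le> x j + h" for s t
    using that x ij h by (intro box) (auto simp: w_def)
  have Di: "((\<lambda>s. g (w s t)) has_real_derivative partial i g (w s t)) (at s)"
    if "smooth_on n S g" "x i \<le> s" "s \<le> x i + h" "x j \<le> t" "t \<le> x j + h" for s t g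
  proof -
    have "(w s t)(i := s') = w s' t" for s' using ij by (auto simp: w_def)
    then show ?thesis using smooth_on_partial_deriv[OF that(1) wS[OF that(2-5)] ij(1)] ij
      by (simp add: w_def)
  qed
  have Dj: "((\<lambda>t. g (w s t)) has_real_derivative partial j g (w s t)) (at t)"
    if "smooth_on n S g" "x i \<le> s" "s \<le> x i + h" "x j \<le> t" "t \<le> x j + h" for s t g
  proof -
    have "(w s t)(j := s') = w s s'" for s' using ij by (auto simp: w_def)
    then show ?thesis using smooth_on_partial_deriv[OF that(1) wS[OF that(2-5)] ij(2)] ij
      by (simp add: w_def)
  qed
  have "\<exists>s>x i. s < x i + h \<and>
    (f (w (x i + h) (x j + h)) - f (w (x i + h) (x j))) - (f (w (x i) (x j + h)) - f (w (x i) (x j)))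
     = (x i + h - x i) * (partial i f (w s (x j + h)) - partial i f (w s (x j)))"
    by (rule MVT2[where f="\<lambda>s. f (w s (x j + h)) - f (w s (x j))"]) (use h f in \<open>auto intro!: DERIV_diff Di\<close>)
  then obtain s where s: "s > x i" "s < x i + h"
    "(f (w (x i + h) (x j + h)) - f (w (x i + h) (x j))) - (f (w (x i) (x j + h)) - f (w (x i) (x j)))
     = h * (partial i f (w s (x j + h)) - partial i f (w s (x j)))" by auto
  have "\<exists>t>x j. t < x j + h \<and> partial i f (w s (x j + h)) - partial i f (w s (x j))
     = (x j + h - x j) * partial j (partial i f) (w s t)"
    by (rule MVT2[where f="\<lambda>t. partial i f (w s t)"])
      (use h s in \<open>auto intro!: Dj smooth_on_partial[OF f ij(1)]\<close>)
  then obtain t where t: "t > x j" "t < x j + h"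
    "partial i f (w s (x j + h)) - partial i f (w s (x j)) = h * partial j (partial i f) (w s t)" by auto
  have w: "w (x i + h) (x j + h) = x(i := x i + h, j := x j + h)" "w (x i + h) (x j) = x(i := x i + h)"
    "w (x i) (x j + h) = x(j := x j + h)" "w (x i) (x j) = x"
    using ij by (auto simp: w_def fun_eq_iff)
  have "w s t \<in> S" using s t by (intro wS) auto
  moreover have "\<bar>w s t l - x l\<bar> \<le> h" for l using s t h by (auto simp: w_def)
  moreover have "f (x(i := x i + h, j := x j + h)) - f (x(i := x i + h)) - f (x(j := x j + h)) + f x
      = h * (h * partial j (partial i f) (w s t))"
    using s(3) unfolding t(3) w by simp
  ultimately show ?thesis by blast
qed

text \<open>Both orders of differentiation express the same second difference divided by
  \<open>h * h\<close>. The intermediate points differ, but both tend to \<open>x\<close> with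
  \<open>h\<close>, so continuity of the second partial derivatives gives equal limits.\<close>

lemma partial_commute:
  assumes f: "smooth_on n S f" and x: "x \<in> S" and ij: "i < n" "j < n"
  shows "partial i (partial j f) x = partial j (partial i f) x"
proof (cases "i = j")
  case False
  have S: "openin (Euclidean_space n) S" using f by (rule smooth_on_openin)
  have xE: "x \<in> EE n" using openin_EE_subset[OF S] x by auto
  obtain e where e: "e > 0" "\<And>y. y \<in> EE n \<Longrightarrow> (\<And>l. l < n \<Longrightarrow> \<bar>y l - x l\<bar> < e) \<Longrightarrow> y \<in> S"
    using openin_EE_box[OF S x] by blast
  have lim: "\<exists>Z. (\<forall>h. 0 < h \<and> h < e \<longrightarrow>
      f (x(i := x i + h, j := x j + h)) - f (x(i := x i + h)) - f (x(j := x j + h)) + f x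
      = h * (h * partial j (partial i f) (Z h))) \<and>
      ((\<lambda>h. partial j (partial i f) (Z h)) \<longlongrightarrow> partial j (partial i f) x) (at_right 0)"
    if ij: "i < n" "j < n" "i \<noteq> j" for i j
  proof -
    have "\<exists>z\<in>S. (\<forall>l. \<bar>z l - x l\<bar> \<le> h) \<and>
        f (x(i := x i + h, j := x j + h)) - f (x(i := x i + h)) - f (x(j := x j + h)) + f x
      = h * (h * partial j (partial i f) z)" if "0 < h \<and> h < e" for h
      by (rule mixed_difference[OF f ij xE]) (use that e(2) in \<open>auto intro: le_less_trans\<close>)
    then obtain Z where Z: "\<And>h. 0 < h \<and> h < e \<Longrightarrow> Z h \<in> S \<and> (\<forall>l. \<bar>Z h l - x l\<bar> \<le> h) \<and>
        f (x(i := x i + h, j := x j + h)) - f (x(i := x i + h)) - f (x(j := x j + h)) + f x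
      = h * (h * partial j (partial i f) (Z h))" by metis
    have ev: "\<forall>\<^sub>F h in at_right 0. 0 < h \<and> h < e"
      using e(1) by (auto simp: eventually_at_right_field)
    have "((\<lambda>h. partial j (partial i f) (Z h)) \<longlongrightarrow> partial j (partial i f) x) (at_right 0)"
    proof (rule continuous_on_tendsto_compose[OF smooth_on_continuous[OF smooth_on_partial[OF smooth_on_partial[OF f ij(1)] ij(2)]] _ x])
      show "\<forall>\<^sub>F h in at_right 0. Z h \<in> S" using ev by eventually_elim (use Z in auto)
      show "(Z \<longlongrightarrow> x) (at_right 0)"
      proof (rule tendsto_coordinatewise)
        fix l
        have "((\<lambda>h. Z h l - x l) \<longlongrightarrow> 0) (at_right 0)"
        proof (rule Lim_null_comparison[where g="\<lambda>h. h"])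
          show "\<forall>\<^sub>F h in at_right 0. norm (Z h l - x l) \<le> h"
            using ev by eventually_elim (use Z in auto)
        qed (rule tendsto_ident_at)
        then show "((\<lambda>h. Z h l) \<longlongrightarrow> x l) (at_right 0)" by (rule LIM_zero_cancel)
      qed
    qed
    then show ?thesis using Z by blast
  qed
  obtain Z1 where Z1: "\<And>h. 0 < h \<and> h < e \<Longrightarrow>
      f (x(i := x i + h, j := x j + h)) - f (x(i := x i + h)) - f (x(j := x j + h)) + f x
      = h * (h * partial j (partial i f) (Z1 h))"
     "((\<lambda>h. partial j (partial i f) (Z1 h)) \<longlongrightarrow> partial j (partial i f) x) (at_right 0)"
    using lim[OF ij False] by blast
  obtain Z2 where Z2: "\<And>h. 0 < h \<and> h < e \<Longrightarrow>
      f (x(j := x j + h, i := x i + h)) - f (x(j := x j + h)) - f (x(i := x i + h)) + f x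
      = h * (h * partial i (partial j f) (Z2 h))"
     "((\<lambda>h. partial i (partial j f) (Z2 h)) \<longlongrightarrow> partial i (partial j f) x) (at_right 0)"
    using lim[OF ij(2,1)] False by metis
  have "\<forall>\<^sub>F h in at_right 0. 0 < h \<and> h < e"
    using e(1) by (auto simp: eventually_at_right_field)
  then have "\<forall>\<^sub>F h in at_right 0. partial j (partial i f) (Z1 h) = partial i (partial j f) (Z2 h)"
  proof eventually_elim
    case (elim h)
    have "x(i := x i + h, j := x j + h) = x(j := x j + h, i := x i + h)"
      using False by (auto simp: fun_eq_iff)
    then have "h * (h * partial j (partial i f) (Z1 h)) = h * (h * partial i (partial j f) (Z2 h))"
      unfolding Z1(1)[OF elim, symmetric] Z2(1)[OF elim, symmetric] by simp
    then show ?case using elim by simp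
  qed
  from Lim_transform_eventually[OF Z1(2) this] Z2(2) show ?thesis
    by (intro tendsto_unique[OF trivial_limit_at_right_real])
qed simp


subsection \<open>Total derivatives of functions of jets\<close>

definition trunc :: "nat \<Rightarrow> (nat \<Rightarrow> real) \<Rightarrow> nat \<Rightarrow> real" where
  "trunc N \<xi> = (\<lambda>j. if j < N then \<xi> j else 0)"

definition depends_below :: "nat \<Rightarrow> ((nat \<Rightarrow> real) \<Rightarrow> real) \<Rightarrow> bool" where
  "depends_below L F \<longleftrightarrow> (\<forall>\<xi> \<eta>. (\<forall>j<L. \<xi> j = \<eta> j) \<longrightarrow> F \<xi> = F \<eta>)"

text \<open>Derivatives of all orders are kept at once, so that no order bound has to be carried
  along. The indexing is that of \<open>jet_chart\<close>; adding \<open>n\<close> to an index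
  raises the order by one.\<close>

definition inf_jet :: "nat \<Rightarrow> (real \<Rightarrow> nat \<Rightarrow> real) \<Rightarrow> real \<Rightarrow> nat \<Rightarrow> real" where
  "inf_jet n x t = (\<lambda>j. (deriv ^^ (j div n)) (\<lambda>s. x s (j mod n)) t)"

text \<open>The formal time derivative of a function of jets: along a curve the coordinate
  \<open>B\<close> moves with velocity the coordinate \<open>B + n\<close>. \<open>L\<close> bounds
  the coordinates on which \<open>F\<close> depends and keeps the sum finite.\<close>

definition total_deriv :: "nat \<Rightarrow> nat \<Rightarrow> ((nat \<Rightarrow> real) \<Rightarrow> real) \<Rightarrow> (nat \<Rightarrow> real) \<Rightarrow> real" where
  "total_deriv n L F \<xi> = (\<Sum>B<L. partial B F \<xi> * \<xi> (B + n))"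

text \<open>This will be the image of a natural jet chart: the base coordinates are restricted to
  \<open>S\<close>, the derivatives are free.\<close>

definition jet_domain :: "nat \<Rightarrow> (nat \<Rightarrow> real) set \<Rightarrow> nat \<Rightarrow> (nat \<Rightarrow> real) set" where
  "jet_domain n S N = {\<xi> \<in> EE N. trunc n \<xi> \<in> S}"

lemma trunc_EE [simp]: "trunc N \<xi> \<in> EE N" by (simp add: trunc_def EE_iff)

lemma trunc_id: "\<xi> \<in> EE N \<Longrightarrow> trunc N \<xi> = \<xi>" by (auto simp: trunc_def EE_iff fun_eq_iff)

lemma trunc_trunc [simp]: "n \<le> N \<Longrightarrow> trunc n (trunc N \<xi>) = trunc n \<xi>" by (auto simp: trunc_def)

lemma depends_below_trunc: "depends_below L F \<Longrightarrow> L \<le> N \<Longrightarrow> F (trunc N \<xi>) = F \<xi>"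
  by (auto simp: depends_below_def trunc_def)

lemma depends_below_mono: "depends_below L F \<Longrightarrow> L \<le> N \<Longrightarrow> depends_below N F"
  by (auto simp: depends_below_def)

lemma partial_outside: "depends_below L F \<Longrightarrow> L \<le> B \<Longrightarrow> partial B F \<xi> = 0"
proof -
  assume "depends_below L F" "L \<le> B"
  then have "F (\<xi>(B := s)) = F \<xi>" for s unfolding depends_below_def by auto
  then show ?thesis by (simp add: partial_def)
qed

lemma depends_below_partial: "depends_below L F \<Longrightarrow> depends_below L (partial B F)"
proof (cases "B < L")
  case True
  assume d: "depends_below L F"
  show ?thesis unfolding depends_below_def
  proof (intro allI impI)
    fix \<xi> \<eta> :: "nat \<Rightarrow> real" assume *: "\<forall>j<L. \<xi> j = \<eta> j"
    then have "F (\<xi>(B := s)) = F (\<eta>(B := s))" for s using d unfolding depends_below_def by auto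
    then show "partial B F \<xi> = partial B F \<eta>" using * True by (simp add: partial_def)
  qed
qed (auto simp: partial_outside depends_below_def)

lemma depends_below_trunc_fun: "depends_below n (\<lambda>\<xi>. f (trunc n \<xi>))"
proof -
  have "trunc n \<xi> = trunc n \<eta>" if "\<forall>j<n. \<xi> j = \<eta> j" for \<xi> \<eta> using that by (auto simp: trunc_def)
  then show ?thesis unfolding depends_below_def by metis
qed

lemma depends_below_total_deriv: "depends_below L F \<Longrightarrow> depends_below (L + n) (total_deriv n L F)"
  using depends_below_partial[of L F] unfolding depends_below_def total_deriv_def by (fastforce intro!: sum.cong arg_cong2[where f=times])

lemma openin_jet_domain:
  assumes "openin (Euclidean_space n) S" "n \<le> N"
  shows "openin (Euclidean_space N) (jet_domain n S N)"
proof -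
  have "continuous_map (Euclidean_space N) (Euclidean_space n) (trunc n)"
    unfolding trunc_def continuous_map_componentwise_Euclidean_space continuous_map_Euclidean_space_iff
    by (auto intro: continuous_on_product_then_coordinatewise[OF continuous_on_id])
  from openin_continuous_map_preimage[OF this assms(1)] show ?thesis by (simp add: jet_domain_def)
qed

lemma smooth_on_jet_domain_trunc:
  assumes "smooth_on n S f" "n \<le> N"
  shows "smooth_on N (jet_domain n S N) (\<lambda>\<xi>. f (trunc n \<xi>))"
proof (rule smooth_on_compose[OF _ _ _ assms(1)])
  show o: "openin (Euclidean_space N) (jet_domain n S N)"
    using assms smooth_on_openin openin_jet_domain by blast
  show "smooth_on N (jet_domain n S N) (\<lambda>y. trunc n y j)" if "j < n" for j
    using that o by (simp add: trunc_def smooth_on_coord)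
qed (auto simp: jet_domain_def)

lemma smooth_on_total_deriv:
  assumes "smooth_on N T F" "L + n \<le> N"
  shows "smooth_on N T (total_deriv n L F)"
  unfolding total_deriv_def[abs_def]
  using assms by (intro smooth_on_sum smooth_on_mult smooth_on_partial smooth_on_coord) (auto simp: smooth_on_openin)

lemma inf_jet_smooth:
  assumes "n > 0" "\<And>i. i < n \<Longrightarrow> smooth1 I (\<lambda>s. x s i)"
  shows "smooth1 I (\<lambda>s. inf_jet n x s j)"
  unfolding inf_jet_def using assms by (intro smooth1_higher_deriv) auto

lemma deriv_inf_jet: "n > 0 \<Longrightarrow> deriv (\<lambda>s. inf_jet n x s j) = (\<lambda>s. inf_jet n x s (j + n))"
  by (simp add: inf_jet_def fun_eq_iff)

lemma trunc_inf_jet: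
  assumes "x t \<in> EE n" shows "trunc n (inf_jet n x t) = x t"
  using assms by (auto simp: trunc_def inf_jet_def EE_iff fun_eq_iff)

text \<open>An infinite jet is not a point of \<open>EE N\<close> in general, so the chain rule is
  applied to its truncation; \<open>depends_below\<close> then removes the truncation and the
  summands from \<open>L\<close> on.\<close>

lemma total_deriv_chain:
  assumes F: "smooth_on N (jet_domain n S N) F" and d: "depends_below L F" and L: "L \<le> N" and n: "0 < n" "n \<le> N"
    and I: "open I" and x: "\<And>i. i < n \<Longrightarrow> smooth1 I (\<lambda>s. x s i)"
    and xS: "\<And>s. s \<in> I \<Longrightarrow> x s \<in> S" and S: "S \<subseteq> EE n" and t: "t \<in> I"
  shows "((\<lambda>s. F (inf_jet n x s)) has_real_derivative total_deriv n L F (inf_jet n x t)) (at t)"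
proof -
  have c: "smooth1 I (\<lambda>s. trunc N (inf_jet n x s) i)" if "i < N" for i
    using inf_jet_smooth[OF n(1) x] that by (simp add: trunc_def)
  have cS: "trunc N (inf_jet n x s) \<in> jet_domain n S N" if "s \<in> I" for s
    using xS[OF that] S n trunc_inf_jet[of x s n] by (auto simp: jet_domain_def)
  have eq: "deriv (\<lambda>s. trunc N (inf_jet n x s) i) t = inf_jet n x t (i + n)" if "i < N" for i
    using that deriv_inf_jet[OF n(1), of x i] by (simp add: trunc_def fun_eq_iff)
  have "(\<Sum>i<N. partial i F (trunc N (inf_jet n x t)) * deriv (\<lambda>s. trunc N (inf_jet n x s) i) t)
      = (\<Sum>i<N. partial i F (inf_jet n x t) * inf_jet n x t (i + n))"
    using depends_below_trunc[OF depends_below_partial[OF d] L] eq by (intro sum.cong) auto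
  also have "\<dots> = total_deriv n L F (inf_jet n x t)"
    unfolding total_deriv_def using L partial_outside[OF d] by (intro sum.mono_neutral_right) auto
  finally show ?thesis
    using smooth1_chain[OF F I c cS t] depends_below_trunc[OF d L] by simp
qed

text \<open>The prolongation of \<open>f\<close>: at the jet of a curve it gives the
  \<open>r\<close>-th derivative of \<open>f\<close> along that curve, in place of an explicit
  formula for higher derivatives of a composite. \<open>n * Suc r\<close> counts the coordinates of
  order at most \<open>r\<close>.\<close>

fun jet_lift :: "nat \<Rightarrow> ((nat \<Rightarrow> real) \<Rightarrow> real) \<Rightarrow> nat \<Rightarrow> (nat \<Rightarrow> real) \<Rightarrow> real" where
  "jet_lift n f 0 = (\<lambda>\<xi>. f (trunc n \<xi>))"
| "jet_lift n f (Suc r) = total_deriv n (n * Suc r) (jet_lift n f r)"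

lemma depends_below_jet_lift: "depends_below (n * Suc r) (jet_lift n f r)"
proof (induction r)
  case 0 then show ?case using depends_below_trunc_fun by simp
next
  case (Suc r) show ?case using depends_below_total_deriv[OF Suc, of n] by (simp add: ac_simps)
qed

lemma smooth_on_jet_lift:
  assumes "smooth_on n S f" "n * Suc r \<le> N"
  shows "smooth_on N (jet_domain n S N) (jet_lift n f r)"
  using assms(2)
proof (induction r)
  case 0 then show ?case using smooth_on_jet_domain_trunc[OF assms(1)] by simp
next
  case (Suc r) then show ?case unfolding jet_lift.simps by (intro smooth_on_total_deriv Suc.IH) auto
qed

lemma higher_deriv_compose_jet_lift:
  assumes f: "smooth_on n S f" and n: "n > 0"
    and I: "open I" and x: "\<And>i. i < n \<Longrightarrow> smooth1 I (\<lambda>s. x s i)"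
    and xS: "\<And>s. s \<in> I \<Longrightarrow> x s \<in> S" and t: "t \<in> I"
  shows "(deriv ^^ r) (\<lambda>s. f (x s)) t = jet_lift n f r (inf_jet n x t)"
  using t
proof (induction r arbitrary: t)
  case 0
  then show ?case using xS trunc_inf_jet openin_EE_subset[OF smooth_on_openin[OF f]] by (auto simp: subset_iff)
next
  case (Suc r)
  have S: "S \<subseteq> EE n" using openin_EE_subset[OF smooth_on_openin[OF f]] .
  have "(deriv ^^ Suc r) (\<lambda>s. f (x s)) t = deriv (\<lambda>s. jet_lift n f r (inf_jet n x s)) t"
    using deriv_cong_open[OF I Suc.prems, of "(deriv ^^ r) (\<lambda>s. f (x s))" "\<lambda>s. jet_lift n f r (inf_jet n x s)" 1] Suc.IH
    by simp
  also have "\<dots> = total_deriv n (n * Suc r) (jet_lift n f r) (inf_jet n x t)"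
    by (rule DERIV_imp_deriv[OF total_deriv_chain[OF smooth_on_jet_lift[OF f order_refl, of r] depends_below_jet_lift _ n _ I x xS S Suc.prems]])
       (use n in auto)
  finally show ?case by simp
qed

subsection \<open>Positive definite matrices and Levi-Civita coefficients\<close>

definition posdef :: "nat \<Rightarrow> (nat \<Rightarrow> nat \<Rightarrow> real) \<Rightarrow> bool" where
  "posdef n A \<longleftrightarrow> (\<forall>v. (\<exists>i<n. v i \<noteq> 0) \<longrightarrow> 0 < (\<Sum>i<n. \<Sum>j<n. v i * v j * A i j))"

lemma posdefD: "posdef n A \<Longrightarrow> i < n \<Longrightarrow> v i \<noteq> 0 \<Longrightarrow> 0 < (\<Sum>i<n. \<Sum>j<n. v i * v j * A i j)"
  unfolding posdef_def by blast

lemma posdef_eq_0: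
  assumes "posdef n A" "(\<Sum>i<n. \<Sum>j<n. v i * v j * A i j) = 0" "i < n"
  shows "v i = 0"
  using posdefD[OF assms(1,3), of v] assms(2) by auto

text \<open>Pairing the vanishing combination with \<open>v\<close> itself makes the quadratic form
  vanish at \<open>v\<close>.\<close>

lemma posdef_kernel:
  assumes A: "posdef n A" and v: "\<And>j. j < n \<Longrightarrow> (\<Sum>i<n. v i * A i j) = 0" and "i < n"
  shows "v i = 0"
proof (rule posdef_eq_0[OF A _ \<open>i < n\<close>])
  have "(\<Sum>i<n. \<Sum>j<n. v i * v j * A i j) = (\<Sum>j<n. \<Sum>i<n. v i * v j * A i j)"
    by (rule sum.swap)
  also have "\<dots> = (\<Sum>j<n. v j * (\<Sum>i<n. v i * A i j))"
    by (simp add: sum_distrib_left mult_ac)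
  also have "\<dots> = 0" using v by simp
  finally show "(\<Sum>i<n. \<Sum>j<n. v i * v j * A i j) = 0" .
qed

lemma posdef_diag: "posdef n A \<Longrightarrow> i < n \<Longrightarrow> 0 < A i i"
proof -
  assume A: "posdef n A" and i: "i < n"
  let ?v = "\<lambda>j. if j = i then 1 else (0::real)"
  have "0 < (\<Sum>j<n. \<Sum>k<n. ?v j * ?v k * A j k)"
    using posdefD[OF A i, of ?v] by simp
  also have "(\<Sum>j<n. \<Sum>k<n. ?v j * ?v k * A j k) = (\<Sum>j<n. if j = i then A i i else 0)"
    using i by (intro sum.cong) (auto simp: if_distrib[of "\<lambda>x. x * _"] cong: if_cong)
  finally show ?thesis using i by simp
qed

text \<open>Extending \<open>v\<close> by the last coordinate \<open>w\<close> for which the last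
  row of \<open>A\<close> gives zero turns the quadratic form of \<open>A\<close> into that of the
  Schur complement.\<close>

lemma posdef_schur:
  assumes A: "posdef (Suc n) A"
  shows "posdef n (\<lambda>i j. A i j - A i n * A n j / A n n)"
  unfolding posdef_def
proof (intro allI impI)
  fix v :: "nat \<Rightarrow> real" assume v: "\<exists>i<n. v i \<noteq> 0"
  have Ann: "A n n > 0" using posdef_diag[OF A] by simp
  define w where "w = - (\<Sum>j<n. v j * A n j) / A n n"
  define u where "u = v(n := w)"
  have un: "u n = w" and uv: "\<And>j. j < n \<Longrightarrow> u j = v j" by (auto simp: u_def)
  have inner: "(\<Sum>j<Suc n. u i * u j * A i j) = (\<Sum>j<n. u i * v j * A i j) + u i * w * A i n" for i
    by (simp add: un uv)
  have "0 < (\<Sum>i<Suc n. \<Sum>j<Suc n. u i * u j * A i j)"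
    using v posdefD[OF A, of _ u] uv by (metis less_SucI)
  also have "\<dots> = (\<Sum>i<n. (\<Sum>j<n. v i * v j * A i j) + v i * w * A i n) + w * ((\<Sum>j<n. v j * A n j) + w * A n n)"
    unfolding inner by (simp add: un uv sum_distrib_left distrib_left mult.assoc)
  also have "(\<Sum>j<n. v j * A n j) + w * A n n = 0" using Ann by (simp add: w_def)
  also have "(\<Sum>i<n. (\<Sum>j<n. v i * v j * A i j) + v i * w * A i n) + w * 0
      = (\<Sum>i<n. \<Sum>j<n. v i * v j * (A i j - A i n * A n j / A n n))"
  proof -
    have "v i * w * A i n = (\<Sum>j<n. - (v i * v j * (A i n * A n j / A n n)))" for i
      unfolding w_def by (simp add: sum_negf sum_distrib_left sum_distrib_right sum_divide_distrib mult_ac)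
    then show ?thesis by (simp add: sum.distrib[symmetric] right_diff_distrib)
  qed
  finally show "0 < (\<Sum>i<n. \<Sum>j<n. v i * v j * (A i j - A i n * A n j / A n n))" .
qed

text \<open>Gaussian elimination with the parameter \<open>x\<close> carried along: the pivot
  \<open>A n n\<close> is positive, so each division is smooth, and the remaining system again has a
  positive definite matrix, the Schur complement. Smooth dependence of the solution is thus obtained
  without determinants.\<close>

lemma posdef_solve:
  assumes "openin (Euclidean_space N) S"
    and "\<And>i j. i < n \<Longrightarrow> j < n \<Longrightarrow> smooth_on N S (A i j)"
    and "\<And>i. i < n \<Longrightarrow> smooth_on N S (b i)"
    and "\<And>x. x \<in> S \<Longrightarrow> posdef n (\<lambda>i j. A i j x)"
  shows "\<exists>y. (\<forall>j<n. smooth_on N S (y j)) \<and> (\<forall>x\<in>S. \<forall>i<n. (\<Sum>j<n. A i j x * y j x) = b i x)"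
  using assms(2-4)
proof (induction n arbitrary: A b)
  case 0 then show ?case by simp
next
  case (Suc n)
  have Ann: "A n n x > 0" if "x \<in> S" for x
    using posdef_diag[OF Suc.prems(3)[OF that], of n] by simp
  have sd: "smooth_on N S (\<lambda>x. f x / A n n x)" if "smooth_on N S f" for f
    using that Suc.prems(1) Ann by (intro smooth_on_divide) force+
  have "\<exists>y. (\<forall>j<n. smooth_on N S (y j)) \<and> (\<forall>x\<in>S. \<forall>i<n.
     (\<Sum>j<n. (A i j x - A i n x * A n j x / A n n x) * y j x) = b i x - A i n x * b n x / A n n x)"
    by (rule Suc.IH) (use Suc.prems posdef_schur[OF Suc.prems(3)] in \<open>auto intro!: smooth_on_diff sd smooth_on_mult\<close>)
  then obtain y where y: "\<And>j. j < n \<Longrightarrow> smooth_on N S (y j)"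
    "\<And>x i. x \<in> S \<Longrightarrow> i < n \<Longrightarrow>
     (\<Sum>j<n. (A i j x - A i n x * A n j x / A n n x) * y j x) = b i x - A i n x * b n x / A n n x"
    by blast
  define z where "z = (\<lambda>x. (b n x - (\<Sum>j<n. A n j x * y j x)) / A n n x)"
  have z: "smooth_on N S z" unfolding z_def
    using Suc.prems y by (intro sd smooth_on_diff smooth_on_sum[OF assms(1)] smooth_on_mult) auto
  have eq: "(\<Sum>j<Suc n. A i j x * (y(n := z)) j x) = (\<Sum>j<n. A i j x * y j x) + A i n x * z x" for i x
    by simp
  have "(\<Sum>j<n. A i j x * y j x) + A i n x * z x = b i x" if x: "x \<in> S" and i: "i < Suc n" for x i
  proof (cases "i = n")
    case True
    then show ?thesis using Ann[OF x] by (simp add: z_def)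
  next
    case False
    then have "i < n" using i by simp
    have "(\<Sum>j<n. A i j x * y j x) - A i n x * (\<Sum>j<n. A n j x * y j x) / A n n x = b i x - A i n x * b n x / A n n x"
      unfolding y(2)[OF x \<open>i < n\<close>, symmetric]
      by (simp add: left_diff_distrib sum_subtractf sum_distrib_left sum_divide_distrib mult.assoc)
    then show ?thesis using Ann[OF x] by (simp add: z_def diff_divide_distrib right_diff_distrib)
  qed
  then show ?case unfolding eq[symmetric]
    by (intro exI[of _ "y(n := z)"]) (use y z in \<open>auto simp: less_Suc_eq\<close>)
qed

text \<open>Applying symmetry and antisymmetry alternately returns to the same entry after six
  exchanges, three of them with a change of sign. Both the uniqueness of the Levi-Civita
  coefficients and their transformation law rest on this.\<close>

lemma sym_antisym_eq_0:
  fixes B :: "nat \<Rightarrow> nat \<Rightarrow> nat \<Rightarrow> real"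
  assumes "\<And>l i j. l < n \<Longrightarrow> i < n \<Longrightarrow> j < n \<Longrightarrow> B l i j = B i l j"
    and "\<And>l i j. l < n \<Longrightarrow> i < n \<Longrightarrow> j < n \<Longrightarrow> B l i j + B l j i = 0"
    and "l < n" "i < n" "j < n"
  shows "B l i j = 0"
  using assms(1)[of l i j] assms(1)[of i j l] assms(1)[of j l i]
    assms(2)[of l i j] assms(2)[of i j l] assms(2)[of j l i] assms(3-5) by linarith

text \<open>What the Levi-Civita theory uses of a metric in a single chart. In this form it applies
  to \<open>g\<close> and, once its coefficients are computed, to \<open>sasaki\<close>.\<close>

definition metric_chart :: "'a manifold \<Rightarrow> 'a metric \<Rightarrow> 'a chart \<Rightarrow> bool" where
  "metric_chart M g C \<longleftrightarrow> openin (Euclidean_space (mdim M)) (snd C ` fst C) \<and>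
    (\<forall>i<mdim M. \<forall>j<mdim M. smooth_on (mdim M) (snd C ` fst C) (metric_coeff M g C i j)) \<and>
    (\<forall>x\<in>snd C ` fst C. posdef (mdim M) (\<lambda>i j. metric_coeff M g C i j x) \<and>
       (\<forall>i<mdim M. \<forall>j<mdim M. metric_coeff M g C i j x = metric_coeff M g C j i x))"

lemma metric_chartD:
  assumes "metric_chart M g C"
  shows "openin (Euclidean_space (mdim M)) (snd C ` fst C)"
    "\<And>i j. i < mdim M \<Longrightarrow> j < mdim M \<Longrightarrow> smooth_on (mdim M) (snd C ` fst C) (metric_coeff M g C i j)"
    "\<And>x. x \<in> snd C ` fst C \<Longrightarrow> posdef (mdim M) (\<lambda>i j. metric_coeff M g C i j x)"
    "\<And>x i j. x \<in> snd C ` fst C \<Longrightarrow> i < mdim M \<Longrightarrow> j < mdim M \<Longrightarrow>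
       metric_coeff M g C i j x = metric_coeff M g C j i x"
  using assms unfolding metric_chart_def by auto

lemma metric_chart_partial_sym:
  assumes "metric_chart M g C" "x \<in> snd C ` fst C" "l < mdim M" "i < mdim M" "j < mdim M"
  shows "partial l (metric_coeff M g C i j) x = partial l (metric_coeff M g C j i) x"
  using assms metric_chartD(4)[OF assms(1)]
  by (intro partial_cong[OF metric_chartD(1)[OF assms(1)]]) auto

lemma levi_civita_coeffsD:
  assumes "levi_civita_coeffs M g C x \<Gamma>"
  shows "\<And>m i j. m < mdim M \<Longrightarrow> i < mdim M \<Longrightarrow> j < mdim M \<Longrightarrow> \<Gamma> m i j = \<Gamma> m j i"
    "\<And>l i j. l < mdim M \<Longrightarrow> i < mdim M \<Longrightarrow> j < mdim M \<Longrightarrow>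
        partial l (metric_coeff M g C i j) x =
          (\<Sum>m<mdim M. \<Gamma> m l i * metric_coeff M g C m j x) +
          (\<Sum>m<mdim M. \<Gamma> m l j * metric_coeff M g C i m x)"
  using assms unfolding levi_civita_coeffs_def by blast+

lemma levi_civita_unique:
  assumes mc: "metric_chart M g C" and x: "x \<in> snd C ` fst C"
    and 1: "levi_civita_coeffs M g C x \<Gamma>" and 2: "levi_civita_coeffs M g C x \<Gamma>'"
    and lt: "m < mdim M" "i < mdim M" "j < mdim M"
  shows "\<Gamma> m i j = \<Gamma>' m i j"
proof -
  define n where "n = mdim M"
  define G where "G i j = metric_coeff M g C i j x" for i j
  \<comment> \<open>The difference of the two connections, lowered with the metric: absence of
    torsion makes it symmetric in the first two indices, compatibility antisymmetric in the last
    two.\<close>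
  define B where "B l i j = (\<Sum>m<n. (\<Gamma> m l i - \<Gamma>' m l i) * G m j)" for l i j
  have Gs: "G i j = G j i" if "i < n" "j < n" for i j
    using metric_chartD(4)[OF mc x] that by (auto simp: G_def n_def)
  have "B l i j = 0" if "l < n" "i < n" "j < n" for l i j
  proof (rule sym_antisym_eq_0[OF _ _ that])
    show "B l i j = B i l j" if "l < n" "i < n" "j < n" for l i j
      using levi_civita_coeffsD(1)[OF 1] levi_civita_coeffsD(1)[OF 2] that
      unfolding B_def n_def by (intro sum.cong) auto
    show "B l i j + B l j i = 0" if "l < n" "i < n" "j < n" for l i j
    proof -
      have e: "(\<Sum>m<n. \<Gamma> m l i * G m j) + (\<Sum>m<n. \<Gamma> m l j * G i m)
         = (\<Sum>m<n. \<Gamma>' m l i * G m j) + (\<Sum>m<n. \<Gamma>' m l j * G i m)"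
        using levi_civita_coeffsD(2)[OF 1, of l i j] levi_civita_coeffsD(2)[OF 2, of l i j] that
        unfolding n_def G_def by linarith
      have "B l j i = (\<Sum>m<n. \<Gamma> m l j * G i m) - (\<Sum>m<n. \<Gamma>' m l j * G i m)"
        unfolding B_def sum_subtractf[symmetric] using that Gs by (intro sum.cong) (auto simp: left_diff_distrib)
      with e show ?thesis by (simp add: B_def left_diff_distrib sum_subtractf)
    qed
  qed
  then have "\<Gamma> m i j - \<Gamma>' m i j = 0"
    using lt metric_chartD(3)[OF mc x] unfolding B_def n_def[symmetric] G_def[symmetric]
    by (intro posdef_kernel[of n G "\<lambda>m. \<Gamma> m i j - \<Gamma>' m i j"]) auto
  then show ?thesis by simp
qed

lemma levi_civita_exists:
  assumes mc: "metric_chart M g C"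
  shows "\<exists>\<Gamma>. (\<forall>m<mdim M. \<forall>i<mdim M. \<forall>j<mdim M. smooth_on (mdim M) (snd C ` fst C) (\<lambda>x. \<Gamma> x m i j)) \<and>
     (\<forall>x\<in>snd C ` fst C. levi_civita_coeffs M g C x (\<Gamma> x))"
proof -
  define n where "n = mdim M"
  define S where "S = snd C ` fst C"
  define G where "G = metric_coeff M g C"
  note mcD = metric_chartD[OF mc, folded n_def S_def G_def]
  \<comment> \<open>Christoffel symbols of the first kind, with the lowered index \<open>j\<close>
    last. Raising it is a linear system with the metric as matrix, so \<open>posdef_solve\<close>
    gives symbols that are smooth in \<open>x\<close>.\<close>
  define c where "c l i j x = (partial l (G i j) x + partial i (G l j) x - partial j (G l i) x) * (1 / 2)" for l i j x
  have cs: "smooth_on n S (c l i j)" if "l < n" "i < n" "j < n" for l i j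
    unfolding c_def[abs_def] using mcD(1,2) that
    by (intro smooth_on_mult smooth_on_diff smooth_on_add smooth_on_partial smooth_on_const) auto
  have "\<exists>y. (\<forall>m<n. smooth_on n S (y m)) \<and> (\<forall>x\<in>S. \<forall>j<n. (\<Sum>m<n. G j m x * y m x) = c l i j x)"
    if "l < n" "i < n" for l i
    by (rule posdef_solve[OF mcD(1)]) (use mcD cs that in auto)
  then obtain Y where Y: "\<And>l i m. l < n \<Longrightarrow> i < n \<Longrightarrow> m < n \<Longrightarrow> smooth_on n S (Y l i m)"
    "\<And>l i j x. l < n \<Longrightarrow> i < n \<Longrightarrow> j < n \<Longrightarrow> x \<in> S \<Longrightarrow> (\<Sum>m<n. G j m x * Y l i m x) = c l i j x"
    by metis
  have Gs: "partial l (G i j) x = partial l (G j i) x" if "l < n" "i < n" "j < n" "x \<in> S" for l i j x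
    using metric_chart_partial_sym[OF mc] that by (auto simp: G_def n_def S_def)
  have cs: "c l i j x = c i l j x" if "l < n" "i < n" "j < n" "x \<in> S" for l i j x
    using Gs[of j l i x] that by (simp add: c_def)
  have "levi_civita_coeffs M g C x (\<lambda>m l i. Y l i m x)" if x: "x \<in> S" for x
    unfolding levi_civita_coeffs_def n_def[symmetric] G_def[symmetric]
  proof (intro conjI allI impI)
    fix m l i assume lt: "m < n" "l < n" "i < n"
    have "Y l i m x - Y i l m x = 0"
    proof (rule posdef_kernel[OF mcD(3)[OF x] _ lt(1), of "\<lambda>m. Y l i m x - Y i l m x"])
      fix j assume j: "j < n"
      have "(\<Sum>m<n. (Y l i m x - Y i l m x) * G m j x) = (\<Sum>m<n. G j m x * Y l i m x) - (\<Sum>m<n. G j m x * Y i l m x)"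
        unfolding sum_subtractf[symmetric] using mcD(4)[OF x] j by (intro sum.cong) (auto simp: algebra_simps)
      then show "(\<Sum>m<n. (Y l i m x - Y i l m x) * G m j x) = 0"
        using Y(2) cs lt j x by simp
    qed
    then show "Y l i m x = Y i l m x" by simp
  next
    fix l i j assume lt: "l < n" "i < n" "j < n"
    have "(\<Sum>m<n. Y l i m x * G m j x) = c l i j x"
      using Y(2)[OF lt x] mcD(4)[OF x] lt by (simp add: mult.commute)
    moreover have "(\<Sum>m<n. Y l j m x * G i m x) = c l j i x"
      using Y(2)[OF lt(1,3,2) x] by (simp add: mult.commute)
    moreover have "c l i j x + c l j i x = partial l (G i j) x"
      using Gs[of l j i x] Gs[of j l i x] Gs[of i l j x] lt x by (simp add: c_def field_simps)
    ultimately show "partial l (G i j) x = (\<Sum>m<n. Y l i m x * G m j x) + (\<Sum>m<n. Y l j m x * G i m x)"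
      by simp
  qed
  then show ?thesis using Y(1)
    unfolding n_def[symmetric] S_def[symmetric]
    by (intro exI[of _ "\<lambda>x m l i. Y l i m x"]) auto
qed

lemma christoffel_levi_civita:
  assumes "metric_chart M g C" "x \<in> snd C ` fst C"
  shows "levi_civita_coeffs M g C x (christoffel M g C x)"
proof -
  obtain \<Gamma> where "levi_civita_coeffs M g C x (\<Gamma> x)"
    using levi_civita_exists[OF assms(1)] assms(2) by blast
  then show ?thesis unfolding christoffel_def by (rule someI[of "levi_civita_coeffs M g C x"])
qed

text \<open>\<open>christoffel\<close> is chosen separately at each point, so smoothness is not
  visible from its definition; uniqueness identifies it with the smooth solution of
  \<open>levi_civita_exists\<close>.\<close>

lemma christoffel_smooth:
  assumes mc: "metric_chart M g C" and "m < mdim M" "i < mdim M" "j < mdim M"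
  shows "smooth_on (mdim M) (snd C ` fst C) (\<lambda>x. christoffel M g C x m i j)"
proof -
  obtain \<Gamma> where \<Gamma>: "\<forall>m<mdim M. \<forall>i<mdim M. \<forall>j<mdim M. smooth_on (mdim M) (snd C ` fst C) (\<lambda>x. \<Gamma> x m i j)"
    "\<forall>x\<in>snd C ` fst C. levi_civita_coeffs M g C x (\<Gamma> x)"
    using levi_civita_exists[OF mc] by (elim exE conjE)
  have "smooth_on (mdim M) (snd C ` fst C) (\<lambda>x. \<Gamma> x m i j)"
    using \<Gamma>(1) assms(2-4) by simp
  then show ?thesis
    by (rule smooth_on_cong)
      (rule levi_civita_unique[OF mc _ bspec[OF \<Gamma>(2)] christoffel_levi_civita[OF mc] assms(2-4)])
qed

text \<open>Contracting with the metric loses nothing, because a positive definite matrix has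
  trivial kernel.\<close>

lemma geodesic_equation_lowered:
  fixes v a :: "nat \<Rightarrow> real"
  assumes mc: "metric_chart M g C" and x: "x \<in> snd C ` fst C"
    and lc: "levi_civita_coeffs M g C x \<Gamma>"
  defines "n \<equiv> mdim M" and "G \<equiv> metric_coeff M g C"
  shows "(\<forall>m<n. a m + (\<Sum>i<n. \<Sum>j<n. \<Gamma> m i j * v i * v j) = 0) \<longleftrightarrow>
    (\<forall>l<n. (\<Sum>m<n. G l m x * a m) +
       (\<Sum>i<n. \<Sum>j<n. (partial i (G l j) x - partial l (G i j) x / 2) * v i * v j) = 0)"
proof -
  note mcD = metric_chartD[OF mc, folded n_def G_def]
  have sym: "\<And>m i j. m < n \<Longrightarrow> i < n \<Longrightarrow> j < n \<Longrightarrow> \<Gamma> m i j = \<Gamma> m j i"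
    and d: "\<And>l i j. l < n \<Longrightarrow> i < n \<Longrightarrow> j < n \<Longrightarrow> partial l (G i j) x =
          (\<Sum>m<n. \<Gamma> m l i * G m j x) + (\<Sum>m<n. \<Gamma> m l j * G i m x)"
    using levi_civita_coeffsD[OF lc] unfolding n_def G_def by blast+
  define q where "q m = (\<Sum>i<n. \<Sum>j<n. \<Gamma> m i j * v i * v j)" for m
  have low: "(\<Sum>i<n. \<Sum>j<n. (partial i (G l j) x - partial l (G i j) x / 2) * v i * v j)
     = (\<Sum>m<n. G l m x * q m)" if l: "l < n" for l
  proof -
    \<comment> \<open>In these terms \<open>partial i (G l j) x\<close> is
      \<open>A i j + B i j\<close> and \<open>partial l (G i j) x\<close> is
      \<open>A i j + A j i\<close>. What remains beside \<open>B\<close> is antisymmetric in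
      \<open>i\<close> and \<open>j\<close> and cancels against \<open>v i * v j\<close>.\<close>
    define A where "A i j = (\<Sum>m<n. \<Gamma> m i l * G m j x)" for i j
    define B where "B i j = (\<Sum>m<n. \<Gamma> m i j * G l m x)" for i j
    have "partial i (G l j) x - partial l (G i j) x / 2 = B i j + (A i j - A j i) / 2"
      if "i < n" "j < n" for i j
    proof -
      have "(\<Sum>m<n. \<Gamma> m l i * G m j x) = A i j"
        unfolding A_def using sym l that by (intro sum.cong) auto
      moreover have "(\<Sum>m<n. \<Gamma> m l j * G i m x) = A j i"
        unfolding A_def using sym mcD(4)[OF x] l that by (intro sum.cong) auto
      ultimately show ?thesis using d[OF that(1) l that(2)] d[OF l that]
        by (simp add: A_def B_def field_simps)
    qed
    then have "(\<Sum>i<n. \<Sum>j<n. (partial i (G l j) x - partial l (G i j) x / 2) * v i * v j)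
      = (\<Sum>i<n. \<Sum>j<n. (B i j + (A i j - A j i) / 2) * v i * v j)"
      by simp
    also have "\<dots> = (\<Sum>i<n. \<Sum>j<n. B i j * v i * v j + (A i j * v i * v j - A j i * v j * v i) / 2)"
      by (simp add: algebra_simps diff_divide_distrib)
    also have "\<dots> = (\<Sum>i<n. \<Sum>j<n. B i j * v i * v j)
       + ((\<Sum>i<n. \<Sum>j<n. A i j * v i * v j) - (\<Sum>i<n. \<Sum>j<n. A j i * v j * v i)) / 2"
      by (simp add: sum.distrib sum_subtractf sum_divide_distrib[symmetric])
    also have "(\<Sum>i<n. \<Sum>j<n. A j i * v j * v i) = (\<Sum>i<n. \<Sum>j<n. A i j * v i * v j)"
      by (rule sum.swap)
    also have "(\<Sum>i<n. \<Sum>j<n. B i j * v i * v j) = (\<Sum>i<n. \<Sum>j<n. \<Sum>m<n. G l m x * (\<Gamma> m i j * v i * v j))"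
      by (simp add: B_def sum_distrib_left sum_distrib_right mult_ac)
    also have "\<dots> = (\<Sum>i<n. \<Sum>m<n. \<Sum>j<n. G l m x * (\<Gamma> m i j * v i * v j))"
      by (intro sum.cong refl sum.swap)
    also have "\<dots> = (\<Sum>m<n. \<Sum>i<n. \<Sum>j<n. G l m x * (\<Gamma> m i j * v i * v j))"
      by (rule sum.swap)
    also have "\<dots> = (\<Sum>m<n. G l m x * q m)"
      by (simp add: q_def sum_distrib_left)
    finally show ?thesis by simp
  qed
  have "(\<forall>m<n. a m + q m = 0) \<longleftrightarrow> (\<forall>l<n. (\<Sum>m<n. G l m x * (a m + q m)) = 0)"
  proof
    assume *: "\<forall>l<n. (\<Sum>m<n. G l m x * (a m + q m)) = 0"
    show "\<forall>m<n. a m + q m = 0"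
    proof (intro allI impI)
      fix m assume "m < n"
      show "a m + q m = 0"
      proof (rule posdef_kernel[OF mcD(3)[OF x] _ \<open>m < n\<close>, of "\<lambda>m. a m + q m"])
        fix l assume l: "l < n"
        have "(\<Sum>m<n. (a m + q m) * G m l x) = (\<Sum>m<n. G l m x * (a m + q m))"
          using mcD(4)[OF x] l by (intro sum.cong) (auto simp: mult.commute)
        then show "(\<Sum>m<n. (a m + q m) * G m l x) = 0" using * l by simp
      qed
    qed
  qed simp
  then show ?thesis using low by (simp add: q_def distrib_left sum.distrib)
qed

subsection \<open>Curves, jets and tangent vectors in charts\<close>

text \<open>The chart conditions as a locale, to be interpreted for \<open>M\<close> and for its jet
  bundles alike.\<close>

locale charted =
  fixes M :: "'a manifold"
  assumes inj_chart: "C \<in> atlas M \<Longrightarrow> inj_on (snd C) (fst C)"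
    and open_chart: "C \<in> atlas M \<Longrightarrow> openin (Euclidean_space (mdim M)) (snd C ` fst C)"
    and open_overlap: "C \<in> atlas M \<Longrightarrow> D \<in> atlas M \<Longrightarrow>
      openin (Euclidean_space (mdim M)) (snd C ` (fst C \<inter> fst D))"
    and smooth_transition: "C \<in> atlas M \<Longrightarrow> D \<in> atlas M \<Longrightarrow> j < mdim M \<Longrightarrow>
      smooth_on (mdim M) (snd C ` (fst C \<inter> fst D)) (\<lambda>x. snd D (chart_inv C x) j)"

lemma smooth_manifold_charted: "smooth_manifold M \<Longrightarrow> charted M"
  unfolding smooth_manifold_def by unfold_locales auto

definition chart_smooth :: "'a manifold \<Rightarrow> 'a chart \<Rightarrow> real set \<Rightarrow> (real \<Rightarrow> 'a) \<Rightarrow> bool" where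
  "chart_smooth M C I c \<longleftrightarrow> C \<in> atlas M \<and> open I \<and> (\<forall>t\<in>I. c t \<in> fst C) \<and>
     (\<forall>i<mdim M. smooth1 I (\<lambda>t. snd C (c t) i))"

lemma chart_smoothD:
  assumes "chart_smooth M C I c"
  shows "C \<in> atlas M" "open I" "\<And>t. t \<in> I \<Longrightarrow> c t \<in> fst C"
    "\<And>i. i < mdim M \<Longrightarrow> smooth1 I (\<lambda>t. snd C (c t) i)"
  using assms unfolding chart_smooth_def by auto

lemma chart_smooth_subset: "chart_smooth M C I c \<Longrightarrow> open J \<Longrightarrow> J \<subseteq> I \<Longrightarrow> chart_smooth M C J c"
  unfolding chart_smooth_def by (auto intro: smooth1_subset)

lemma curve_stays_in:
  assumes x: "\<And>i. i < n \<Longrightarrow> smooth1 I (\<lambda>s. x s i)" and I: "open I" and E: "\<And>s. s \<in> I \<Longrightarrow> x s \<in> EE n"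
    and U: "openin (Euclidean_space n) U" and t: "t \<in> I" "x t \<in> U"
  obtains J where "open J" "t \<in> J" "J \<subseteq> I" "\<And>s. s \<in> J \<Longrightarrow> x s \<in> U"
proof -
  have ev: "\<forall>\<^sub>F s in at t. s \<in> I" using I t(1) by (rule eventually_at_in_open')
  have "((\<lambda>s. x s i) \<longlongrightarrow> x t i) (at t)" for i
  proof (cases "i < n")
    case True
    then show ?thesis using DERIV_isCont[OF smooth1_D[OF x t(1)]] by (simp add: isCont_def)
  next
    case False
    have "\<forall>\<^sub>F s in at t. x s i = x t i"
      using ev by eventually_elim (use E False t in \<open>auto simp: EE_iff\<close>)
    then show ?thesis by (rule tendsto_eventually)
  qed
  then have "(x \<longlongrightarrow> x t) (at t)" by (rule tendsto_coordinatewise)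
  moreover have "\<forall>\<^sub>F s in at t. x s \<in> EE n" using ev by eventually_elim (rule E)
  ultimately have "\<forall>\<^sub>F s in at t. x s \<in> U" using openin_EE_eventually[OF U] t(2) by blast
  then have "\<forall>\<^sub>F s in nhds t. x s \<in> U" using t(2) by (simp add: eventually_nhds_conv_at)
  then obtain V where "open V" "t \<in> V" "\<forall>s\<in>V. x s \<in> U" unfolding eventually_nhds by blast
  then show ?thesis using I t(1) by (intro that[of "V \<inter> I"]) auto
qed

lemma same_jet:
  assumes "q' 0 = q 0"
    "\<And>C i r. C \<in> atlas M \<Longrightarrow> q 0 \<in> fst C \<Longrightarrow> i < mdim M \<Longrightarrow> r \<le> k \<Longrightarrow>
      (deriv ^^ r) (\<lambda>t. snd C (q' t) i) 0 = (deriv ^^ r) (\<lambda>t. snd C (q t) i) 0"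
  shows "jet M k q' = jet M k q"
  using assms unfolding jet_def by auto

lemma jet_self: "smooth_germ M q \<Longrightarrow> q \<in> jet M k q"
  by (simp add: jet_def)

lemma rep_in_jet: "smooth_germ M q \<Longrightarrow> rep (jet M k q) \<in> jet M k q"
  unfolding rep_def by (rule someI[of "\<lambda>q'. q' \<in> jet M k q"]) (rule jet_self)

lemma rep_jet:
  assumes "smooth_germ M q"
  shows "smooth_germ M (rep (jet M k q))" "rep (jet M k q) 0 = q 0"
    "C \<in> atlas M \<Longrightarrow> q 0 \<in> fst C \<Longrightarrow> i < mdim M \<Longrightarrow> r \<le> k \<Longrightarrow>
      (deriv ^^ r) (\<lambda>t. snd C (rep (jet M k q) t) i) 0 = (deriv ^^ r) (\<lambda>t. snd C (q t) i) 0"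
  using rep_in_jet[OF assms, of k] unfolding jet_def by auto

lemma jet_rep_jet: "smooth_germ M q \<Longrightarrow> jet M k (rep (jet M k q)) = jet M k q"
  by (rule same_jet) (auto simp: rep_jet)

lemma jetsE:
  assumes "u \<in> jets M k"
  shows "smooth_germ M (rep u)" "jet M k (rep u) = u"
proof -
  obtain q where "smooth_germ M q" "u = jet M k q" using assms unfolding jets_def by blast
  then show "smooth_germ M (rep u)" "jet M k (rep u) = u" by (simp_all add: rep_jet jet_rep_jet)
qed

lemma jet_in_jets: "smooth_germ M q \<Longrightarrow> jet M k q \<in> jets M k"
  unfolding jets_def by auto

lemma jet_base_jet: "smooth_germ M q \<Longrightarrow> jet_base (jet M k q) = q 0"
  by (simp add: jet_base_def rep_jet)

lemma jet_in_tspace: "smooth_germ M q \<Longrightarrow> jet M 1 q \<in> tspace M (q 0)"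
  by (simp add: tspace_def jet_in_jets jet_base_jet)

lemma tspaceD:
  assumes "v \<in> tspace M p"
  shows "smooth_germ M (rep v)" "rep v 0 = p" "jet M 1 (rep v) = v" "v \<in> jets M 1"
  using assms jetsE[of v M 1] by (auto simp: tspace_def jet_base_def)

lemma vcomp_jet:
  assumes "smooth_germ M q" "C \<in> atlas M" "q 0 \<in> fst C" "i < mdim M"
  shows "vcomp C (jet M 1 q) i = deriv (\<lambda>t. snd C (q t) i) 0"
  using rep_jet(3)[OF assms, of 1 1] by (simp add: vcomp_def)

lemma smooth_curve_chart:
  assumes "smooth_curve M I c" "t \<in> I" "C \<in> atlas M" "c t \<in> fst C"
  obtains J where "t \<in> J" "J \<subseteq> I" "chart_smooth M C J c"
proof -
  have I: "open I" using assms(1) by (simp add: smooth_curve_def)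
  have ev: "\<forall>\<^sub>F s in nhds t. c s \<in> fst C"
    using assms unfolding smooth_curve_def by blast
  then obtain V where V: "open V" "t \<in> V" "\<forall>s\<in>V. c s \<in> fst C" unfolding eventually_nhds by blast
  have "smooth1 (V \<inter> I) (\<lambda>t. snd C (c t) i)" if "i < mdim M" for i
    unfolding smooth1_def using I V assms(1,3) that unfolding smooth_curve_def by blast
  then show ?thesis using V I assms(2,3)
    by (intro that[of "V \<inter> I"]) (auto simp: chart_smooth_def)
qed

lemma smooth_germ_chart:
  assumes "smooth_germ M q" "C \<in> atlas M" "q 0 \<in> fst C"
  obtains J where "0 \<in> J" "chart_smooth M C J q"
proof -
  obtain e where e: "e > 0" "smooth_curve M {-e<..<e} q"
    using assms(1) unfolding smooth_germ_def by blast
  have "0 \<in> {-e<..<e}" using e(1) by simp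
  then obtain J where "0 \<in> J" "J \<subseteq> {-e<..<e}" "chart_smooth M C J q"
    by (rule smooth_curve_chart[OF e(2) _ assms(2,3)])
  then show ?thesis using that by blast
qed

lemma smooth_germ_carrier: "smooth_germ M q \<Longrightarrow> q 0 \<in> mcarrier M"
  unfolding smooth_germ_def smooth_curve_def by auto

section \<open>From one chart to all charts: curves, jets and tangent vectors\<close>

context charted
begin

lemma chart_inv_chart: "C \<in> atlas M \<Longrightarrow> p \<in> fst C \<Longrightarrow> chart_inv C (snd C p) = p"
  using inj_chart by (rule inv_into_f_f)

lemma chart_chart_inv: "x \<in> snd C ` fst C \<Longrightarrow> snd C (chart_inv C x) = x"
  by (rule f_inv_into_f)

lemma chart_inv_in: "x \<in> snd C ` fst C \<Longrightarrow> chart_inv C x \<in> fst C"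
  by (rule inv_into_into)

lemma chart_EE: "C \<in> atlas M \<Longrightarrow> p \<in> fst C \<Longrightarrow> snd C p \<in> EE (mdim M)"
  using openin_EE_subset[OF open_chart] by blast

lemma chart_ext:
  assumes "C \<in> atlas M" "p \<in> fst C" "q \<in> fst C" "\<And>i. i < mdim M \<Longrightarrow> snd C p i = snd C q i"
  shows "p = q"
proof -
  have "snd C p = snd C q"
  proof
    fix i show "snd C p i = snd C q i"
      using assms chart_EE[of C p] chart_EE[of C q] by (cases "i < mdim M") (auto simp: EE_iff)
  qed
  then show ?thesis using inj_chart[OF assms(1)] assms(2,3) by (auto dest: inj_onD)
qed

lemma chart_smooth_stays:
  assumes c: "chart_smooth M C I c" and t: "t \<in> I" and U: "openin (Euclidean_space (mdim M)) U"
    and "snd C (c t) \<in> U"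
  obtains J where "open J" "t \<in> J" "J \<subseteq> I" "\<And>s. s \<in> J \<Longrightarrow> snd C (c s) \<in> U"
  by (rule curve_stays_in[of "mdim M" I "\<lambda>s. snd C (c s)" U t])
    (use chart_smoothD[OF c] chart_EE assms in auto)

lemma in_overlap:
  assumes "C \<in> atlas M" "p \<in> fst C" "snd C p \<in> snd C ` (fst C \<inter> fst D)"
  shows "p \<in> fst D"
  using assms inj_chart[OF assms(1)] by (auto dest: inj_onD)

lemma chart_smooth_overlap:
  assumes c: "chart_smooth M C I c" and t: "t \<in> I" and D: "D \<in> atlas M" "c t \<in> fst D"
  obtains J where "open J" "t \<in> J" "J \<subseteq> I" "\<And>s. s \<in> J \<Longrightarrow> c s \<in> fst C \<inter> fst D"
proof -
  note cD = chart_smoothD[OF c]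
  have "snd C (c t) \<in> snd C ` (fst C \<inter> fst D)" using cD(3)[OF t] D by auto
  then obtain J where J: "open J" "t \<in> J" "J \<subseteq> I" "\<And>s. s \<in> J \<Longrightarrow> snd C (c s) \<in> snd C ` (fst C \<inter> fst D)"
    using chart_smooth_stays[OF c t open_overlap[OF cD(1) D(1)]] by blast
  have "c s \<in> fst C \<inter> fst D" if "s \<in> J" for s
  proof -
    have s: "c s \<in> fst C" using cD(3) J(3) that by blast
    then show ?thesis using in_overlap[OF cD(1) s J(4)[OF that]] by simp
  qed
  then show ?thesis using J(1-3) that by blast
qed

lemma chart_smooth_change:
  assumes c: "chart_smooth M C I c" and t: "t \<in> I" and D: "D \<in> atlas M" "c t \<in> fst D"
  obtains J where "t \<in> J" "J \<subseteq> I" "chart_smooth M D J c"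
proof -
  note cD = chart_smoothD[OF c]
  obtain J where J: "open J" "t \<in> J" "J \<subseteq> I" "\<And>s. s \<in> J \<Longrightarrow> c s \<in> fst C \<inter> fst D"
    by (rule chart_smooth_overlap[OF assms]) blast
  have "smooth1 J (\<lambda>t. snd D (c t) j)" if j: "j < mdim M" for j
  proof -
    have "smooth1 J (\<lambda>t. snd D (chart_inv C (snd C (c t))) j)"
      by (rule smooth1_compose[OF smooth_transition[OF cD(1) D(1) j] J(1)])
        (use J smooth1_subset[OF cD(4)] in auto)
    then show ?thesis
      by (rule smooth1_cong) (use J cD(3) chart_inv_chart[OF cD(1)] in auto)
  qed
  then show ?thesis using J D by (intro that[of J]) (auto simp: chart_smooth_def)
qed

text \<open>\<open>smooth_curve\<close> quantifies over all charts at each time; smooth transition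
  maps reduce this to one chart, which may vary with the time.\<close>

lemma smooth_curveI:
  assumes I: "open I" and c: "\<And>t. t \<in> I \<Longrightarrow> \<exists>C J. t \<in> J \<and> chart_smooth M C J c"
  shows "smooth_curve M I c"
  unfolding smooth_curve_def
proof (intro conjI ballI allI impI I)
  fix t assume t: "t \<in> I"
  obtain C J where C: "t \<in> J" "chart_smooth M C J c" using c[OF t] by blast
  then show "c t \<in> mcarrier M" using chart_smoothD[OF C(2)] by (auto simp: mcarrier_def)
  fix D assume D: "D \<in> atlas M" "c t \<in> fst D"
  obtain K where K: "t \<in> K" "K \<subseteq> J" "chart_smooth M D K c"
    by (rule chart_smooth_change[OF C(2,1) D])
  note KD = chart_smoothD[OF K(3)]
  show "\<forall>\<^sub>F s in nhds t. c s \<in> fst D"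
    using eventually_nhds_in_open[OF KD(2) K(1)] by (rule eventually_mono) (rule KD(3))
  fix i r assume "i < mdim M"
  then show "(deriv ^^ r) (\<lambda>s. snd D (c s) i) differentiable (at t)"
    using KD(4) K(1) unfolding smooth1_def by blast
qed

lemma chart_smooth_curve: "chart_smooth M C I c \<Longrightarrow> smooth_curve M I c"
  using smooth_curveI chart_smoothD(2) by blast

lemma smooth_germI:
  assumes "chart_smooth M C J q" "0 \<in> J" shows "smooth_germ M q"
proof -
  obtain e where "e > 0" "ball 0 e \<subseteq> J"
    using chart_smoothD(2)[OF assms(1)] assms(2) open_contains_ball by blast
  moreover have "{-e<..<e} \<subseteq> ball 0 e" by (auto simp: dist_real_def)
  ultimately have "chart_smooth M C {-e<..<e} q"
    using chart_smooth_subset[OF assms(1), of "{-e<..<e}"] by auto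
  then show ?thesis using \<open>e > 0\<close> chart_smooth_curve unfolding smooth_germ_def by blast
qed

lemma chart_smooth_shift:
  assumes "chart_smooth M C I c"
  shows "chart_smooth M C {s. t + s \<in> I} (\<lambda>s. c (t + s))"
proof -
  note cD = chart_smoothD[OF assms]
  have "smooth1 {s. t + s \<in> I} (\<lambda>_. 0)"
    using smooth1_shift[OF smooth1_const[OF cD(2), of 0]] by simp
  then have "open {s. t + s \<in> I}" by (rule smooth1_open)
  then show ?thesis
    unfolding chart_smooth_def using cD smooth1_shift[of I "\<lambda>t. snd C (c t) i" t for i] by auto
qed

lemma smooth_germ_shift:
  assumes "smooth_curve M I c" "t \<in> I"
  shows "smooth_germ M (\<lambda>s. c (t + s))"
proof -
  have "c t \<in> mcarrier M" using assms by (auto simp: smooth_curve_def)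
  then obtain C where C: "C \<in> atlas M" "c t \<in> fst C" by (auto simp: mcarrier_def)
  obtain J where J: "t \<in> J" "J \<subseteq> I" "chart_smooth M C J c"
    by (rule smooth_curve_chart[OF assms C])
  show ?thesis using smooth_germI[OF chart_smooth_shift[OF J(3), of t]] J(1) by simp
qed

text \<open>Applied to the transition map, \<open>jet_lift\<close> becomes the change of jet
  coordinates.\<close>

lemma higher_deriv_change:
  assumes c: "chart_smooth M C I c" and t: "t \<in> I" and D: "D \<in> atlas M" "c t \<in> fst D" and j: "j < mdim M"
  shows "(deriv ^^ r) (\<lambda>s. snd D (c s) j) t =
    jet_lift (mdim M) (\<lambda>x. snd D (chart_inv C x) j) r (inf_jet (mdim M) (\<lambda>s. snd C (c s)) t)"
proof -
  note cD = chart_smoothD[OF c]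
  obtain J where J: "open J" "t \<in> J" "J \<subseteq> I" "\<And>s. s \<in> J \<Longrightarrow> c s \<in> fst C \<inter> fst D"
    by (rule chart_smooth_overlap[OF c t D]) blast
  have "(deriv ^^ r) (\<lambda>s. snd D (c s) j) t = (deriv ^^ r) (\<lambda>s. snd D (chart_inv C (snd C (c s))) j) t"
    by (rule deriv_cong_open[OF J(1,2)]) (use J chart_inv_chart[OF cD(1)] in auto)
  also have "\<dots> = jet_lift (mdim M) (\<lambda>x. snd D (chart_inv C x) j) r (inf_jet (mdim M) (\<lambda>s. snd C (c s)) t)"
    by (rule higher_deriv_compose_jet_lift[OF smooth_transition[OF cD(1) D(1) j] _ J(1) _ _ J(2)])
      (use j J smooth1_subset[OF cD(4)] in auto)
  finally show ?thesis .
qed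

text \<open>The definition of \<open>jet\<close> demands agreement in every chart. By
  \<open>higher_deriv_change\<close> the derivatives of order \<open>r\<close> in another chart
  depend only on those of order at most \<open>r\<close> in \<open>C\<close>.\<close>

lemma jet_eqI:
  assumes q: "smooth_germ M q" "smooth_germ M q'" and C: "C \<in> atlas M" "q 0 \<in> fst C" "q' 0 \<in> fst C"
    and eq: "\<And>i r. i < mdim M \<Longrightarrow> r \<le> k \<Longrightarrow>
      (deriv ^^ r) (\<lambda>t. snd C (q' t) i) 0 = (deriv ^^ r) (\<lambda>t. snd C (q t) i) 0"
  shows "jet M k q' = jet M k q"
proof (rule same_jet)
  show q0: "q' 0 = q 0" using eq[of _ 0] C by (intro chart_ext[of C]) auto
  fix D j r assume D: "D \<in> atlas M" "q 0 \<in> fst D" and j: "j < mdim M" and r: "r \<le> k"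
  obtain J where J: "0 \<in> J" "chart_smooth M C J q" by (rule smooth_germ_chart[OF q(1) C(1,2)])
  obtain J' where J': "0 \<in> J'" "chart_smooth M C J' q'" by (rule smooth_germ_chart[OF q(2) C(1,3)])
  have "inf_jet (mdim M) (\<lambda>s. snd C (q' s)) 0 i = inf_jet (mdim M) (\<lambda>s. snd C (q s)) 0 i"
    if "i < mdim M * Suc r" for i
  proof -
    have "i div mdim M < Suc r" using that by (intro less_mult_imp_div_less) (simp add: mult.commute)
    then show ?thesis unfolding inf_jet_def using j r by (intro eq) auto
  qed
  then show "(deriv ^^ r) (\<lambda>t. snd D (q' t) j) 0 = (deriv ^^ r) (\<lambda>t. snd D (q t) j) 0"
    using depends_below_jet_lift[of "mdim M" r "\<lambda>x. snd D (chart_inv C x) j"] q0 D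
    unfolding higher_deriv_change[OF J(2,1) D j] higher_deriv_change[OF J'(2,1) D(1) _ j, unfolded q0, OF D(2)]
    by (auto simp: depends_below_def)
qed

lemma tspace_ext:
  assumes v: "v \<in> tspace M p" and w: "w \<in> tspace M p" and C: "C \<in> atlas M" "p \<in> fst C"
    and eq: "\<And>i. i < mdim M \<Longrightarrow> vcomp C v i = vcomp C w i"
  shows "v = w"
proof -
  note vD = tspaceD[OF v] and wD = tspaceD[OF w]
  have "jet M 1 (rep v) = jet M 1 (rep w)"
  proof (rule jet_eqI[OF wD(1) vD(1) C(1)])
    fix i r assume "i < mdim M" "r \<le> (1::nat)"
    then show "(deriv ^^ r) (\<lambda>t. snd C (rep v t) i) 0 = (deriv ^^ r) (\<lambda>t. snd C (rep w t) i) 0"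
      using eq[of i] vD(2) wD(2) by (cases "r = 0") (auto simp: vcomp_def le_Suc_eq)
  qed (use vD wD C in auto)
  then show ?thesis using vD wD by simp
qed

lemma vcomp_change:
  assumes v: "v \<in> tspace M p" and C: "C \<in> atlas M" "p \<in> fst C" and D: "D \<in> atlas M" "p \<in> fst D"
    and j: "j < mdim M"
  shows "vcomp D v j = (\<Sum>i<mdim M. partial i (\<lambda>x. snd D (chart_inv C x) j) (snd C p) * vcomp C v i)"
proof -
  note vD = tspaceD[OF v]
  obtain I where I: "0 \<in> I" "chart_smooth M C I (rep v)"
    using smooth_germ_chart[OF vD(1) C(1)] C(2) vD(2) by auto
  note cD = chart_smoothD[OF I(2)]
  obtain J where J: "open J" "0 \<in> J" "J \<subseteq> I" "\<And>s. s \<in> J \<Longrightarrow> rep v s \<in> fst C \<inter> fst D"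
    using chart_smooth_overlap[OF I(2,1) D(1)] D(2) vD(2) by auto
  have "vcomp D v j = deriv (\<lambda>s. snd D (chart_inv C (snd C (rep v s))) j) 0"
    unfolding vcomp_def
    using deriv_cong_open[OF J(1,2), of "\<lambda>s. snd D (rep v s) j" "\<lambda>s. snd D (chart_inv C (snd C (rep v s))) j" 1]
      J chart_inv_chart[OF cD(1)] by auto
  also have "\<dots> = (\<Sum>i<mdim M. partial i (\<lambda>x. snd D (chart_inv C x) j) (snd C (rep v 0)) *
      deriv (\<lambda>s. snd C (rep v s) i) 0)"
    by (rule DERIV_imp_deriv[OF smooth1_chain[OF smooth_transition[OF cD(1) D(1) j] J(1) _ _ J(2)]])
      (use J smooth1_subset[OF cD(4)] in auto)
  finally show ?thesis by (simp add: vcomp_def vD)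
qed

lemma chart_inv_smooth:
  assumes C: "C \<in> atlas M" and I: "open I" and x: "\<And>t. t \<in> I \<Longrightarrow> x t \<in> snd C ` fst C"
    "\<And>i. i < mdim M \<Longrightarrow> smooth1 I (\<lambda>t. x t i)"
  shows "chart_smooth M C I (\<lambda>t. chart_inv C (x t))"
  unfolding chart_smooth_def
  using assms chart_inv_in[OF x(1)] smooth1_cong[OF x(2)] chart_chart_inv[OF x(1)] by auto

text \<open>The coordinate curve is defined for all times and may leave the image of the chart,
  where \<open>chart_inv\<close> has no meaning. The image is open, so the curve stays inside near
  time 0, and a jet uses only the germ.\<close>

lemma curve_through_chart:
  assumes C: "C \<in> atlas M" and x: "\<And>i. i < mdim M \<Longrightarrow> smooth1 UNIV (\<lambda>t. x t i)"
    "\<And>t. x t \<in> EE (mdim M)" "x 0 \<in> snd C ` fst C"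
  obtains J where "0 \<in> J" "chart_smooth M C J (\<lambda>t. chart_inv C (x t))"
    "\<And>t. t \<in> J \<Longrightarrow> snd C (chart_inv C (x t)) = x t"
proof -
  obtain J where J: "open J" "0 \<in> J" "\<And>t. t \<in> J \<Longrightarrow> x t \<in> snd C ` fst C"
    using curve_stays_in[OF x(1) open_UNIV x(2) open_chart[OF C] _ x(3)] by auto
  show ?thesis
  proof (rule that[of J])
    show "0 \<in> J" by fact
    show "chart_smooth M C J (\<lambda>t. chart_inv C (x t))"
      by (rule chart_inv_smooth[OF C J(1,3)]) (use smooth1_subset[OF x(1) J(1)] in auto)
    show "snd C (chart_inv C (x t)) = x t" if "t \<in> J" for t
      by (rule chart_chart_inv[OF J(3)[OF that]])
  qed
qed

lemma jet_of_chart_curve: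
  assumes C: "C \<in> atlas M" and x: "\<And>i. i < mdim M \<Longrightarrow> smooth1 UNIV (\<lambda>t. x t i)"
    "\<And>t. x t \<in> EE (mdim M)" "x 0 \<in> snd C ` fst C"
  shows "smooth_germ M (\<lambda>t. chart_inv C (x t))" "chart_inv C (x 0) \<in> fst C"
    "(deriv ^^ r) (\<lambda>t. snd C (chart_inv C (x t)) i) 0 = (deriv ^^ r) (\<lambda>t. x t i) 0"
proof -
  obtain J where J: "0 \<in> J" "chart_smooth M C J (\<lambda>t. chart_inv C (x t))"
    "\<And>t. t \<in> J \<Longrightarrow> snd C (chart_inv C (x t)) = x t"
    using curve_through_chart[OF assms] by metis
  show "smooth_germ M (\<lambda>t. chart_inv C (x t))" by (rule smooth_germI[OF J(2,1)])
  show "chart_inv C (x 0) \<in> fst C" using chart_smoothD(3)[OF J(2,1)] .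
  show "(deriv ^^ r) (\<lambda>t. snd C (chart_inv C (x t)) i) 0 = (deriv ^^ r) (\<lambda>t. x t i) 0"
    by (rule deriv_cong_open[OF chart_smoothD(2)[OF J(2)] J(1)]) (simp add: J(3))
qed

lemma tangent_vector_exists:
  assumes C: "C \<in> atlas M" "p \<in> fst C"
  shows "\<exists>v\<in>tspace M p. \<forall>i<mdim M. vcomp C v i = a i"
proof -
  \<comment> \<open>A straight line in the chart, starting at the coordinates of \<open>p\<close>
    with direction \<open>a\<close>.\<close>
  define x where "x t = (\<lambda>i. if i < mdim M then snd C p i + t * a i else 0)" for t
  have x0: "x 0 = snd C p" using chart_EE[OF C] by (auto simp: x_def EE_iff fun_eq_iff)
  have x: "\<And>i. i < mdim M \<Longrightarrow> smooth1 UNIV (\<lambda>t. x t i)" "\<And>t. x t \<in> EE (mdim M)" "x 0 \<in> snd C ` fst C"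
    using C(2) x0 by (auto simp: x_def EE_iff intro!: smooth1_add smooth1_mult smooth1_const smooth1_ident)
  note q = jet_of_chart_curve[OF C(1) x]
  have p: "chart_inv C (x 0) = p" using x0 chart_inv_chart[OF C] by simp
  have "vcomp C (jet M 1 (\<lambda>t. chart_inv C (x t))) i = a i" if "i < mdim M" for i
  proof -
    have "((\<lambda>t. x t i) has_real_derivative a i) (at 0)"
      using that by (auto simp: x_def intro!: derivative_eq_intros)
    then show ?thesis
      using vcomp_jet[OF q(1) C(1) q(2) that] q(3)[of 1 i] by (simp add: DERIV_imp_deriv)
  qed
  moreover have "jet M 1 (\<lambda>t. chart_inv C (x t)) \<in> tspace M p"
    using jet_in_tspace[OF q(1)] p by simp
  ultimately show ?thesis by blast
qed

lemma coord_vec: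
  assumes C: "C \<in> atlas M" "p \<in> fst C" and i: "i < mdim M"
  shows "coord_vec M C p i \<in> tspace M p"
    "j < mdim M \<Longrightarrow> vcomp C (coord_vec M C p i) j = (if j = i then 1 else 0)"
proof -
  define x where "x t = (snd C p)(i := snd C p i + t)" for t
  have x0: "x 0 = snd C p" by (simp add: x_def)
  have x: "\<And>i. i < mdim M \<Longrightarrow> smooth1 UNIV (\<lambda>t. x t i)" "\<And>t. x t \<in> EE (mdim M)" "x 0 \<in> snd C ` fst C"
  proof -
    show "smooth1 UNIV (\<lambda>t. x t j)" for j
      by (cases "j = i") (auto simp: x_def intro!: smooth1_add smooth1_const smooth1_ident)
  qed (use C(2) x0 chart_EE[OF C] i in \<open>auto simp: x_def\<close>)
  note q = jet_of_chart_curve[OF C(1) x]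
  have p: "chart_inv C (x 0) = p" using x0 chart_inv_chart[OF C] by simp
  have e: "coord_vec M C p i = jet M 1 (\<lambda>t. chart_inv C (x t))"
    by (simp add: coord_vec_def x_def)
  show "coord_vec M C p i \<in> tspace M p" using jet_in_tspace[OF q(1)] p e by simp
  have "((\<lambda>t. x t j) has_real_derivative (if j = i then 1 else 0)) (at 0)"
    by (auto simp: x_def intro!: derivative_eq_intros)
  then show "vcomp C (coord_vec M C p i) j = (if j = i then 1 else 0)" if "j < mdim M"
    using vcomp_jet[OF q(1) C(1) q(2) that] q(3)[of 1 j] by (simp add: e DERIV_imp_deriv)
qed

lemma velocity:
  assumes "smooth_curve M I c" "t \<in> I"
  shows "velocity M c t \<in> tspace M (c t)"
    "C \<in> atlas M \<Longrightarrow> c t \<in> fst C \<Longrightarrow> i < mdim M \<Longrightarrow> vcomp C (velocity M c t) i = deriv (\<lambda>s. snd C (c s) i) t"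
proof -
  note q = smooth_germ_shift[OF assms]
  show "velocity M c t \<in> tspace M (c t)" using jet_in_tspace[OF q] by (simp add: velocity_def)
  assume "C \<in> atlas M" "c t \<in> fst C" "i < mdim M"
  then show "vcomp C (velocity M c t) i = deriv (\<lambda>s. snd C (c s) i) t"
    using vcomp_jet[OF q, of C i] fun_cong[OF higher_deriv_shift[of 1 "\<lambda>s. snd C (c s) i" t], of 0]
    by (simp add: velocity_def)
qed

lemma zero_vec:
  assumes "p \<in> mcarrier M"
  shows "zero_vec M p \<in> tspace M p"
    "C \<in> atlas M \<Longrightarrow> p \<in> fst C \<Longrightarrow> i < mdim M \<Longrightarrow> vcomp C (zero_vec M p) i = 0"
proof -
  obtain C where "C \<in> atlas M" "p \<in> fst C" using assms by (auto simp: mcarrier_def)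
  then have "chart_smooth M C UNIV (\<lambda>_. p)" by (simp add: chart_smooth_def smooth1_const)
  then have q: "smooth_germ M (\<lambda>_. p)" by (rule smooth_germI) simp
  show "zero_vec M p \<in> tspace M p" using jet_in_tspace[OF q] by (simp add: zero_vec_def)
  show "vcomp C (zero_vec M p) i = 0" if "C \<in> atlas M" "p \<in> fst C" "i < mdim M" for C
    using vcomp_jet[OF q, of C i] that by (simp add: zero_vec_def)
qed

lemma scale_vec:
  assumes v: "v \<in> tspace M p" and p: "p \<in> mcarrier M"
  shows "scale_vec M a v \<in> tspace M p"
    "C \<in> atlas M \<Longrightarrow> p \<in> fst C \<Longrightarrow> i < mdim M \<Longrightarrow> vcomp C (scale_vec M a v) i = a * vcomp C v i"
proof -
  note vD = tspaceD[OF v]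
  have *: "smooth_germ M (\<lambda>t. rep v (a * t)) \<and> (\<forall>i<mdim M. deriv (\<lambda>t. snd C (rep v (a * t)) i) 0 = a * vcomp C v i)"
    if C: "C \<in> atlas M" "p \<in> fst C" for C
  proof -
    obtain I where I: "0 \<in> I" "chart_smooth M C I (rep v)"
      using smooth_germ_chart[OF vD(1) C(1)] C(2) vD(2) by auto
    note cD = chart_smoothD[OF I(2)]
    define J where "J = {t. a * t \<in> I}"
    have J: "open J" "0 \<in> J"
      using open_vimage[OF cD(2), of "\<lambda>t. a * t"] I(1) by (auto simp: J_def vimage_def continuous_on_mult_left)
    have at: "smooth1 J (\<lambda>t. a * t)" using J by (intro smooth1_mult smooth1_const smooth1_ident)
    have "smooth1 J (\<lambda>t. snd C (rep v (a * t)) i)" if "i < mdim M" for i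
      by (rule smooth1_comp[OF cD(4)[OF that] at]) (simp add: J_def)
    then have "chart_smooth M C J (\<lambda>t. rep v (a * t))"
      unfolding chart_smooth_def using J cD by (auto simp: J_def)
    moreover have "deriv (\<lambda>t. snd C (rep v (a * t)) i) 0 = a * vcomp C v i" if "i < mdim M" for i
    proof -
      have "((\<lambda>s. snd C (rep v s) i) has_real_derivative vcomp C v i) (at (a * 0))"
        using smooth1_D[OF cD(4)[OF that] I(1)] by (simp add: vcomp_def)
      moreover have "((\<lambda>t. a * t) has_real_derivative a) (at 0)"
        by (auto intro!: derivative_eq_intros)
      ultimately have "((\<lambda>t. snd C (rep v (a * t)) i) has_real_derivative vcomp C v i * a) (at 0)"
        by (rule DERIV_chain2)
      then show ?thesis by (simp add: DERIV_imp_deriv mult.commute)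
    qed
    ultimately show ?thesis using smooth_germI J(2) by blast
  qed
  obtain C where C: "C \<in> atlas M" "p \<in> fst C" using p by (auto simp: mcarrier_def)
  have q: "smooth_germ M (\<lambda>t. rep v (a * t))" using *[OF C] by blast
  show "scale_vec M a v \<in> tspace M p" using jet_in_tspace[OF q] vD(2) by (simp add: scale_vec_def)
  show "vcomp C (scale_vec M a v) i = a * vcomp C v i" if "C \<in> atlas M" "p \<in> fst C" "i < mdim M" for C
    using vcomp_jet[OF q, of C i] *[of C] vD(2) that by (simp add: scale_vec_def)
qed

end

subsection \<open>Change of chart for the Levi-Civita connection\<close>

lemma metric_coeff_alt: "metric_coeff M g C i j x =
    g (chart_inv C x) (coord_vec M C (chart_inv C x) i) (coord_vec M C (chart_inv C x) j)"
  by (simp add: metric_coeff_def Let_def)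

locale riem = charted M for M :: "'a manifold" +
  fixes g :: "'a metric"
  assumes riem: "riemannian_metric M g"
begin

lemma g_sym: "p \<in> mcarrier M \<Longrightarrow> v \<in> tspace M p \<Longrightarrow> w \<in> tspace M p \<Longrightarrow> g p v w = g p w v"
  and g_pos: "p \<in> mcarrier M \<Longrightarrow> v \<in> tspace M p \<Longrightarrow> v \<noteq> zero_vec M p \<Longrightarrow> g p v v > 0"
  using conjunct1[OF riem[unfolded riemannian_metric_def]] by simp_all

lemma g_expand:
  assumes "C \<in> atlas M" "p \<in> fst C" "v \<in> tspace M p" "w \<in> tspace M p"
  shows "g p v w = (\<Sum>i<mdim M. \<Sum>j<mdim M. vcomp C v i * vcomp C w j * metric_coeff M g C i j (snd C p))"
  using conjunct1[OF conjunct2[OF riem[unfolded riemannian_metric_def]]] assms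
  unfolding metric_coeff_alt chart_inv_chart[OF assms(1,2)] by simp

lemma metric_chart: assumes C: "C \<in> atlas M" shows "metric_chart M g C"
  unfolding metric_chart_def
proof (intro conjI ballI allI impI)
  show "openin (Euclidean_space (mdim M)) (snd C ` fst C)" by (rule open_chart[OF C])
  show "smooth_on (mdim M) (snd C ` fst C) (metric_coeff M g C i j)" if "i < mdim M" "j < mdim M" for i j
    using conjunct2[OF conjunct2[OF riem[unfolded riemannian_metric_def]]] C that by simp
  fix x assume x: "x \<in> snd C ` fst C"
  define p where "p = chart_inv C x"
  have p: "p \<in> fst C" "snd C p = x" using chart_inv_in[OF x] chart_chart_inv[OF x] by (auto simp: p_def)
  have pM: "p \<in> mcarrier M" using C p by (auto simp: mcarrier_def)
  show "metric_coeff M g C i j x = metric_coeff M g C j i x" if "i < mdim M" "j < mdim M" for i j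
    unfolding metric_coeff_alt p_def[symmetric]
    by (rule g_sym[OF pM coord_vec(1)[OF C p(1) that(1)] coord_vec(1)[OF C p(1) that(2)]])
  show "posdef (mdim M) (\<lambda>i j. metric_coeff M g C i j x)"
    unfolding posdef_def
  proof (intro allI impI)
    fix a :: "nat \<Rightarrow> real" assume a: "\<exists>i<mdim M. a i \<noteq> 0"
    obtain v where v: "v \<in> tspace M p" "\<And>i. i < mdim M \<Longrightarrow> vcomp C v i = a i"
      using tangent_vector_exists[OF C p(1), of a] by blast
    have "v \<noteq> zero_vec M p" using a v(2) zero_vec(2)[OF pM C p(1)] by auto
    then have "0 < g p v v" by (rule g_pos[OF pM v(1)])
    also have "g p v v = (\<Sum>i<mdim M. \<Sum>j<mdim M. a i * a j * metric_coeff M g C i j x)"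
      unfolding g_expand[OF C p(1) v(1) v(1)] p(2) by (simp add: v(2))
    finally show "0 < (\<Sum>i<mdim M. \<Sum>j<mdim M. a i * a j * metric_coeff M g C i j x)" .
  qed
qed

end

lemma sum_move_first3:
  "(\<Sum>a\<in>A. \<Sum>b\<in>B. \<Sum>c\<in>C. f a b c) = (\<Sum>b\<in>B. \<Sum>c\<in>C. \<Sum>a\<in>A. f a b c)" for f :: "_ \<Rightarrow> _ \<Rightarrow> _ \<Rightarrow> real"
  by (subst sum.swap) (intro sum.cong refl sum.swap)

lemma sum_move_first4:
  "(\<Sum>a\<in>A. \<Sum>b\<in>B. \<Sum>c\<in>C. \<Sum>d\<in>D. f a b c d) = (\<Sum>b\<in>B. \<Sum>c\<in>C. \<Sum>d\<in>D. \<Sum>a\<in>A. f a b c d)"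
  for f :: "_ \<Rightarrow> _ \<Rightarrow> _ \<Rightarrow> _ \<Rightarrow> real"
  by (subst sum.swap) (intro sum.cong refl sum_move_first3)

text \<open>Setting for the transformation law of the Christoffel symbols. Below,
  \<open>\<phi>\<close> is the transition map from \<open>C\<close> to \<open>D\<close>,
  \<open>J\<close> and \<open>H\<close> are its first and second derivatives at the point, and the
  suffixes \<open>c\<close> and \<open>d\<close> refer to the two charts.\<close>

locale chart_pair = riem M g for M :: "'a manifold" and g +
  fixes C D :: "'a chart" and p :: 'a
  assumes CD: "C \<in> atlas M" "D \<in> atlas M" and p: "p \<in> fst C" "p \<in> fst D"
begin

definition n :: nat where "n = mdim M"
definition U :: "(nat \<Rightarrow> real) set" where "U = snd C ` (fst C \<inter> fst D)"
definition \<phi> :: "nat \<Rightarrow> (nat \<Rightarrow> real) \<Rightarrow> real" where "\<phi> a x = snd D (chart_inv C x) a"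
definition J :: "nat \<Rightarrow> nat \<Rightarrow> real" where "J a i = partial i (\<phi> a) (snd C p)"
definition H :: "nat \<Rightarrow> nat \<Rightarrow> nat \<Rightarrow> real" where "H a l i = partial l (partial i (\<phi> a)) (snd C p)"
definition Gc :: "nat \<Rightarrow> nat \<Rightarrow> real" where "Gc i j = metric_coeff M g C i j (snd C p)"
definition Gd :: "nat \<Rightarrow> nat \<Rightarrow> real" where "Gd i j = metric_coeff M g D i j (snd D p)"
definition \<Gamma>c :: "nat \<Rightarrow> nat \<Rightarrow> nat \<Rightarrow> real" where "\<Gamma>c = christoffel M g C (snd C p)"
definition \<Gamma>d :: "nat \<Rightarrow> nat \<Rightarrow> nat \<Rightarrow> real" where "\<Gamma>d = christoffel M g D (snd D p)"

lemma U: "openin (Euclidean_space n) U" "snd C p \<in> U"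
  using open_overlap[OF CD] p by (auto simp: U_def n_def)

lemma \<phi>_smooth: "a < n \<Longrightarrow> smooth_on n U (\<phi> a)"
  using smooth_transition[OF CD] unfolding \<phi>_def[abs_def] U_def n_def by blast

lemma vcomp_J: "v \<in> tspace M p \<Longrightarrow> a < n \<Longrightarrow> vcomp D v a = (\<Sum>i<n. J a i * vcomp C v i)"
  using vcomp_change[OF _ CD(1) p(1) CD(2) p(2)] unfolding n_def J_def \<phi>_def[abs_def] by blast

text \<open>A tangent vector with prescribed components in \<open>D\<close> exists, and the Jacobian
  maps its components in \<open>C\<close> to these. This takes the place of an inverse
  Jacobian.\<close>

lemma J_surj: "\<exists>e. \<forall>a<n. E a = (\<Sum>i<n. J a i * e i)"
proof -
  obtain v where v: "v \<in> tspace M p" "\<And>i. i < mdim M \<Longrightarrow> vcomp D v i = E i"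
    using tangent_vector_exists[OF CD(2) p(2), of E] by blast
  show ?thesis using v(2) vcomp_J[OF v(1)] by (intro exI[of _ "vcomp C v"]) (auto simp: n_def)
qed

text \<open>Stated on all of \<open>U\<close> and not just at the point, because \<open>dGc\<close>
  differentiates it.\<close>

lemma Gc_eq_at:
  assumes x: "x \<in> U" and ij: "i < n" "j < n"
  shows "metric_coeff M g C i j x = (\<Sum>a<n. \<Sum>b<n. partial i (\<phi> a) x * partial j (\<phi> b) x *
     metric_coeff M g D a b (snd D (chart_inv C x)))"
proof -
  define q where "q = chart_inv C x"
  have q: "q \<in> fst C" "q \<in> fst D" "snd C q = x"
    using x chart_inv_chart[OF CD(1)] by (auto simp: q_def U_def)
  have v: "coord_vec M C q i \<in> tspace M q" "coord_vec M C q j \<in> tspace M q"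
    using coord_vec(1)[OF CD(1) q(1)] ij by (auto simp: n_def)
  have e: "vcomp D (coord_vec M C q i) a = partial i (\<phi> a) x" if "i < n" "a < n" for a i
  proof -
    have "vcomp D (coord_vec M C q i) a = (\<Sum>l<n. partial l (\<phi> a) x * vcomp C (coord_vec M C q i) l)"
      using vcomp_change[OF coord_vec(1)[OF CD(1) q(1)] CD(1) q(1) CD(2) q(2)] that q(3)
      unfolding \<phi>_def[abs_def] n_def by simp
    also have "\<dots> = (\<Sum>l<n. if l = i then partial i (\<phi> a) x else 0)"
      using coord_vec(2)[OF CD(1) q(1)] that by (intro sum.cong) (auto simp: n_def)
    finally show ?thesis using that by simp
  qed
  have "metric_coeff M g C i j x = g q (coord_vec M C q i) (coord_vec M C q j)"
    by (simp add: metric_coeff_alt q_def)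
  also have "\<dots> = (\<Sum>a<n. \<Sum>b<n. partial i (\<phi> a) x * partial j (\<phi> b) x * metric_coeff M g D a b (snd D q))"
    unfolding g_expand[OF CD(2) q(2) v] n_def[symmetric] using e ij by simp
  finally show ?thesis by (simp add: q_def)
qed

lemma dGc:
  assumes l: "l < n" and ij: "i < n" "j < n"
  shows "partial l (metric_coeff M g C i j) (snd C p) =
    (\<Sum>a<n. \<Sum>b<n. H a l i * J b j * Gd a b + J a i * H b l j * Gd a b
       + J a i * J b j * (\<Sum>c<n. partial c (metric_coeff M g D a b) (snd D p) * J c l))"
proof -
  define x where "x = snd C p"
  define h where "h y = snd D (chart_inv C y)" for y
  have x: "x \<in> U" "h x = snd D p" using U chart_inv_chart[OF CD(1) p(1)] by (auto simp: x_def h_def)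
  have hD: "h y \<in> snd D ` fst D" if "y \<in> U" for y
    using that chart_inv_chart[OF CD(1)] by (auto simp: h_def U_def)
  note mD = metric_chartD[OF metric_chart[OF CD(2)], folded n_def]
  have ev: "\<forall>\<^sub>F s in nhds (x l). x(l := s) \<in> U" by (rule eventually_update_in[OF U(1) x(1) l])
  have dG: "((\<lambda>s. metric_coeff M g D a b (h (x(l := s)))) has_real_derivative
      (\<Sum>c<n. partial c (metric_coeff M g D a b) (snd D p) * J c l)) (at (x l))" if "a < n" "b < n" for a b
  proof -
    have "((\<lambda>s. metric_coeff M g D a b (h (x(l := s)))) has_real_derivative
      (\<Sum>c<n. partial c (metric_coeff M g D a b) (h (x(l := x l))) * J c l)) (at (x l))"
    proof (rule smooth_on_chain_curve[OF mD(2)[OF that], where c="\<lambda>s. h (x(l := s))"])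
      show "h (x(l := x l)) \<in> snd D ` fst D" using hD[OF x(1)] by (simp only: fun_upd_triv)
      have "\<forall>\<^sub>F s in at (x l). x(l := s) \<in> U" using ev by (simp add: eventually_nhds_conv_at)
      then show "\<forall>\<^sub>F s in at (x l). h (x(l := s)) \<in> EE n"
        by eventually_elim (use hD openin_EE_subset[OF mD(1)] in auto)
      show "((\<lambda>s. h (x(l := s)) c) has_real_derivative J c l) (at (x l))" if "c < n" for c
        using smooth_on_partial_deriv[OF \<phi>_smooth[OF that] x(1) l] by (simp add: \<phi>_def h_def J_def x_def)
    qed
    then show ?thesis using x(2) by simp
  qed
  have dJ: "((\<lambda>s. partial i (\<phi> a) (x(l := s))) has_real_derivative H a l i) (at (x l))" if "a < n" "i < n" for a i
    using smooth_on_partial_deriv[OF smooth_on_partial[OF \<phi>_smooth[OF that(1)] that(2)] x(1) l]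
    by (simp add: H_def x_def)
  have "((\<lambda>s. \<Sum>a<n. \<Sum>b<n. partial i (\<phi> a) (x(l := s)) * partial j (\<phi> b) (x(l := s)) *
      metric_coeff M g D a b (h (x(l := s)))) has_real_derivative
     (\<Sum>a<n. \<Sum>b<n. (H a l i * partial j (\<phi> b) (x(l := x l)) + H b l j * partial i (\<phi> a) (x(l := x l))) *
        metric_coeff M g D a b (h (x(l := x l)))
       + (\<Sum>c<n. partial c (metric_coeff M g D a b) (snd D p) * J c l)
          * (partial i (\<phi> a) (x(l := x l)) * partial j (\<phi> b) (x(l := x l))))) (at (x l))"
    using ij by (intro DERIV_sum DERIV_mult dJ dG) auto
  then have D: "((\<lambda>s. \<Sum>a<n. \<Sum>b<n. partial i (\<phi> a) (x(l := s)) * partial j (\<phi> b) (x(l := s)) *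
      metric_coeff M g D a b (h (x(l := s)))) has_real_derivative
     (\<Sum>a<n. \<Sum>b<n. H a l i * J b j * Gd a b + J a i * H b l j * Gd a b
       + J a i * J b j * (\<Sum>c<n. partial c (metric_coeff M g D a b) (snd D p) * J c l))) (at (x l))"
    by (rule back_subst[where P="\<lambda>d. (_ has_real_derivative d) _"])
      (intro sum.cong refl, simp add: x(2) J_def[symmetric] Gd_def[symmetric] x_def[symmetric] J_def[folded x_def, symmetric] algebra_simps)
  have "partial l (metric_coeff M g C i j) x = deriv (\<lambda>s. \<Sum>a<n. \<Sum>b<n. partial i (\<phi> a) (x(l := s)) * partial j (\<phi> b) (x(l := s)) *
      metric_coeff M g D a b (h (x(l := s)))) (x l)"
    unfolding partial_def
    by (rule deriv_cong_ev[OF _ refl]) (use ev in \<open>eventually_elim, simp add: Gc_eq_at[OF _ ij] h_def partial_def[abs_def]\<close>)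
  then show ?thesis using DERIV_imp_deriv[OF D] by (simp add: x_def)
qed

text \<open>The defect in the transformation law. It is shown to vanish through its symmetries,
  without an explicit formula for the Christoffel symbols.\<close>

definition E :: "nat \<Rightarrow> nat \<Rightarrow> nat \<Rightarrow> real" where
  "E a l i = (\<Sum>m<n. J a m * \<Gamma>c m l i) - H a l i - (\<Sum>c<n. \<Sum>d<n. \<Gamma>d a c d * J c l * J d i)"

text \<open>The defect lowered with the metric of \<open>D\<close>, with the lowered index pulled
  back to \<open>C\<close>. All three indices then refer to the same chart, as
  \<open>sym_antisym_eq_0\<close> requires.\<close>

definition B :: "nat \<Rightarrow> nat \<Rightarrow> nat \<Rightarrow> real" where
  "B l i j = (\<Sum>a<n. \<Sum>b<n. E a l i * Gd a b * J b j)"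

lemma in_charts: "snd C p \<in> snd C ` fst C" "snd D p \<in> snd D ` fst D"
  using p by auto

lemmas lc_c = levi_civita_coeffsD[OF christoffel_levi_civita[OF metric_chart[OF CD(1)] in_charts(1)], folded n_def Gc_def \<Gamma>c_def]
lemmas lc_d = levi_civita_coeffsD[OF christoffel_levi_civita[OF metric_chart[OF CD(2)] in_charts(2)], folded n_def Gd_def \<Gamma>d_def]
lemmas Gc_sym = metric_chartD(4)[OF metric_chart[OF CD(1)] in_charts(1), folded n_def Gc_def]
lemmas Gd_sym = metric_chartD(4)[OF metric_chart[OF CD(2)] in_charts(2), folded n_def Gd_def]

lemma Gc_eq: "i < n \<Longrightarrow> j < n \<Longrightarrow> Gc i j = (\<Sum>a<n. \<Sum>b<n. J a i * J b j * Gd a b)"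
  using Gc_eq_at[OF U(2)] chart_inv_chart[OF CD(1) p(1)] by (simp add: Gc_def Gd_def J_def)

lemma E_sym: "a < n \<Longrightarrow> l < n \<Longrightarrow> i < n \<Longrightarrow> E a l i = E a i l"
proof -
  assume lt: "a < n" "l < n" "i < n"
  have "(\<Sum>c<n. \<Sum>d<n. \<Gamma>d a c d * J c l * J d i) = (\<Sum>d<n. \<Sum>c<n. \<Gamma>d a c d * J c l * J d i)"
    by (rule sum.swap)
  also have "\<dots> = (\<Sum>d<n. \<Sum>c<n. \<Gamma>d a d c * J d i * J c l)"
    using lt lc_d(1) by (intro sum.cong) auto
  finally have 1: "(\<Sum>c<n. \<Sum>d<n. \<Gamma>d a c d * J c l * J d i) = (\<Sum>d<n. \<Sum>c<n. \<Gamma>d a d c * J d i * J c l)" .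
  have 2: "(\<Sum>m<n. J a m * \<Gamma>c m l i) = (\<Sum>m<n. J a m * \<Gamma>c m i l)"
    using lt lc_c(1) by (intro sum.cong) auto
  have "H a l i = H a i l" unfolding H_def using partial_commute[OF \<phi>_smooth U(2)] lt by blast
  then show ?thesis using 1 2 by (simp add: E_def)
qed

text \<open>Rearranged so that the symbols of both charts appear lowered, the form to which
  compatibility with the metric can be applied.\<close>

lemma B_expand:
  assumes "l < n" "i < n" "j < n"
  shows "B l i j = (\<Sum>m<n. \<Gamma>c m l i * Gc m j) - (\<Sum>a<n. \<Sum>b<n. H a l i * J b j * Gd a b)
    - (\<Sum>c<n. \<Sum>d<n. \<Sum>b<n. J c l * J d i * J b j * (\<Sum>a<n. \<Gamma>d a c d * Gd a b))"
proof -
  have "(\<Sum>a<n. \<Sum>b<n. (\<Sum>m<n. J a m * \<Gamma>c m l i) * Gd a b * J b j)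
    = (\<Sum>a<n. \<Sum>b<n. \<Sum>m<n. J a m * \<Gamma>c m l i * Gd a b * J b j)"
    by (simp add: sum_distrib_right)
  also have "\<dots> = (\<Sum>m<n. \<Sum>a<n. \<Sum>b<n. J a m * \<Gamma>c m l i * Gd a b * J b j)"
    by (rule sum_move_first3[symmetric])
  also have "\<dots> = (\<Sum>m<n. \<Gamma>c m l i * Gc m j)"
    using assms by (intro sum.cong) (auto simp: Gc_eq sum_distrib_left mult_ac)
  finally have 1: "(\<Sum>a<n. \<Sum>b<n. (\<Sum>m<n. J a m * \<Gamma>c m l i) * Gd a b * J b j) = (\<Sum>m<n. \<Gamma>c m l i * Gc m j)" .
  have "(\<Sum>a<n. \<Sum>b<n. (\<Sum>c<n. \<Sum>d<n. \<Gamma>d a c d * J c l * J d i) * Gd a b * J b j)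
    = (\<Sum>a<n. \<Sum>b<n. \<Sum>c<n. \<Sum>d<n. \<Gamma>d a c d * J c l * J d i * Gd a b * J b j)"
    by (simp add: sum_distrib_right)
  also have "\<dots> = (\<Sum>b<n. \<Sum>c<n. \<Sum>d<n. \<Sum>a<n. \<Gamma>d a c d * J c l * J d i * Gd a b * J b j)"
    by (rule sum_move_first4)
  also have "\<dots> = (\<Sum>c<n. \<Sum>d<n. \<Sum>b<n. \<Sum>a<n. \<Gamma>d a c d * J c l * J d i * Gd a b * J b j)"
    by (rule sum_move_first3)
  also have "\<dots> = (\<Sum>c<n. \<Sum>d<n. \<Sum>b<n. J c l * J d i * J b j * (\<Sum>a<n. \<Gamma>d a c d * Gd a b))"
    by (simp add: sum_distrib_left mult_ac)
  finally have 2: "(\<Sum>a<n. \<Sum>b<n. (\<Sum>c<n. \<Sum>d<n. \<Gamma>d a c d * J c l * J d i) * Gd a b * J b j)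
    = (\<Sum>c<n. \<Sum>d<n. \<Sum>b<n. J c l * J d i * J b j * (\<Sum>a<n. \<Gamma>d a c d * Gd a b))" .
  show ?thesis unfolding B_def E_def left_diff_distrib sum_subtractf 1 2 by (simp add: mult_ac)
qed

text \<open>Compatibility in \<open>C\<close> turns the first terms of \<open>B_expand\<close> into
  a derivative of the metric in \<open>C\<close>, compatibility in \<open>D\<close> turns the last
  ones into the pulled back derivative of the metric in \<open>D\<close>, and by \<open>dGc\<close>
  these differ exactly by the terms with \<open>H\<close>.\<close>

lemma B_antisym:
  assumes l: "l < n" and ij: "i < n" "j < n"
  shows "B l i j + B l j i = 0"
proof -
  define T where "T c d b = (\<Sum>a<n. \<Gamma>d a c d * Gd a b)" for c d b
  have dG: "T c d b + T c b d = partial c (metric_coeff M g D d b) (snd D p)" if "c < n" "d < n" "b < n" for c d b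
  proof -
    have "(\<Sum>m<n. \<Gamma>d m c b * Gd d m) = T c b d"
      unfolding T_def using Gd_sym that by (intro sum.cong) auto
    then show ?thesis using lc_d(2)[OF that] by (simp add: T_def)
  qed
  have "(\<Sum>m<n. \<Gamma>c m l j * Gc m i) = (\<Sum>m<n. \<Gamma>c m l j * Gc i m)"
    using Gc_sym ij by (intro sum.cong) auto
  then have a: "(\<Sum>m<n. \<Gamma>c m l i * Gc m j) + (\<Sum>m<n. \<Gamma>c m l j * Gc m i) = partial l (metric_coeff M g C i j) (snd C p)"
    using lc_c(2)[OF l ij] by simp
  have b: "(\<Sum>a<n. \<Sum>b<n. H a l j * J b i * Gd a b) = (\<Sum>a<n. \<Sum>b<n. J a i * H b l j * Gd a b)"
  proof -
    have "(\<Sum>a<n. \<Sum>b<n. H a l j * J b i * Gd a b) = (\<Sum>b<n. \<Sum>a<n. H a l j * J b i * Gd a b)"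
      by (rule sum.swap)
    also have "\<dots> = (\<Sum>b<n. \<Sum>a<n. J b i * H a l j * Gd b a)"
      using Gd_sym by (intro sum.cong) auto
    finally show ?thesis .
  qed
  have c: "(\<Sum>c<n. \<Sum>d<n. \<Sum>b<n. J c l * J d i * J b j * T c d b) + (\<Sum>c<n. \<Sum>d<n. \<Sum>b<n. J c l * J d j * J b i * T c d b)
    = (\<Sum>a<n. \<Sum>b<n. J a i * J b j * (\<Sum>c<n. partial c (metric_coeff M g D a b) (snd D p) * J c l))"
  proof -
    have "(\<Sum>c<n. \<Sum>d<n. \<Sum>b<n. J c l * J d j * J b i * T c d b) = (\<Sum>c<n. \<Sum>b<n. \<Sum>d<n. J c l * J d j * J b i * T c d b)"
      by (intro sum.cong refl sum.swap)
    then have "(\<Sum>c<n. \<Sum>d<n. \<Sum>b<n. J c l * J d i * J b j * T c d b) + (\<Sum>c<n. \<Sum>d<n. \<Sum>b<n. J c l * J d j * J b i * T c d b)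
      = (\<Sum>c<n. \<Sum>d<n. \<Sum>b<n. J c l * J d i * J b j * T c d b + J c l * J b j * J d i * T c b d)"
      by (simp add: sum.distrib)
    also have "\<dots> = (\<Sum>c<n. \<Sum>d<n. \<Sum>b<n. J d i * J b j * (partial c (metric_coeff M g D d b) (snd D p) * J c l))"
      by (intro sum.cong refl) (simp add: dG[symmetric] algebra_simps)
    also have "\<dots> = (\<Sum>d<n. \<Sum>b<n. \<Sum>c<n. J d i * J b j * (partial c (metric_coeff M g D d b) (snd D p) * J c l))"
      by (rule sum_move_first3)
    finally show ?thesis by (simp add: sum_distrib_left)
  qed
  show ?thesis
    using a b c dGc[OF l ij]
    unfolding B_expand[OF l ij] B_expand[OF l ij(2,1)] T_def sum.distrib by linarith
qed

lemma E_eq_0: "a < n \<Longrightarrow> l < n \<Longrightarrow> i < n \<Longrightarrow> E a l i = 0"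
proof -
  assume lt: "a < n" "l < n" "i < n"
  have B0: "B l i j = 0" if "j < n" for j
  proof (rule sym_antisym_eq_0[OF _ B_antisym lt(2,3) that])
    show "B l i j = B i l j" if "l < n" "i < n" for l i j
      unfolding B_def using E_sym[OF _ that] by simp
  qed
  \<comment> \<open>Surjectivity of the Jacobian lets the vanishing of \<open>B\<close> test the
    defect against itself: the quadratic form of \<open>Gd\<close> is zero on it.\<close>
  obtain e where e: "\<forall>b<n. E b l i = (\<Sum>j<n. J b j * e j)" using J_surj[of "\<lambda>b. E b l i"] by blast
  have "(\<Sum>a<n. \<Sum>b<n. E a l i * E b l i * Gd a b) = (\<Sum>a<n. \<Sum>b<n. \<Sum>j<n. e j * (E a l i * Gd a b * J b j))"
    using e by (simp add: sum_distrib_left sum_distrib_right mult_ac)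
  also have "\<dots> = (\<Sum>j<n. e j * B l i j)"
    unfolding B_def sum_distrib_left by (rule sum_move_first3[symmetric])
  also have "\<dots> = 0" using B0 by simp
  finally show "E a l i = 0"
    using posdef_eq_0[OF metric_chartD(3)[OF metric_chart[OF CD(2)] in_charts(2), folded n_def Gd_def], of "\<lambda>a. E a l i" a] lt
    by simp
qed

lemma christoffel_change:
  assumes "a < n" "l < n" "i < n"
  shows "(\<Sum>m<n. J a m * \<Gamma>c m l i) = H a l i + (\<Sum>c<n. \<Sum>d<n. \<Gamma>d a c d * J c l * J d i)"
  using E_eq_0[OF assms] by (simp add: E_def)

end

section \<open>The covariant derivative computed in one chart\<close>

context riem
begin

text \<open>Acts on component functions instead of vector fields along the curve, so that it can be
  iterated by function powers in step with \<open>cov_deriv\<close>.\<close>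

definition cov_rhs :: "'a chart \<Rightarrow> (real \<Rightarrow> 'a) \<Rightarrow> (nat \<Rightarrow> real \<Rightarrow> real) \<Rightarrow> nat \<Rightarrow> real \<Rightarrow> real" where
  "cov_rhs C c a m t = deriv (a m) t + (\<Sum>i<mdim M. \<Sum>j<mdim M.
     christoffel M g C (snd C (c t)) m i j * deriv (\<lambda>s. snd C (c s) i) t * a j t)"

text \<open>Differentiating the transformed components brings in second derivatives of the
  transition map; \<open>christoffel_change\<close> absorbs exactly these.\<close>

lemma cov_rhs_change:
  assumes c: "chart_smooth M C I c" and V: "\<And>s. s \<in> I \<Longrightarrow> V s \<in> tspace M (c s)"
    and Vs: "\<And>i. i < mdim M \<Longrightarrow> smooth1 I (\<lambda>s. vcomp C (V s) i)"
    and t: "t \<in> I" and D: "D \<in> atlas M" "c t \<in> fst D"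
    and w: "w \<in> tspace M (c t)" "\<And>m. m < mdim M \<Longrightarrow> vcomp C w m = cov_rhs C c (\<lambda>i s. vcomp C (V s) i) m t"
    and a: "a < mdim M"
  shows "(\<lambda>s. vcomp D (V s) a) differentiable (at t)"
    "vcomp D w a = cov_rhs D c (\<lambda>i s. vcomp D (V s) i) a t"
proof -
  note cD = chart_smoothD[OF c]
  interpret P: chart_pair M g C D "c t"
    by unfold_locales (use cD D t in auto)
  note [simp] = P.n_def[symmetric]
  define v' where "v' i = deriv (\<lambda>s. vcomp C (V s) i) t" for i
  define x' where "x' i = deriv (\<lambda>s. snd C (c s) i) t" for i
  define v where "v i = vcomp C (V t) i" for i
  obtain K where K: "open K" "t \<in> K" "K \<subseteq> I" "\<And>s. s \<in> K \<Longrightarrow> c s \<in> fst C \<inter> fst D"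
    using chart_smooth_overlap[OF c t D] by metis
  have VD: "vcomp D (V s) a = (\<Sum>i<P.n. partial i (P.\<phi> a) (snd C (c s)) * vcomp C (V s) i)"
    if "s \<in> K" "a < P.n" for s a
    using vcomp_change[OF V cD(1) _ D(1)] K that unfolding P.\<phi>_def[abs_def] by (auto simp: subset_iff)
  have evK: "\<forall>\<^sub>F s in nhds t. s \<in> K" using K eventually_nhds_in_open by blast
  have der: "((\<lambda>s. vcomp D (V s) a) has_real_derivative
      (\<Sum>i<P.n. (\<Sum>l<P.n. P.H a l i * x' l) * v i + v' i * P.J a i)) (at t)" if a: "a < P.n" for a
  proof -
    have "((\<lambda>s. partial i (P.\<phi> a) (snd C (c s))) has_real_derivative (\<Sum>l<P.n. P.H a l i * x' l)) (at t)"
      if "i < P.n" for i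
      unfolding P.H_def x'_def
    proof (rule smooth1_chain[OF smooth_on_partial[OF P.\<phi>_smooth[OF a] that] K(1) _ _ K(2)])
      show "smooth1 K (\<lambda>s. snd C (c s) l)" if "l < P.n" for l
        using smooth1_subset[OF cD(4) K(1,3)] that by simp
      show "snd C (c s) \<in> P.U" if "s \<in> K" for s using K(4)[OF that] by (auto simp: P.U_def)
    qed
    moreover have "((\<lambda>s. vcomp C (V s) i) has_real_derivative v' i) (at t)" if "i < P.n" for i
      unfolding v'_def using smooth1_D[OF Vs t] that by simp
    ultimately have D1: "((\<lambda>s. \<Sum>i<P.n. partial i (P.\<phi> a) (snd C (c s)) * vcomp C (V s) i) has_real_derivative
      (\<Sum>i<P.n. (\<Sum>l<P.n. P.H a l i * x' l) * v i + v' i * P.J a i)) (at t)"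
      unfolding v_def P.J_def by (intro DERIV_sum DERIV_mult) auto
    have D2: "\<forall>\<^sub>F s in nhds t. (\<Sum>i<P.n. partial i (P.\<phi> a) (snd C (c s)) * vcomp C (V s) i) = vcomp D (V s) a"
      using evK by eventually_elim (simp add: VD[OF _ a])
    show ?thesis by (rule iffD1[OF DERIV_cong_ev[OF refl D2 refl] D1])
  qed
  show "(\<lambda>s. vcomp D (V s) a) differentiable (at t)"
    using der a by (auto simp: real_differentiable_def)
  have xD: "deriv (\<lambda>s. snd D (c s) b) t = (\<Sum>i<P.n. P.J b i * x' i)" if "b < P.n" for b
    using P.vcomp_J[OF velocity(1)[OF chart_smooth_curve[OF c] t] that]
      velocity(2)[OF chart_smooth_curve[OF c] t] that D t cD(1,3) by (simp add: x'_def)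
  have vD: "vcomp D (V t) b = (\<Sum>i<P.n. P.J b i * v i)" if "b < P.n" for b
    using P.vcomp_J[OF V[OF t] that] by (simp add: v_def)
  have an: "a < P.n" using a by simp
  have w': "vcomp C w m = v' m + (\<Sum>i<P.n. \<Sum>j<P.n. P.\<Gamma>c m i j * x' i * v j)" if "m < P.n" for m
    using w(2) that by (simp add: cov_rhs_def v'_def x'_def v_def P.\<Gamma>c_def)
  have "vcomp D w a = (\<Sum>m<P.n. P.J a m * v' m) + (\<Sum>m<P.n. \<Sum>i<P.n. \<Sum>j<P.n. P.J a m * P.\<Gamma>c m i j * x' i * v j)"
    unfolding P.vcomp_J[OF w(1) an] by (simp add: w' distrib_left sum.distrib sum_distrib_left mult_ac)
  also have "(\<Sum>m<P.n. \<Sum>i<P.n. \<Sum>j<P.n. P.J a m * P.\<Gamma>c m i j * x' i * v j)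
    = (\<Sum>i<P.n. \<Sum>j<P.n. \<Sum>m<P.n. P.J a m * P.\<Gamma>c m i j * x' i * v j)"
    by (rule sum_move_first3)
  also have "\<dots> = (\<Sum>i<P.n. \<Sum>j<P.n. (\<Sum>m<P.n. P.J a m * P.\<Gamma>c m i j) * x' i * v j)"
    by (simp add: sum_distrib_right)
  also have "\<dots> = (\<Sum>i<P.n. \<Sum>j<P.n. (P.H a i j + (\<Sum>c<P.n. \<Sum>d<P.n. P.\<Gamma>d a c d * P.J c i * P.J d j)) * x' i * v j)"
    by (simp add: P.christoffel_change an)
  also have "\<dots> = (\<Sum>i<P.n. \<Sum>j<P.n. P.H a i j * x' i * v j) +
     (\<Sum>i<P.n. \<Sum>j<P.n. \<Sum>c<P.n. \<Sum>d<P.n. P.\<Gamma>d a c d * (P.J c i * x' i) * (P.J d j * v j))"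
    by (simp add: distrib_left distrib_right sum.distrib sum_distrib_left sum_distrib_right mult_ac)
  also have "(\<Sum>i<P.n. \<Sum>j<P.n. \<Sum>c<P.n. \<Sum>d<P.n. P.\<Gamma>d a c d * (P.J c i * x' i) * (P.J d j * v j))
    = (\<Sum>c<P.n. \<Sum>d<P.n. P.\<Gamma>d a c d * (\<Sum>i<P.n. P.J c i * x' i) * (\<Sum>j<P.n. P.J d j * v j))"
  proof -
    have "(\<Sum>i<P.n. \<Sum>j<P.n. \<Sum>c<P.n. \<Sum>d<P.n. P.\<Gamma>d a c d * (P.J c i * x' i) * (P.J d j * v j))
       = (\<Sum>j<P.n. \<Sum>c<P.n. \<Sum>d<P.n. \<Sum>i<P.n. P.\<Gamma>d a c d * (P.J c i * x' i) * (P.J d j * v j))"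
      by (rule sum_move_first4)
    also have "\<dots> = (\<Sum>c<P.n. \<Sum>d<P.n. \<Sum>j<P.n. \<Sum>i<P.n. P.\<Gamma>d a c d * (P.J c i * x' i) * (P.J d j * v j))"
      by (rule sum_move_first3)
    also have "\<dots> = (\<Sum>c<P.n. \<Sum>d<P.n. \<Sum>i<P.n. \<Sum>j<P.n. P.\<Gamma>d a c d * (P.J c i * x' i) * (P.J d j * v j))"
      by (intro sum.cong refl sum.swap)
    finally show ?thesis by (simp add: sum_distrib_left sum_distrib_right mult_ac)
  qed
  also have "(\<Sum>i<P.n. \<Sum>j<P.n. P.H a i j * x' i * v j) = (\<Sum>j<P.n. \<Sum>i<P.n. P.H a i j * x' i * v j)"
    by (rule sum.swap)
  also have "\<dots> = (\<Sum>j<P.n. (\<Sum>i<P.n. P.H a i j * x' i) * v j)"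
    by (simp add: sum_distrib_right)
  finally show "vcomp D w a = cov_rhs D c (\<lambda>i s. vcomp D (V s) i) a t"
    using DERIV_imp_deriv[OF der[OF an]]
    by (simp add: cov_rhs_def xD vD P.\<Gamma>d_def[symmetric] sum.distrib sum_distrib_right mult_ac)
qed

text \<open>\<open>has_cov_deriv\<close> asks for the formula in every chart around the point; by
  \<open>cov_rhs_change\<close> it holds in all of them as soon as it holds in one.\<close>

lemma has_cov_deriv_iff_chart:
  assumes c: "chart_smooth M C I c" and V: "\<And>s. s \<in> I \<Longrightarrow> V s \<in> tspace M (c s)"
    and Vs: "\<And>i. i < mdim M \<Longrightarrow> smooth1 I (\<lambda>s. vcomp C (V s) i)" and t: "t \<in> I"
    and w: "w \<in> tspace M (c t)"
  shows "has_cov_deriv M g c V t w \<longleftrightarrow> (\<forall>m<mdim M. vcomp C w m = cov_rhs C c (\<lambda>i s. vcomp C (V s) i) m t)"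
proof -
  note cD = chart_smoothD[OF c]
  have vel: "vcomp D (velocity M c t) i = deriv (\<lambda>s. snd D (c s) i) t"
    if "D \<in> atlas M" "c t \<in> fst D" "i < mdim M" for D i
    using velocity(2)[OF chart_smooth_curve[OF c] t] that by blast
  have ev: "\<forall>\<^sub>F s in nhds t. V s \<in> tspace M (c s)"
    using eventually_nhds_in_open[OF cD(2) t] by eventually_elim (rule V)
  show ?thesis
  proof
    assume "has_cov_deriv M g c V t w"
    then show "\<forall>m<mdim M. vcomp C w m = cov_rhs C c (\<lambda>i s. vcomp C (V s) i) m t"
      using cD(1) cD(3)[OF t] vel unfolding has_cov_deriv_def cov_rhs_def by simp
  next
    assume eq: "\<forall>m<mdim M. vcomp C w m = cov_rhs C c (\<lambda>i s. vcomp C (V s) i) m t"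
    show "has_cov_deriv M g c V t w"
      unfolding has_cov_deriv_def
    proof (intro conjI ev w ballI impI allI)
      fix D m assume D: "D \<in> atlas M" "c t \<in> fst D" and m: "m < mdim M"
      note r = cov_rhs_change[OF c V Vs t D w _ m]
      show "(\<lambda>s. vcomp D (V s) m) differentiable (at t)" using r(1) eq by blast
      have "vcomp D w m = cov_rhs D c (\<lambda>i s. vcomp D (V s) i) m t" using r(2) eq by blast
      then show "vcomp D w m = deriv (\<lambda>s. vcomp D (V s) m) t +
             (\<Sum>i<mdim M. \<Sum>j<mdim M. christoffel M g D (snd D (c t)) m i j *
                vcomp D (velocity M c t) i * vcomp D (V t) j)"
        using vel[OF D] by (simp add: cov_rhs_def)
    qed
  qed
qed

text \<open>Resolves the definite description: a vector with the right components exists, and its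
  components in one chart determine it.\<close>

lemma cov_deriv_chart:
  assumes c: "chart_smooth M C I c" and V: "\<And>s. s \<in> I \<Longrightarrow> V s \<in> tspace M (c s)"
    and Vs: "\<And>i. i < mdim M \<Longrightarrow> smooth1 I (\<lambda>s. vcomp C (V s) i)" and t: "t \<in> I"
  shows "cov_deriv M g c V t \<in> tspace M (c t)"
    "m < mdim M \<Longrightarrow> vcomp C (cov_deriv M g c V t) m = cov_rhs C c (\<lambda>i s. vcomp C (V s) i) m t"
proof -
  note cD = chart_smoothD[OF c]
  note iff = has_cov_deriv_iff_chart[OF c V Vs t]
  obtain w where w: "w \<in> tspace M (c t)" "\<And>m. m < mdim M \<Longrightarrow> vcomp C w m = cov_rhs C c (\<lambda>i s. vcomp C (V s) i) m t"
    using tangent_vector_exists[OF cD(1) cD(3)[OF t], of "\<lambda>m. cov_rhs C c (\<lambda>i s. vcomp C (V s) i) m t"] by blast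
  have "cov_deriv M g c V t = w"
    unfolding cov_deriv_def
  proof (rule the_equality)
    show "has_cov_deriv M g c V t w" using iff[OF _ _ w(1)] w(2) by blast
    fix w' assume w': "has_cov_deriv M g c V t w'"
    then have "w' \<in> tspace M (c t)" by (simp add: has_cov_deriv_def)
    then show "w' = w"
      using iff[OF _ _ \<open>w' \<in> tspace M (c t)\<close>] w' w by (intro tspace_ext[OF _ w(1) cD(1) cD(3)[OF t]]) auto
  qed
  then show "cov_deriv M g c V t \<in> tspace M (c t)"
    "m < mdim M \<Longrightarrow> vcomp C (cov_deriv M g c V t) m = cov_rhs C c (\<lambda>i s. vcomp C (V s) i) m t"
    using w by auto
qed

end

subsection \<open>The jet bundle\<close>

lemma mdim_jet_bundle [simp]: "mdim (jet_bundle k M) = mdim M * (k + 1)"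
  and atlas_jet_bundle: "atlas (jet_bundle k M) = jet_chart M k ` atlas M"
  by (simp_all add: jet_bundle_def)

lemma jet_chart_fst: "u \<in> fst (jet_chart M k C) \<longleftrightarrow> u \<in> jets M k \<and> jet_base u \<in> fst C"
  by (simp add: jet_chart_def)

lemma jet_chart_snd:
  "snd (jet_chart M k C) u = trunc (mdim M * (k + 1)) (inf_jet (mdim M) (\<lambda>t. snd C (rep u t)) 0)"
  by (simp add: jet_chart_def trunc_def inf_jet_def fun_eq_iff)

lemma div_index: "j < n * (k + 1) \<Longrightarrow> j div n \<le> k \<and> j mod n < n" for j n k :: nat
proof -
  assume j: "j < n * (k + 1)"
  then have "j div n < k + 1" by (intro less_mult_imp_div_less) (simp add: mult.commute)
  moreover have "n > 0" using j by (cases n) auto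
  ultimately show ?thesis by simp
qed

lemma index_less: "i < n \<Longrightarrow> r \<le> k \<Longrightarrow> n * r + i < n * (k + 1)" for i n r k :: nat
proof -
  assume "i < n" "r \<le> k"
  then have "n * r + i < n * Suc r" "n * Suc r \<le> n * (k + 1)" by (simp, intro mult_le_mono2) simp
  then show ?thesis by linarith
qed

lemma mcarrier_jet_bundle: "mcarrier (jet_bundle k M) = jets M k"
proof -
  have "\<exists>C\<in>atlas M. jet_base u \<in> fst C" if "u \<in> jets M k" for u
    using smooth_germ_carrier[OF jetsE(1)[OF that]] by (auto simp: mcarrier_def jet_base_def)
  then show ?thesis by (auto simp: mcarrier_def atlas_jet_bundle jet_chart_fst)
qed

lemma jet_chart_jet:
  assumes q: "smooth_germ M q" and C: "C \<in> atlas M" "q 0 \<in> fst C"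
  shows "jet M k q \<in> fst (jet_chart M k C)"
    "snd (jet_chart M k C) (jet M k q) = trunc (mdim M * (k + 1)) (inf_jet (mdim M) (\<lambda>t. snd C (q t)) 0)"
  using assms rep_jet(3)[OF q C, of _ _ k] div_index[of _ "mdim M" k]
  by (auto simp: jet_chart_fst jet_in_jets jet_base_jet jet_chart_snd trunc_def inf_jet_def fun_eq_iff simp del: add_mult_distrib2 mult_Suc_right)

context charted
begin

lemma jet_coord_base:
  assumes "C \<in> atlas M" "jet_base u \<in> fst C"
  shows "trunc (mdim M) (snd (jet_chart M k C) u) = snd C (jet_base u)"
  using chart_EE[OF assms] by (simp add: jet_chart_snd trunc_inf_jet jet_base_def)

text \<open>Polynomials in the coordinates, carried back by the chart, realise any prescribed
  derivatives up to order \<open>k\<close>; only the base coordinates have to lie in the image of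
  \<open>C\<close>.\<close>

lemma jet_exists:
  assumes C: "C \<in> atlas M" and \<xi>: "\<xi> \<in> jet_domain (mdim M) (snd C ` fst C) (mdim M * (k + 1))"
  shows "\<exists>u\<in>fst (jet_chart M k C). snd (jet_chart M k C) u = \<xi>"
proof -
  define n where "n = mdim M"
  have "\<exists>p. \<forall>r\<le>k. (deriv ^^ r) (poly p) 0 = \<xi> (n * r + i)" for i
    by (rule poly_with_derivs)
  then obtain p where p: "\<And>i r. r \<le> k \<Longrightarrow> (deriv ^^ r) (poly (p i)) 0 = \<xi> (n * r + i)" by metis
  define x where "x t = (\<lambda>i. if i < n then poly (p i) t else 0)" for t
  have x0: "x 0 = trunc n \<xi>" using p[of 0] by (auto simp: x_def trunc_def fun_eq_iff)
  have x: "\<And>i. i < mdim M \<Longrightarrow> smooth1 UNIV (\<lambda>t. x t i)" "\<And>t. x t \<in> EE (mdim M)" "x 0 \<in> snd C ` fst C"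
    using \<xi> x0 by (auto simp: x_def EE_iff n_def jet_domain_def smooth1_poly)
  note q = jet_of_chart_curve[OF C x]
  let ?q = "\<lambda>t. chart_inv C (x t)"
  have "snd (jet_chart M k C) (jet M k ?q) = \<xi>"
  proof
    fix j
    show "snd (jet_chart M k C) (jet M k ?q) j = \<xi> j"
    proof (cases "j < n * (k + 1)")
      case True
      note d = div_index[OF True]
      have "snd (jet_chart M k C) (jet M k ?q) j = (deriv ^^ (j div n)) (\<lambda>t. x t (j mod n)) 0"
        using jet_chart_jet(2)[OF q(1) C q(2)] True q(3) unfolding n_def by (simp add: trunc_def inf_jet_def)
      also have "\<dots> = \<xi> j" using d p[of "j div n" "j mod n"] by (simp add: x_def)
      finally show ?thesis .
    next
      case False
      then show ?thesis using \<xi> by (auto simp: jet_chart_snd trunc_def n_def jet_domain_def EE_iff)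
    qed
  qed
  then show ?thesis using jet_chart_jet(1)[OF q(1) C q(2)] by blast
qed

lemma jet_chart_EE: "snd (jet_chart M k C) u \<in> EE (mdim M * (k + 1))"
  by (simp add: jet_chart_snd del: add_mult_distrib2 mult_Suc_right)

text \<open>Whether a jet lies over a chart is decided by its base point, that is, by its first
  \<open>mdim M\<close> coordinates.\<close>

lemma jet_chart_overlap:
  assumes C: "C \<in> atlas M" and D: "D \<in> atlas M"
  shows "snd (jet_chart M k C) ` (fst (jet_chart M k C) \<inter> fst (jet_chart M k D)) =
    jet_domain (mdim M) (snd C ` (fst C \<inter> fst D)) (mdim M * (k + 1))" (is "?L = ?R")
proof
  show "?L \<subseteq> ?R"
  proof
    fix \<xi> assume "\<xi> \<in> ?L"
    then obtain u where u: "u \<in> fst (jet_chart M k C)" "u \<in> fst (jet_chart M k D)" "\<xi> = snd (jet_chart M k C) u"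
      by blast
    then have "jet_base u \<in> fst C" "jet_base u \<in> fst D" by (simp_all add: jet_chart_fst)
    then show "\<xi> \<in> ?R"
      unfolding u(3) jet_domain_def using jet_coord_base[OF C, of u k] jet_chart_EE by blast
  qed
  show "?R \<subseteq> ?L"
  proof
    fix \<xi> assume \<xi>: "\<xi> \<in> ?R"
    then have "\<xi> \<in> jet_domain (mdim M) (snd C ` fst C) (mdim M * (k + 1))" by (auto simp: jet_domain_def)
    then obtain u where u: "u \<in> fst (jet_chart M k C)" "snd (jet_chart M k C) u = \<xi>"
      using jet_exists[OF C] by blast
    have b: "jet_base u \<in> fst C" using u(1) by (simp add: jet_chart_fst)
    then have "snd C (jet_base u) \<in> snd C ` (fst C \<inter> fst D)"
      using \<xi> jet_coord_base[OF C b, of k] u(2) by (simp add: jet_domain_def)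
    then have "jet_base u \<in> fst D" by (rule in_overlap[OF C b])
    then show "\<xi> \<in> ?L" using u by (auto simp: jet_chart_fst)
  qed
qed

lemma jet_chart_image:
  assumes "C \<in> atlas M"
  shows "snd (jet_chart M k C) ` fst (jet_chart M k C) = jet_domain (mdim M) (snd C ` fst C) (mdim M * (k + 1))"
  using jet_chart_overlap[OF assms assms, of k] by simp

lemma inj_jet_chart: assumes C: "C \<in> atlas M" shows "inj_on (snd (jet_chart M k C)) (fst (jet_chart M k C))"
proof (rule inj_onI)
  fix u v assume u: "u \<in> fst (jet_chart M k C)" and v: "v \<in> fst (jet_chart M k C)"
    and eq: "snd (jet_chart M k C) u = snd (jet_chart M k C) v"
  have uD: "u \<in> jets M k" "rep u 0 \<in> fst C" and vD: "v \<in> jets M k" "rep v 0 \<in> fst C"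
    using u v by (simp_all add: jet_chart_fst jet_base_def)
  have "jet M k (rep u) = jet M k (rep v)"
  proof (rule jet_eqI[OF jetsE(1)[OF vD(1)] jetsE(1)[OF uD(1)] C vD(2) uD(2)])
    fix i r assume ir: "i < mdim M" "r \<le> k"
    then show "(deriv ^^ r) (\<lambda>t. snd C (rep u t) i) 0 = (deriv ^^ r) (\<lambda>t. snd C (rep v t) i) 0"
      using fun_cong[OF eq, of "mdim M * r + i"] index_less[OF ir]
      by (simp add: jet_chart_snd trunc_def inf_jet_def)
  qed
  then show "u = v" using jetsE(2) uD vD by metis
qed

lemma jet_transition:
  assumes C: "C \<in> atlas M" and D: "D \<in> atlas M" and u: "u \<in> fst (jet_chart M k C)" "u \<in> fst (jet_chart M k D)"
    and j: "j < mdim M * (k + 1)"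
  shows "snd (jet_chart M k D) u j =
    jet_lift (mdim M) (\<lambda>x. snd D (chart_inv C x) (j mod mdim M)) (j div mdim M) (snd (jet_chart M k C) u)"
proof -
  define n where "n = mdim M"
  have uD: "u \<in> jets M k" "rep u 0 \<in> fst C" "rep u 0 \<in> fst D"
    using u by (simp_all add: jet_chart_fst jet_base_def)
  note d = div_index[OF j]
  obtain J where J: "0 \<in> J" "chart_smooth M C J (rep u)"
    by (rule smooth_germ_chart[OF jetsE(1)[OF uD(1)] C uD(2)])
  have "n * Suc (j div n) \<le> n * (k + 1)" using d unfolding n_def by (intro mult_le_mono2) simp
  then have "jet_lift n (\<lambda>x. snd D (chart_inv C x) (j mod n)) (j div n) (snd (jet_chart M k C) u)
    = jet_lift n (\<lambda>x. snd D (chart_inv C x) (j mod n)) (j div n) (inf_jet n (\<lambda>t. snd C (rep u t)) 0)"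
    unfolding jet_chart_snd n_def[symmetric] by (rule depends_below_trunc[OF depends_below_jet_lift])
  also have "\<dots> = (deriv ^^ (j div n)) (\<lambda>t. snd D (rep u t) (j mod n)) 0"
    unfolding n_def using higher_deriv_change[OF J(2,1) D uD(3)] d by simp
  finally show ?thesis using j by (simp add: jet_chart_snd trunc_def inf_jet_def n_def)
qed

text \<open>The transition functions of the jet charts are prolongations of those of
  \<open>M\<close>, and \<open>jet_lift\<close> preserves smoothness.\<close>

lemma charted_jet_bundle: "charted (jet_bundle k M)"
proof
  let ?N = "mdim M * (k + 1)"
  have nN: "mdim M \<le> ?N" by simp
  fix C' assume "C' \<in> atlas (jet_bundle k M)"
  then obtain C where C: "C \<in> atlas M" "C' = jet_chart M k C" by (auto simp: atlas_jet_bundle)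
  show "inj_on (snd C') (fst C')" using inj_jet_chart C by simp
  show "openin (Euclidean_space (mdim (jet_bundle k M))) (snd C' ` fst C')"
    unfolding C(2) jet_chart_image[OF C(1)] mdim_jet_bundle by (rule openin_jet_domain[OF open_chart[OF C(1)] nN])
  fix D' assume "D' \<in> atlas (jet_bundle k M)"
  then obtain D where D: "D \<in> atlas M" "D' = jet_chart M k D" by (auto simp: atlas_jet_bundle)
  show "openin (Euclidean_space (mdim (jet_bundle k M))) (snd C' ` (fst C' \<inter> fst D'))"
    unfolding C(2) D(2) jet_chart_overlap[OF C(1) D(1)] mdim_jet_bundle
    by (rule openin_jet_domain[OF open_overlap[OF C(1) D(1)] nN])
  fix j assume "j < mdim (jet_bundle k M)"
  then have j: "j < ?N" by simp
  note d = div_index[OF j]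
  have le: "mdim M * Suc (j div mdim M) \<le> ?N" using d by (intro mult_le_mono2) simp
  have jm: "j mod mdim M < mdim M" using d by simp
  have "smooth_on ?N (jet_domain (mdim M) (snd C ` (fst C \<inter> fst D)) ?N)
     (jet_lift (mdim M) (\<lambda>x. snd D (chart_inv C x) (j mod mdim M)) (j div mdim M))"
    by (rule smooth_on_jet_lift[OF smooth_transition[OF C(1) D(1) jm] le])
  then show "smooth_on (mdim (jet_bundle k M)) (snd C' ` (fst C' \<inter> fst D')) (\<lambda>x. snd D' (chart_inv C' x) j)"
    unfolding C(2) D(2) jet_chart_overlap[OF C(1) D(1), symmetric] mdim_jet_bundle
  proof (rule smooth_on_cong)
    fix x assume "x \<in> snd (jet_chart M k C) ` (fst (jet_chart M k C) \<inter> fst (jet_chart M k D))"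
    then obtain u where u: "u \<in> fst (jet_chart M k C)" "u \<in> fst (jet_chart M k D)" "x = snd (jet_chart M k C) u"
      by blast
    have "chart_inv (jet_chart M k C) x = u" unfolding u(3) by (rule inv_into_f_f[OF inj_jet_chart[OF C(1)] u(1)])
    then show "jet_lift (mdim M) (\<lambda>x. snd D (chart_inv C x) (j mod mdim M)) (j div mdim M) x
      = snd (jet_chart M k D) (chart_inv (jet_chart M k C) x) j"
      using jet_transition[OF C(1) D(1) u(1,2) j] u(3) by simp
  qed
qed

text \<open>Truncation keeps the representative curve and only forgets its derivatives of order
  above \<open>l\<close>.\<close>

lemma jet_trunc:
  assumes u: "u \<in> jets M k" and C: "C \<in> atlas M" "jet_base u \<in> fst C" and l: "l \<le> k"
  shows "snd (jet_chart M l C) (jet_trunc M l u) = trunc (mdim M * (l + 1)) (snd (jet_chart M k C) u)"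
proof -
  have b: "rep u 0 \<in> fst C" using C(2) by (simp add: jet_base_def)
  have "mdim M * (l + 1) \<le> mdim M * (k + 1)" using l by (intro mult_le_mono2) simp
  then show ?thesis
    unfolding jet_trunc_def jet_chart_jet(2)[OF jetsE(1)[OF u] C(1) b] by (simp only: jet_chart_snd trunc_trunc)
qed

end

subsection \<open>Families of curves\<close>

definition pt :: "real \<Rightarrow> real \<Rightarrow> nat \<Rightarrow> real" where
  "pt s t = (\<lambda>j. if j = 0 then s else if j = 1 then t else 0)"

definition box2 :: "real \<Rightarrow> (nat \<Rightarrow> real) set" where
  "box2 e = {z \<in> topspace (Euclidean_space 2). \<bar>z 0\<bar> < e \<and> \<bar>z 1\<bar> < e}"

lemma pt_simps [simp]: "pt s t 0 = s" "pt s t (Suc 0) = t" "(pt s t)(0 := s') = pt s' t" "(pt s t)(Suc 0 := t') = pt s t'"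
  by (auto simp: pt_def fun_eq_iff)

lemma pt_in_box2: "pt s t \<in> box2 e \<longleftrightarrow> \<bar>s\<bar> < e \<and> \<bar>t\<bar> < e"
  by (auto simp: box2_def pt_def EE_iff)

lemma openin_box2: "openin (Euclidean_space 2) (box2 e)"
proof -
  have "box2 e = {z \<in> EE 2. z 0 \<in> {-e<..<e}} \<inter> {z \<in> EE 2. z 1 \<in> {-e<..<e}}"
    by (auto simp: box2_def)
  then show ?thesis
    by (simp only:) (intro openin_Int openin_coord_preimage open_greaterThanLessThan)
qed

lemma partial_pt: "partial 0 F (pt s t) = deriv (\<lambda>s. F (pt s t)) s" "partial (Suc 0) F (pt s t) = deriv (\<lambda>t. F (pt s t)) t"
  by (simp_all add: partial_def)

lemma higher_deriv_pt: "(deriv ^^ r) (\<lambda>t. F (pt s t)) = (\<lambda>t. ((partial 1) ^^ r) F (pt s t))"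
proof (induction r)
  case (Suc r)
  show ?case by (simp only: funpow.simps comp_apply Suc) (simp add: partial_pt)
qed simp

lemma smooth_on_higher_partial: "smooth_on n S F \<Longrightarrow> i < n \<Longrightarrow> smooth_on n S ((partial i ^^ r) F)"
  by (induction r) (simp_all add: smooth_on_partial)

text \<open>Exchanges the derivative in the family parameter, which gives the velocity of the curve
  of jets, with the time derivatives, which make up the jet of the variation field.\<close>

lemma higher_partial_commute:
  assumes F: "smooth_on n S F" and ij: "i < n" "j < n" and z: "z \<in> S"
  shows "(partial i ^^ r) (partial j F) z = partial j ((partial i ^^ r) F) z"
  using z
proof (induction r arbitrary: z)
  case (Suc r)
  have "(partial i ^^ Suc r) (partial j F) z = partial i (partial j ((partial i ^^ r) F)) z"
    using Suc by (auto intro!: partial_cong[OF smooth_on_openin[OF F] _ ij(1)])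
  also have "\<dots> = partial j (partial i ((partial i ^^ r) F)) z"
    by (rule partial_commute[OF smooth_on_higher_partial[OF F ij(1)] Suc.prems ij])
  finally show ?case by simp
qed simp

lemma smooth1_box_s: "smooth_on 2 (box2 e) F \<Longrightarrow> \<bar>t\<bar> < e \<Longrightarrow> smooth1 {-e<..<e} (\<lambda>s. F (pt s t))"
proof -
  assume F: "smooth_on 2 (box2 e) F" and t: "\<bar>t\<bar> < e"
  have "smooth1 {-e<..<e} (\<lambda>s. pt s t j)" for j
    by (cases "j = 0") (simp_all add: pt_def smooth1_const smooth1_ident)
  then show ?thesis using t by (intro smooth1_compose[OF F]) (auto simp: pt_in_box2)
qed

lemma smooth1_box_t: "smooth_on 2 (box2 e) F \<Longrightarrow> \<bar>s\<bar> < e \<Longrightarrow> smooth1 {-e<..<e} (\<lambda>t. F (pt s t))"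
proof -
  assume F: "smooth_on 2 (box2 e) F" and s: "\<bar>s\<bar> < e"
  have "smooth1 {-e<..<e} (\<lambda>t. pt s t j)" for j
    by (cases "j = 0"; cases "j = Suc 0"; simp add: pt_def smooth1_const smooth1_ident)
  then show ?thesis using s by (intro smooth1_compose[OF F]) (auto simp: pt_in_box2)
qed

definition family_box :: "'a manifold \<Rightarrow> 'a chart \<Rightarrow> (real \<Rightarrow> real \<Rightarrow> 'a) \<Rightarrow> real \<Rightarrow> bool" where
  "family_box M C \<gamma> e \<longleftrightarrow> C \<in> atlas M \<and> e > 0 \<and> (\<forall>s t. \<bar>s\<bar> < e \<and> \<bar>t\<bar> < e \<longrightarrow> \<gamma> s t \<in> fst C) \<and>
     (\<forall>i<mdim M. smooth_on 2 (box2 e) (\<lambda>z. snd C (\<gamma> (z 0) (z 1)) i))"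

lemma family_boxD:
  assumes "family_box M C \<gamma> e"
  shows "C \<in> atlas M" "e > 0" "\<And>s t. \<bar>s\<bar> < e \<Longrightarrow> \<bar>t\<bar> < e \<Longrightarrow> \<gamma> s t \<in> fst C"
    "\<And>i. i < mdim M \<Longrightarrow> smooth_on 2 (box2 e) (\<lambda>z. snd C (\<gamma> (z 0) (z 1)) i)"
  using assms by (simp_all add: family_box_def)

lemma smooth_family_box:
  assumes "smooth_family M \<gamma>" "C \<in> atlas M" "\<gamma> 0 0 \<in> fst C"
  obtains e where "family_box M C \<gamma> e"
proof -
  have "\<exists>e>0. (\<forall>s t. \<bar>s\<bar> < e \<and> \<bar>t\<bar> < e \<longrightarrow> \<gamma> s t \<in> fst C) \<and>
           (\<forall>i<mdim M. smooth_on 2 (box2 e) (\<lambda>z. snd C (\<gamma> (z 0) (z 1)) i))"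
    unfolding box2_def
    by (rule mp[OF bspec[OF conjunct2[OF assms(1)[unfolded smooth_family_def]] assms(2)] assms(3)])
  then have "\<exists>e. family_box M C \<gamma> e" using assms(2) by (simp add: family_box_def)
  then show ?thesis using that by blast
qed

lemma family_box_curves:
  assumes "family_box M C \<gamma> e"
  shows "\<bar>s\<bar> < e \<Longrightarrow> chart_smooth M C {-e<..<e} (\<gamma> s)"
    "\<bar>t\<bar> < e \<Longrightarrow> chart_smooth M C {-e<..<e} (\<lambda>s. \<gamma> s t)"
  using smooth1_box_s[OF family_boxD(4)[OF assms]] smooth1_box_t[OF family_boxD(4)[OF assms]]
    family_boxD(1-3)[OF assms] by (auto simp: chart_smooth_def)

context charted
begin

lemma family_jet_coord:
  assumes e: "family_box M C \<gamma> e" and s: "\<bar>s\<bar> < e" and A: "A < mdim M * (k + 1)"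
  shows "snd (jet_chart M k C) (jet M k (\<gamma> s)) A =
    (partial 1 ^^ (A div mdim M)) (\<lambda>z. snd C (\<gamma> (z 0) (z 1)) (A mod mdim M)) (pt s 0)"
proof -
  note eD = family_boxD[OF e]
  have q: "smooth_germ M (\<gamma> s)" "\<gamma> s 0 \<in> fst C"
    using smooth_germI[OF family_box_curves(1)[OF e s]] eD(2,3) s by auto
  show ?thesis
    using jet_chart_jet(2)[OF q(1) eD(1) q(2), of k] A
      fun_cong[OF higher_deriv_pt[of "A div mdim M" "\<lambda>z. snd C (\<gamma> (z 0) (z 1)) (A mod mdim M)" s], of 0]
    by (simp add: trunc_def inf_jet_def)
qed

text \<open>Since \<open>W\<close> is a tangent vector, \<open>rep W\<close> belongs to the 1-jet of
  the curve of jets \<open>jet M k (\<gamma> s)\<close>. Base point and components are read off from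
  this membership alone.\<close>

lemma family_for_base:
  assumes W: "W \<in> tspace (jet_bundle k M) u" and \<gamma>: "family_for M k W \<gamma>"
  shows "u = jet M k (\<gamma> 0)" "smooth_germ M (\<gamma> 0)" "jet_base u = \<gamma> 0 0"
    "C \<in> atlas M \<Longrightarrow> \<gamma> 0 0 \<in> fst C \<Longrightarrow> A < mdim M * (k + 1) \<Longrightarrow>
       vcomp (jet_chart M k C) W A = deriv (\<lambda>s. snd (jet_chart M k C) (jet M k (\<gamma> s)) A) 0"
proof -
  have sf: "smooth_family M \<gamma>" and Weq: "W = jet (jet_bundle k M) 1 (\<lambda>s. jet M k (\<gamma> s))"
    using \<gamma> by (auto simp: family_for_def velocity_def)
  note WD = tspaceD[OF W]
  have r: "rep W \<in> jet (jet_bundle k M) 1 (\<lambda>s. jet M k (\<gamma> s))"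
    using jet_self[OF WD(1), of 1] WD(3) Weq by simp
  then show u: "u = jet M k (\<gamma> 0)" using WD(2) by (simp add: jet_def)
  have "\<gamma> 0 0 \<in> mcarrier M" using sf by (simp add: smooth_family_def)
  then obtain C0 where C0: "C0 \<in> atlas M" "\<gamma> 0 0 \<in> fst C0" by (auto simp: mcarrier_def)
  obtain e where e: "family_box M C0 \<gamma> e" by (rule smooth_family_box[OF sf C0])
  show q: "smooth_germ M (\<gamma> 0)"
    by (rule smooth_germI[OF family_box_curves(1)[OF e]]) (use family_boxD(2)[OF e] in auto)
  show "jet_base u = \<gamma> 0 0" using jet_base_jet[OF q] u by simp
  show "vcomp (jet_chart M k C) W A = deriv (\<lambda>s. snd (jet_chart M k C) (jet M k (\<gamma> s)) A) 0"
    if C: "C \<in> atlas M" "\<gamma> 0 0 \<in> fst C" and A: "A < mdim M * (k + 1)"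
  proof -
    have "jet_chart M k C \<in> atlas (jet_bundle k M)" "jet M k (\<gamma> 0) \<in> fst (jet_chart M k C)"
      using C jet_chart_jet(1)[OF q C] by (auto simp: atlas_jet_bundle)
    moreover have "\<forall>C\<in>atlas (jet_bundle k M). jet M k (\<gamma> 0) \<in> fst C \<longrightarrow>
        (\<forall>i<mdim (jet_bundle k M). \<forall>r\<le>1.
           (deriv ^^ r) (\<lambda>t. snd C (rep W t) i) 0 = (deriv ^^ r) (\<lambda>t. snd C (jet M k (\<gamma> t)) i) 0)"
      using r unfolding jet_def[of "jet_bundle k M"] by simp
    ultimately have "(deriv ^^ 1) (\<lambda>t. snd (jet_chart M k C) (rep W t) A) 0
        = (deriv ^^ 1) (\<lambda>t. snd (jet_chart M k C) (jet M k (\<gamma> t)) A) 0"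
      using A unfolding mdim_jet_bundle by blast
    then show ?thesis by (simp add: vcomp_def)
  qed
qed

text \<open>Gives meaning to the choice in \<open>K_map\<close>. In a chart the family is affine in
  \<open>s\<close>: a polynomial curve with the jet \<open>u\<close>, plus \<open>s\<close> times a
  polynomial curve whose derivatives at 0 are the components of \<open>W\<close>.\<close>

lemma family_exists:
  assumes W: "W \<in> tspace (jet_bundle k M) u"
  shows "\<exists>\<gamma>. family_for M k W \<gamma>"
proof -
  interpret JB: charted "jet_bundle k M" by (rule charted_jet_bundle)
  define n where "n = mdim M"
  have u: "u \<in> jets M k"
    using smooth_germ_carrier[OF tspaceD(1)[OF W]] tspaceD(2)[OF W] by (simp add: mcarrier_jet_bundle)
  then obtain C where C: "C \<in> atlas M" "jet_base u \<in> fst C"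
    using smooth_germ_carrier[OF jetsE(1)[OF u]] by (auto simp: mcarrier_def jet_base_def)
  define C' where "C' = jet_chart M k C"
  have C': "C' \<in> atlas (jet_bundle k M)" "u \<in> fst C'"
    using C u by (auto simp: C'_def atlas_jet_bundle jet_chart_fst)
  define \<xi> where "\<xi> = snd C' u"
  have "\<exists>p. \<forall>r\<le>k. (deriv ^^ r) (poly p) 0 = \<xi> (n * r + i)" for i by (rule poly_with_derivs)
  then obtain p where p: "\<And>i r. r \<le> k \<Longrightarrow> (deriv ^^ r) (poly (p i)) 0 = \<xi> (n * r + i)" by metis
  have "\<exists>p. \<forall>r\<le>k. (deriv ^^ r) (poly p) 0 = vcomp C' W (n * r + i)" for i by (rule poly_with_derivs)
  then obtain w where w: "\<And>i r. r \<le> k \<Longrightarrow> (deriv ^^ r) (poly (w i)) 0 = vcomp C' W (n * r + i)" by metis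
  define h where "h z = (\<lambda>i. if i < n then poly (p i) (z 1) + z 0 * poly (w i) (z 1) else 0)" for z :: "nat \<Rightarrow> real"
  define \<gamma> where "\<gamma> s t = chart_inv C (h (pt s t))" for s t
  have E2: "openin (Euclidean_space 2) (EE 2)" by (rule openin_topspace)
  have hs: "smooth_on 2 (EE 2) (\<lambda>z. h z i)" for i
  proof (cases "i < n")
    case True
    have "smooth_on 2 (EE 2) (\<lambda>z. poly q (z 1))" for q
      by (rule smooth_on_comp_smooth1[OF smooth1_poly smooth_on_coord[OF E2]]) simp
    then show ?thesis using True
      by (simp add: h_def) (intro smooth_on_add smooth_on_mult smooth_on_coord[OF E2])
  qed (simp add: h_def smooth_on_const[OF E2])
  have hE: "h z \<in> EE n" for z by (simp add: h_def EE_iff)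
  have h00: "h (pt 0 0) = snd C (jet_base u)"
    unfolding jet_coord_base[OF C, of k, symmetric]
    using p[of 0] by (auto simp: h_def trunc_def fun_eq_iff \<xi>_def C'_def n_def)
  have \<gamma>00: "\<gamma> 0 0 = jet_base u" using chart_inv_chart[OF C] h00 by (simp add: \<gamma>_def)
  have hc: "continuous_map (Euclidean_space 2) (Euclidean_space n) h"
  proof -
    have "h = (\<lambda>z i. if i < n then h z i else 0)" by (simp add: h_def fun_eq_iff)
    moreover have "continuous_map (Euclidean_space 2) (Euclidean_space n) (\<lambda>z i. if i < n then h z i else 0)"
      unfolding continuous_map_componentwise_Euclidean_space continuous_map_Euclidean_space_iff
      using smooth_on_continuous[OF hs] by blast
    ultimately show ?thesis by metis
  qed
  \<comment> \<open>\<open>h\<close> may leave the image of the chart, but by continuity not near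
    the origin. The open set \<open>V\<close> is arbitrary because every overlap with another chart
    has to be reached.\<close>
  have box: "\<exists>e>0. \<forall>z\<in>box2 e. h z \<in> V" if V: "openin (Euclidean_space n) V" "snd C (jet_base u) \<in> V" for V
  proof -
    have o: "openin (Euclidean_space 2) {z \<in> EE 2. h z \<in> V}"
      using openin_continuous_map_preimage[OF hc V(1)] .
    have "pt 0 0 \<in> {z \<in> EE 2. h z \<in> V}" using V(2) h00 by (simp add: pt_def EE_iff)
    from openin_EE_box[OF o this] obtain e where "e > 0"
      "\<forall>y\<in>EE 2. (\<forall>j<2. \<bar>y j - pt 0 0 j\<bar> < e) \<longrightarrow> y \<in> {z \<in> EE 2. h z \<in> V}" by blast
    then show ?thesis by (intro exI[of _ e]) (auto simp: box2_def pt_def less_2_cases_iff)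
  qed
  \<comment> \<open>\<open>smooth_family\<close> asks for a box in each chart \<open>D\<close>
    around the point, not only in the chart \<open>C\<close> from which the family is built.\<close>
  have fam: "\<exists>e. family_box M D \<gamma> e \<and> (\<forall>s t. \<bar>s\<bar> < e \<and> \<bar>t\<bar> < e \<longrightarrow> snd C (\<gamma> s t) = h (pt s t))"
    if D: "D \<in> atlas M" "\<gamma> 0 0 \<in> fst D" for D
  proof -
    let ?V = "snd C ` (fst C \<inter> fst D)"
    have "snd C (jet_base u) \<in> ?V" using C(2) D(2) \<gamma>00 by auto
    then obtain e where e: "e > 0" "\<And>z. z \<in> box2 e \<Longrightarrow> h z \<in> ?V"
      using box[OF open_overlap[OF C(1) D(1), folded n_def]] by blast
    have "\<gamma> s t \<in> fst C \<inter> fst D \<and> snd C (\<gamma> s t) = h (pt s t)" if "\<bar>s\<bar> < e \<and> \<bar>t\<bar> < e" for s t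
    proof -
      have "h (pt s t) \<in> ?V" using e(2)[of "pt s t"] that by (simp add: pt_in_box2)
      then obtain q where q: "q \<in> fst C" "q \<in> fst D" "h (pt s t) = snd C q" by blast
      then show ?thesis using chart_inv_chart[OF C(1) q(1)] by (simp add: \<gamma>_def)
    qed
    moreover have "smooth_on 2 (box2 e) (\<lambda>z. snd D (\<gamma> (z 0) (z 1)) i)" if i: "i < mdim M" for i
    proof -
      have "smooth_on 2 (box2 e) (\<lambda>z. snd D (chart_inv C (h z)) i)"
        by (rule smooth_on_compose[OF openin_box2 _ e(2) smooth_transition[OF C(1) D(1) i]])
          (rule smooth_on_subset[OF hs openin_box2 openin_EE_subset[OF openin_box2]])
      then show ?thesis
      proof (rule smooth_on_cong)
        fix z assume "z \<in> box2 e"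
        then have "pt (z 0) (z 1) = z" by (auto simp: box2_def pt_def EE_iff fun_eq_iff numeral_2_eq_2 Suc_le_eq)
        then show "snd D (chart_inv C (h z)) i = snd D (\<gamma> (z 0) (z 1)) i" by (simp add: \<gamma>_def)
      qed
    qed
    ultimately show ?thesis using e(1) D(1) unfolding family_box_def by blast
  qed
  have sf: "smooth_family M \<gamma>"
    unfolding smooth_family_def box2_def[symmetric]
  proof (intro conjI ballI impI)
    show "\<gamma> 0 0 \<in> mcarrier M" using C \<gamma>00 by (auto simp: mcarrier_def)
    show "\<exists>e>0. (\<forall>s t. \<bar>s\<bar> < e \<and> \<bar>t\<bar> < e \<longrightarrow> \<gamma> s t \<in> fst D) \<and>
      (\<forall>i<mdim M. smooth_on 2 (box2 e) (\<lambda>z. snd D (\<gamma> (z 0) (z 1)) i))" if "D \<in> atlas M" "\<gamma> 0 0 \<in> fst D" for D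
      using fam[OF that] unfolding family_box_def by blast
  qed
  have "\<gamma> 0 0 \<in> fst C" using C(2) \<gamma>00 by simp
  then obtain e where eb: "family_box M C \<gamma> e"
    and eh: "\<forall>s t. \<bar>s\<bar> < e \<and> \<bar>t\<bar> < e \<longrightarrow> snd C (\<gamma> s t) = h (pt s t)"
    using fam[OF C(1)] by blast
  note e = family_boxD(2,3)[OF eb]
  have germ: "smooth_germ M (\<gamma> s)" "\<gamma> s 0 \<in> fst C" if "\<bar>s\<bar> < e" for s
    using smooth_germI[OF family_box_curves(1)[OF eb that]] e that by auto
  \<comment> \<open>Smoothness, base point and velocity of the curve of jets all follow from this
    affine formula.\<close>
  have coord: "snd C' (jet M k (\<gamma> s)) A = \<xi> A + s * vcomp C' W A" if s: "\<bar>s\<bar> < e" and A: "A < n * (k + 1)" for s A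
  proof -
    note d = div_index[OF A]
    have "snd C' (jet M k (\<gamma> s)) A = (deriv ^^ (A div n)) (\<lambda>t. snd C (\<gamma> s t) (A mod n)) 0"
      using jet_chart_jet(2)[OF germ(1)[OF s] C(1) germ(2)[OF s], of k] A
      by (simp add: C'_def trunc_def inf_jet_def n_def)
    also have "\<dots> = (deriv ^^ (A div n)) (poly (p (A mod n) + smult s (w (A mod n)))) 0"
      by (rule deriv_cong_open[of "{-e<..<e}"]) (use e(1) s d in \<open>auto simp: eh h_def\<close>)
    also have "\<dots> = (deriv ^^ (A div n)) (poly (p (A mod n))) 0 + s * (deriv ^^ (A div n)) (poly (w (A mod n))) 0"
      by (simp add: higher_deriv_poly higher_pderiv_add higher_pderiv_smult)
    also have "\<dots> = \<xi> A + s * vcomp C' W A" using p w d by simp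
    finally show ?thesis .
  qed
  have cs: "chart_smooth (jet_bundle k M) C' {-e<..<e} (\<lambda>s. jet M k (\<gamma> s))"
    unfolding chart_smooth_def
  proof (intro conjI C' ballI allI impI)
    show "jet M k (\<gamma> s) \<in> fst C'" if "s \<in> {-e<..<e}" for s
      unfolding C'_def by (rule jet_chart_jet(1)[OF germ(1) C(1) germ(2)]) (use that in auto)
    fix A assume "A < mdim (jet_bundle k M)"
    then have A: "A < n * (k + 1)" by (simp add: n_def)
    have "smooth1 {-e<..<e} (\<lambda>s. \<xi> A + s * vcomp C' W A)"
      by (intro smooth1_add smooth1_mult smooth1_const smooth1_ident open_greaterThanLessThan)
    then show "smooth1 {-e<..<e} (\<lambda>s. snd C' (jet M k (\<gamma> s)) A)"
      by (rule smooth1_cong) (use coord[OF _ A] in auto)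
  qed simp
  have e0: "0 \<in> {-e<..<e}" using e(1) by simp
  have u0: "jet M k (\<gamma> 0) = u"
  proof (rule JB.chart_ext[OF C'(1) _ C'(2)])
    show "jet M k (\<gamma> 0) \<in> fst C'" by (rule chart_smoothD(3)[OF cs e0])
    show "snd C' (jet M k (\<gamma> 0)) i = snd C' u i" if "i < mdim (jet_bundle k M)" for i
      using coord[of 0 i] e(1) that by (simp add: \<xi>_def n_def)
  qed
  note vel = JB.velocity[OF JB.chart_smooth_curve[OF cs] e0, unfolded u0]
  have "velocity (jet_bundle k M) (\<lambda>s. jet M k (\<gamma> s)) 0 = W"
  proof (rule JB.tspace_ext[OF vel(1) W C'])
    fix A assume A: "A < mdim (jet_bundle k M)"
    have "((\<lambda>s. \<xi> A + s * vcomp C' W A) has_real_derivative vcomp C' W A) (at 0)"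
      by (auto intro!: derivative_eq_intros)
    moreover have "deriv (\<lambda>s. snd C' (jet M k (\<gamma> s)) A) 0 = deriv (\<lambda>s. \<xi> A + s * vcomp C' W A) 0"
      using deriv_cong_open[OF _ e0, of "\<lambda>s. snd C' (jet M k (\<gamma> s)) A" "\<lambda>s. \<xi> A + s * vcomp C' W A" 1]
        coord[of _ A] A by (simp add: n_def abs_less_iff)
    ultimately show "vcomp C' (velocity (jet_bundle k M) (\<lambda>s. jet M k (\<gamma> s)) 0) A = vcomp C' W A"
      using vel(2)[OF C' A] by (simp add: DERIV_imp_deriv)
  qed
  with sf show ?thesis unfolding family_for_def by blast
qed

end

subsection \<open>The maps \<open>K\<^sub>\<alpha>\<close> in coordinates\<close>

context riem
begin

lemma cov_rhs_cong:
  assumes "open I" "t \<in> I" "\<And>s j. s \<in> I \<Longrightarrow> j < mdim M \<Longrightarrow> a j s = b j s" "m < mdim M"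
  shows "cov_rhs C c a m t = cov_rhs C c b m t"
  using deriv_cong_open[OF assms(1,2), of "a m" "b m" 1] assms by (simp add: cov_rhs_def)

lemma cov_rhs_smooth:
  assumes c: "chart_smooth M C I c" and a: "\<And>j. j < mdim M \<Longrightarrow> smooth1 I (a j)" and m: "m < mdim M"
  shows "smooth1 I (cov_rhs C c a m)"
proof -
  note cD = chart_smoothD[OF c]
  have "smooth1 I (\<lambda>t. christoffel M g C (snd C (c t)) m i j)" if "i < mdim M" "j < mdim M" for i j
    by (rule smooth1_compose[OF christoffel_smooth[OF metric_chart[OF cD(1)] m that] cD(2,4)]) (use cD(3) in auto)
  then show ?thesis
    unfolding cov_rhs_def[abs_def]
    by (intro smooth1_add smooth1_sum[OF cD(2)] smooth1_mult smooth1_deriv a cD(4) m) auto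
qed

lemma cov_rhs_iter_smooth:
  assumes "chart_smooth M C I c" "\<And>j. j < mdim M \<Longrightarrow> smooth1 I (a j)" "m < mdim M"
  shows "smooth1 I ((cov_rhs C c ^^ \<alpha>) a m)"
  using assms(2,3) by (induction \<alpha> arbitrary: m) (auto intro: cov_rhs_smooth[OF assms(1)])

text \<open>Proved at all times of \<open>I\<close> together, since the next covariant derivative at
  a given time involves the field near that time.\<close>

lemma cov_deriv_iter:
  assumes c: "chart_smooth M C I c" and V: "\<And>s. s \<in> I \<Longrightarrow> V s \<in> tspace M (c s)"
    and Vs: "\<And>i. i < mdim M \<Longrightarrow> smooth1 I (\<lambda>s. vcomp C (V s) i)" and t: "t \<in> I"
  shows "(cov_deriv M g c ^^ \<alpha>) V t \<in> tspace M (c t) \<and>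
    (\<forall>m<mdim M. vcomp C ((cov_deriv M g c ^^ \<alpha>) V t) m = (cov_rhs C c ^^ \<alpha>) (\<lambda>i s. vcomp C (V s) i) m t)"
  using t
proof (induction \<alpha> arbitrary: t)
  case 0 then show ?case using V by simp
next
  case (Suc \<alpha>)
  note cD = chart_smoothD[OF c]
  let ?V = "(cov_deriv M g c ^^ \<alpha>) V" and ?a = "(cov_rhs C c ^^ \<alpha>) (\<lambda>i s. vcomp C (V s) i)"
  have V': "\<And>s. s \<in> I \<Longrightarrow> ?V s \<in> tspace M (c s)"
    and eq: "\<And>s m. s \<in> I \<Longrightarrow> m < mdim M \<Longrightarrow> vcomp C (?V s) m = ?a m s"
    using Suc.IH by blast+
  have sm: "smooth1 I (\<lambda>s. vcomp C (?V s) m)" if "m < mdim M" for m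
    by (rule smooth1_cong[OF cov_rhs_iter_smooth[OF c Vs that]]) (simp_all add: eq that)
  note * = cov_deriv_chart[OF c V' sm Suc.prems]
  have "vcomp C ((cov_deriv M g c ^^ Suc \<alpha>) V t) m = (cov_rhs C c ^^ Suc \<alpha>) (\<lambda>i s. vcomp C (V s) i) m t"
    if m: "m < mdim M" for m
    using *(2)[OF _ _ m] cov_rhs_cong[OF cD(2) Suc.prems eq m, where C=C and c=c] by simp
  moreover have "(cov_deriv M g c ^^ Suc \<alpha>) V t \<in> tspace M (c t)" using *(1) by simp
  ultimately show ?case by blast
qed

text \<open>\<open>theta C \<alpha> m A \<xi>\<close> is the coefficient of the \<open>A\<close>-th jet coordinate of a vector field in the
  \<open>m\<close>-th component of its \<open>\<alpha>\<close>-fold covariant derivative along a curve with jet coordinates \<open>\<xi>\<close>.\<close>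

fun theta :: "'a chart \<Rightarrow> nat \<Rightarrow> nat \<Rightarrow> nat \<Rightarrow> (nat \<Rightarrow> real) \<Rightarrow> real" where
  "theta C 0 m A = (\<lambda>\<xi>. if m = A then 1 else 0)"
| "theta C (Suc \<alpha>) m A = (\<lambda>\<xi>. total_deriv (mdim M) (mdim M * Suc \<alpha>) (theta C \<alpha> m A) \<xi>
     + (if mdim M \<le> A then theta C \<alpha> m (A - mdim M) \<xi> else 0)
     + (\<Sum>i<mdim M. \<Sum>j<mdim M. christoffel M g C (trunc (mdim M) \<xi>) m i j * \<xi> (mdim M + i) * theta C \<alpha> j A \<xi>))"

lemma theta_depends_below: "depends_below (mdim M * Suc \<alpha>) (theta C \<alpha> m A)"
proof (induction \<alpha> arbitrary: m A)
  case 0 then show ?case by (simp add: depends_below_def)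
next
  case (Suc \<alpha>)
  define n where "n = mdim M"
  have 1: "depends_below (n * Suc (Suc \<alpha>)) (total_deriv n (n * Suc \<alpha>) (theta C \<alpha> m A))"
    using depends_below_total_deriv[OF Suc.IH, of n] by (simp add: n_def ac_simps)
  have 2: "depends_below (n * Suc (Suc \<alpha>)) (theta C \<alpha> m A)" for m A
    using depends_below_mono[OF Suc.IH] by (simp add: n_def)
  have 3: "trunc n \<xi> = trunc n \<eta>" if "\<forall>j<n * Suc (Suc \<alpha>). \<xi> j = \<eta> j" for \<xi> \<eta> :: "nat \<Rightarrow> real"
    using that by (auto simp: trunc_def fun_eq_iff)
  have 4: "\<xi> (n + i) = \<eta> (n + i)" if "\<forall>j<n * Suc (Suc \<alpha>). \<xi> j = \<eta> j" "i < n" for \<xi> \<eta> :: "nat \<Rightarrow> real" and i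
    using that by (auto intro!: that(1)[rule_format])
  show ?case
    unfolding depends_below_def n_def[symmetric]
  proof (intro allI impI)
    fix \<xi> \<eta> :: "nat \<Rightarrow> real" assume e: "\<forall>j<n * Suc (Suc \<alpha>). \<xi> j = \<eta> j"
    have "total_deriv n (n * Suc \<alpha>) (theta C \<alpha> m A) \<xi> = total_deriv n (n * Suc \<alpha>) (theta C \<alpha> m A) \<eta>"
      using 1 e unfolding depends_below_def by blast
    moreover have "theta C \<alpha> m A \<xi> = theta C \<alpha> m A \<eta>" for m A using 2 e unfolding depends_below_def by blast
    ultimately show "theta C (Suc \<alpha>) m A \<xi> = theta C (Suc \<alpha>) m A \<eta>"
      using 3[OF e] 4[OF e] by (simp add: n_def[symmetric])
  qed
qed

lemma theta_smooth:
  assumes C: "C \<in> atlas M" and m: "m < mdim M" and N: "mdim M * Suc \<alpha> \<le> N"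
  shows "smooth_on N (jet_domain (mdim M) (snd C ` fst C) N) (theta C \<alpha> m A)"
  using m N
proof (induction \<alpha> arbitrary: m A)
  case 0
  then show ?case using openin_jet_domain[OF open_chart[OF C]] by (simp add: smooth_on_const)
next
  case (Suc \<alpha>)
  define n where "n = mdim M"
  have N': "n * Suc \<alpha> \<le> N" "n * Suc \<alpha> + n \<le> N" "n \<le> N" using Suc.prems(2) by (auto simp: n_def)
  have o: "openin (Euclidean_space N) (jet_domain n (snd C ` fst C) N)"
    unfolding n_def by (rule openin_jet_domain[OF open_chart[OF C] N'(3)[unfolded n_def]])
  have IH: "smooth_on N (jet_domain n (snd C ` fst C) N) (theta C \<alpha> m A)" if "m < n" for m A
    unfolding n_def by (rule Suc.IH) (use that N'(1) in \<open>auto simp: n_def\<close>)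
  have chr: "smooth_on N (jet_domain n (snd C ` fst C) N) (\<lambda>\<xi>. christoffel M g C (trunc n \<xi>) m i j)" if "i < n" "j < n" for i j
    unfolding n_def
    by (rule smooth_on_jet_domain_trunc[OF christoffel_smooth[OF metric_chart[OF C] Suc.prems(1)]])
      (use that N'(3) in \<open>auto simp: n_def\<close>)
  have mn: "m < n" using Suc.prems by (simp add: n_def)
  have 2: "smooth_on N (jet_domain n (snd C ` fst C) N) (\<lambda>\<xi>. if n \<le> A then theta C \<alpha> m (A - n) \<xi> else 0)"
    using IH[OF mn] smooth_on_const[OF o] by (cases "n \<le> A") simp_all
  show ?case unfolding theta.simps n_def[symmetric]
    by (intro smooth_on_add smooth_on_total_deriv[OF IH[OF mn] N'(2)] 2 smooth_on_sum[OF o] smooth_on_mult chr smooth_on_coord[OF o] IH) auto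
qed

text \<open>An \<open>\<alpha>\<close>-fold covariant derivative involves the derivatives of the
  field only up to order \<open>\<alpha>\<close>.\<close>

lemma theta_support: "m < mdim M \<Longrightarrow> mdim M * Suc \<alpha> \<le> A \<Longrightarrow> theta C \<alpha> m A = (\<lambda>\<xi>. 0)"
proof (induction \<alpha> arbitrary: m A)
  case (Suc \<alpha>)
  have z: "theta C \<alpha> j A = (\<lambda>\<xi>. 0)" if "j < mdim M" for j using Suc.IH[of j A] Suc.prems that by simp
  moreover have "theta C \<alpha> m (A - mdim M) = (\<lambda>\<xi>. 0)" using Suc.IH[of m "A - mdim M"] Suc.prems by simp
  moreover have "total_deriv n L (\<lambda>\<xi>. 0) \<xi> = 0" for n L \<xi> by (simp add: total_deriv_def partial_def)
  ultimately show ?case using Suc.prems(1) by (intro ext) simp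
qed auto

text \<open>Only the index shift in the recursion reaches the block of highest order, and it carries
  the identity along. The one-forms are therefore triangular with identity blocks on the diagonal,
  which later gives the positivity of the Sasaki metric.\<close>

lemma theta_leading: "m < mdim M \<Longrightarrow> i < mdim M \<Longrightarrow> theta C \<alpha> m (mdim M * \<alpha> + i) \<xi> = (if m = i then 1 else 0)"
proof (induction \<alpha>)
  case (Suc \<alpha>)
  have z: "theta C \<alpha> j (mdim M * Suc \<alpha> + i) = (\<lambda>\<xi>. 0)" if "j < mdim M" for j
    using that by (intro theta_support) auto
  moreover have "total_deriv n L (\<lambda>\<xi>. 0) \<xi> = 0" for n L \<xi> by (simp add: total_deriv_def partial_def)
  moreover have "mdim M * Suc \<alpha> + i - mdim M = mdim M * \<alpha> + i" "mdim M \<le> mdim M * Suc \<alpha> + i" by simp_all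
  ultimately show ?case using Suc by (simp del: mult_Suc_right)
qed simp

text \<open>One more derivative of the sum produces the three summands in the recursion of
  \<open>theta\<close>: the total derivative from the coefficients, the index shift because the
  coordinate \<open>A\<close> of the field has as derivative its coordinate \<open>A + n\<close>,
  and the Christoffel term.\<close>

lemma cov_rhs_iter:
  assumes c: "chart_smooth M C I c" and a: "\<And>j. j < mdim M \<Longrightarrow> smooth1 I (a j)"
    and m: "m < mdim M" and t: "t \<in> I"
  shows "(cov_rhs C c ^^ \<alpha>) a m t =
    (\<Sum>A<mdim M * Suc \<alpha>. theta C \<alpha> m A (inf_jet (mdim M) (\<lambda>s. snd C (c s)) t) * inf_jet (mdim M) (\<lambda>s j. a j s) t A)"
  using m t
proof (induction \<alpha> arbitrary: m t)
  case 0
  have "(\<Sum>A<mdim M. (if m = A then 1 else 0) * inf_jet (mdim M) (\<lambda>s j. a j s) t A) = a m t"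
    using 0 by (simp add: if_distrib[of "\<lambda>x. x * _"] inf_jet_def cong: if_cong)
  then show ?case by simp
next
  case (Suc \<alpha>)
  note cD = chart_smoothD[OF c]
  define n where "n = mdim M"
  define L where "L = n * Suc \<alpha>"
  define \<xi> where "\<xi> s = inf_jet n (\<lambda>s. snd C (c s)) s" for s
  define \<omega> where "\<omega> s = inf_jet n (\<lambda>s j. a j s) s" for s
  have n0: "n > 0" using Suc.prems(1) by (simp add: n_def)
  have nL: "n \<le> L" by (simp add: L_def)
  have IH: "(cov_rhs C c ^^ \<alpha>) a m s = (\<Sum>A<L. theta C \<alpha> m A (\<xi> s) * \<omega> s A)" if "m < n" "s \<in> I" for m s
    using Suc.IH that by (simp add: n_def L_def \<xi>_def \<omega>_def)
  have d1: "((\<lambda>s. theta C \<alpha> m A (\<xi> s)) has_real_derivative total_deriv n L (theta C \<alpha> m A) (\<xi> t)) (at t)" for A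
    unfolding \<xi>_def
  proof (rule total_deriv_chain[OF _ _ order_refl n0 nL cD(2)])
    show "smooth_on L (jet_domain n (snd C ` fst C) L) (theta C \<alpha> m A)"
      unfolding L_def n_def by (rule theta_smooth[OF cD(1) Suc.prems(1) order_refl])
    show "depends_below L (theta C \<alpha> m A)" unfolding L_def n_def by (rule theta_depends_below)
    show "snd C ` fst C \<subseteq> EE n" unfolding n_def by (rule openin_EE_subset[OF open_chart[OF cD(1)]])
  qed (use cD Suc.prems in \<open>auto simp: n_def\<close>)
  have d2: "((\<lambda>s. \<omega> s A) has_real_derivative \<omega> t (A + n)) (at t)" for A
    using smooth1_D[OF inf_jet_smooth[OF n0, of I "\<lambda>s j. a j s" A] Suc.prems(2)] a
    unfolding \<omega>_def deriv_inf_jet[OF n0, of "\<lambda>s j. a j s" A] by (simp add: n_def)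
  have "((\<lambda>s. \<Sum>A<L. theta C \<alpha> m A (\<xi> s) * \<omega> s A) has_real_derivative
     (\<Sum>A<L. total_deriv n L (theta C \<alpha> m A) (\<xi> t) * \<omega> t A + \<omega> t (A + n) * theta C \<alpha> m A (\<xi> t))) (at t)"
    by (intro DERIV_sum DERIV_mult d1 d2)
  then have D: "deriv ((cov_rhs C c ^^ \<alpha>) a m) t =
     (\<Sum>A<L. total_deriv n L (theta C \<alpha> m A) (\<xi> t) * \<omega> t A) + (\<Sum>A<L. theta C \<alpha> m A (\<xi> t) * \<omega> t (A + n))"
    using deriv_cong_open[OF cD(2) Suc.prems(2), of "(cov_rhs C c ^^ \<alpha>) a m" "\<lambda>s. \<Sum>A<L. theta C \<alpha> m A (\<xi> s) * \<omega> s A" 1]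
      IH Suc.prems(1) by (simp add: n_def[symmetric] DERIV_imp_deriv sum.distrib mult.commute)
  have sup: "theta C \<alpha> j A = (\<lambda>\<xi>. 0)" if "j < n" "L \<le> A" for j A
    using theta_support that unfolding n_def L_def by blast
  have mn: "m < n" using Suc.prems(1) by (simp add: n_def)
  \<comment> \<open>The three contributions are brought to the common range below
    \<open>L + n\<close>: coefficients vanish from \<open>L\<close> on, and the index shift fills
    the last block.\<close>
  have S1: "(\<Sum>A<L. total_deriv n L (theta C \<alpha> m A) (\<xi> t) * \<omega> t A) = (\<Sum>A<L + n. total_deriv n L (theta C \<alpha> m A) (\<xi> t) * \<omega> t A)"
    by (rule sum.mono_neutral_left) (auto simp: sup[OF mn] total_deriv_def partial_def)
  have S2: "(\<Sum>A<L. theta C \<alpha> m A (\<xi> t) * \<omega> t (A + n))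
      = (\<Sum>A<L + n. (if n \<le> A then theta C \<alpha> m (A - n) (\<xi> t) else 0) * \<omega> t A)"
  proof -
    have "(\<Sum>A<L. theta C \<alpha> m A (\<xi> t) * \<omega> t (A + n)) = (\<Sum>A\<in>{n..<L + n}. theta C \<alpha> m (A - n) (\<xi> t) * \<omega> t A)"
      by (rule sum.reindex_bij_witness[where i="\<lambda>A. A - n" and j="\<lambda>A. A + n"]) auto
    also have "\<dots> = (\<Sum>A\<in>{n..<L + n}. (if n \<le> A then theta C \<alpha> m (A - n) (\<xi> t) else 0) * \<omega> t A)"
      by (intro sum.cong) auto
    also have "\<dots> = (\<Sum>A<L + n. (if n \<le> A then theta C \<alpha> m (A - n) (\<xi> t) else 0) * \<omega> t A)"
      by (rule sum.mono_neutral_left) auto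
    finally show ?thesis .
  qed
  define G where "G i j = christoffel M g C (snd C (c t)) m i j * \<xi> t (n + i)" for i j
  have x0: "trunc n (\<xi> t) = snd C (c t)"
    unfolding \<xi>_def n_def
    by (rule trunc_inf_jet[of "\<lambda>s. snd C (c s)" t, OF chart_EE[OF cD(1) cD(3)[OF Suc.prems(2)]]])
  have x1: "deriv (\<lambda>s. snd C (c s) i) t = \<xi> t (n + i)" if "i < n" for i
    using that n0 by (simp add: \<xi>_def inf_jet_def)
  have S3: "(\<Sum>i<n. \<Sum>j<n. christoffel M g C (snd C (c t)) m i j * deriv (\<lambda>s. snd C (c s) i) t * (cov_rhs C c ^^ \<alpha>) a j t)
     = (\<Sum>A<L + n. (\<Sum>i<n. \<Sum>j<n. G i j * theta C \<alpha> j A (\<xi> t)) * \<omega> t A)"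
  proof -
    have "(cov_rhs C c ^^ \<alpha>) a j t = (\<Sum>A<L + n. theta C \<alpha> j A (\<xi> t) * \<omega> t A)" if "j < n" for j
      unfolding IH[OF that Suc.prems(2)] by (rule sum.mono_neutral_left) (auto simp: sup[OF that])
    then have "(\<Sum>i<n. \<Sum>j<n. christoffel M g C (snd C (c t)) m i j * deriv (\<lambda>s. snd C (c s) i) t * (cov_rhs C c ^^ \<alpha>) a j t)
      = (\<Sum>i<n. \<Sum>j<n. \<Sum>A<L + n. G i j * theta C \<alpha> j A (\<xi> t) * \<omega> t A)"
      by (simp add: G_def x1 sum_distrib_left mult.assoc)
    also have "\<dots> = (\<Sum>A<L + n. \<Sum>i<n. \<Sum>j<n. G i j * theta C \<alpha> j A (\<xi> t) * \<omega> t A)"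
      by (rule sum_move_first3[symmetric])
    finally show ?thesis by (simp add: sum_distrib_right)
  qed
  have "(cov_rhs C c ^^ Suc \<alpha>) a m t = (\<Sum>A<L + n. total_deriv n L (theta C \<alpha> m A) (\<xi> t) * \<omega> t A)
     + (\<Sum>A<L + n. (if n \<le> A then theta C \<alpha> m (A - n) (\<xi> t) else 0) * \<omega> t A)
     + (\<Sum>A<L + n. (\<Sum>i<n. \<Sum>j<n. G i j * theta C \<alpha> j A (\<xi> t)) * \<omega> t A)"
    unfolding S1[symmetric] S2[symmetric] S3[symmetric] D[symmetric]
    by (simp add: cov_rhs_def n_def)
  also have "\<dots> = (\<Sum>A<L + n. theta C (Suc \<alpha>) m A (\<xi> t) * \<omega> t A)"
    unfolding theta.simps n_def[symmetric] L_def[symmetric]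
    by (simp add: sum.distrib[symmetric] distrib_right[symmetric] x0 G_def)
  finally show ?case by (simp add: n_def \<xi>_def \<omega>_def L_def ac_simps)
qed

text \<open>Mixed partial derivatives commute, so the time jet of the variation field has the
  components of \<open>W\<close> as coordinates, and \<open>cov_rhs_iter\<close> applies. The
  resulting components no longer mention the family, which makes the choice in \<open>K_map\<close>
  harmless.\<close>

lemma K_map_family:
  assumes W: "W \<in> tspace (jet_bundle k M) u" and C: "C \<in> atlas M" "jet_base u \<in> fst C"
    and \<gamma>: "family_for M k W \<gamma>" and \<alpha>: "\<alpha> \<le> k"
  defines "X \<equiv> (cov_deriv M g (\<gamma> 0) ^^ \<alpha>) (\<lambda>t. velocity M (\<lambda>s. \<gamma> s t) 0) 0"
  shows "X \<in> tspace M (jet_base u)"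
    "m < mdim M \<Longrightarrow> vcomp C X m =
      (\<Sum>A<mdim M * Suc \<alpha>. theta C \<alpha> m A (snd (jet_chart M k C) u) * vcomp (jet_chart M k C) W A)"
proof -
  define n where "n = mdim M"
  note b = family_for_base[OF W \<gamma>]
  have g0: "\<gamma> 0 0 \<in> fst C" using b(3) C(2) by simp
  have "smooth_family M \<gamma>" using \<gamma> by (simp add: family_for_def)
  then obtain e where e: "family_box M C \<gamma> e"
    using smooth_family_box[of M \<gamma> C] C(1) g0 by blast
  note eD = family_boxD[OF e]
  have c: "chart_smooth M C {-e<..<e} (\<gamma> 0)" by (rule family_box_curves(1)[OF e]) (use eD in simp)
  define Y where "Y i z = snd C (\<gamma> (z 0) (z 1)) i" for i and z :: "nat \<Rightarrow> real"
  have Y: "smooth_on 2 (box2 e) (Y i)" if "i < n" for i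
    using eD(4) that unfolding Y_def[abs_def] n_def by blast
  define V where "V t = velocity M (\<lambda>s. \<gamma> s t) 0" for t
  have V: "V t \<in> tspace M (\<gamma> 0 t)" "\<And>i. i < n \<Longrightarrow> vcomp C (V t) i = partial 0 (Y i) (pt 0 t)"
    if "t \<in> {-e<..<e}" for t
  proof -
    have cs: "chart_smooth M C {-e<..<e} (\<lambda>s. \<gamma> s t)" by (rule family_box_curves(2)[OF e]) (use that in auto)
    have z: "0 \<in> {-e<..<e}" using eD(2) by simp
    note v = velocity[OF chart_smooth_curve[OF cs] z]
    show "V t \<in> tspace M (\<gamma> 0 t)" using v(1) by (simp add: V_def)
    show "vcomp C (V t) i = partial 0 (Y i) (pt 0 t)" if "i < n" for i
      using v(2)[OF C(1) chart_smoothD(3)[OF cs z]] that by (simp add: V_def partial_pt Y_def n_def)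
  qed
  have Vs: "smooth1 {-e<..<e} (\<lambda>t. vcomp C (V t) i)" if "i < mdim M" for i
  proof (rule smooth1_cong)
    have "smooth_on 2 (box2 e) (partial 0 (Y i))" using smooth_on_partial[OF Y] that by (simp add: n_def)
    then show "smooth1 {-e<..<e} (\<lambda>t. partial 0 (Y i) (pt 0 t))"
      by (rule smooth1_box_t) (use eD(2) in simp)
  qed (use that V(2) in \<open>simp add: n_def\<close>)
  have z: "0 \<in> {-e<..<e}" using eD(2) by simp
  note it = cov_deriv_iter[OF c V(1) Vs z, of \<alpha>]
  have X: "X = (cov_deriv M g (\<gamma> 0) ^^ \<alpha>) V 0" by (simp add: X_def V_def[abs_def])
  show "X \<in> tspace M (jet_base u)" using it b(3) by (simp add: X)
  assume m: "m < mdim M"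
  have \<omega>: "inf_jet n (\<lambda>s j. vcomp C (V s) j) 0 A = vcomp (jet_chart M k C) W A" if A: "A < n * Suc \<alpha>" for A
  proof -
    have Ak: "A < n * (k + 1)" using A \<alpha> by (metis Suc_eq_plus1 Suc_le_mono less_le_trans mult_le_mono2)
    note d = div_index[OF Ak]
    define r where "r = A div n"
    define i where "i = A mod n"
    have i: "i < n" using d by (simp add: i_def)
    have "inf_jet n (\<lambda>s j. vcomp C (V s) j) 0 A = (deriv ^^ r) (\<lambda>t. partial 0 (Y i) (pt 0 t)) 0"
      unfolding inf_jet_def r_def[symmetric] i_def[symmetric]
      by (rule deriv_cong_open[OF _ z]) (use V(2) i in auto)
    also have "\<dots> = (partial 1 ^^ r) (partial 0 (Y i)) (pt 0 0)"
      by (simp only: higher_deriv_pt)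
    also have "\<dots> = partial 0 ((partial 1 ^^ r) (Y i)) (pt 0 0)"
      by (rule higher_partial_commute[OF Y[OF i]]) (use eD(2) in \<open>auto simp: pt_in_box2\<close>)
    also have "\<dots> = deriv (\<lambda>s. (partial 1 ^^ r) (Y i) (pt s 0)) 0" by (rule partial_pt)
    also have "\<dots> = deriv (\<lambda>s. snd (jet_chart M k C) (jet M k (\<gamma> s)) A) 0"
    proof -
      have "(partial 1 ^^ r) (Y i) (pt s 0) = snd (jet_chart M k C) (jet M k (\<gamma> s)) A" if "s \<in> {-e<..<e}" for s
      proof -
        have "snd (jet_chart M k C) (jet M k (\<gamma> s)) A = (partial 1 ^^ (A div mdim M)) (\<lambda>z. snd C (\<gamma> (z 0) (z 1)) (A mod mdim M)) (pt s 0)"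
          by (rule family_jet_coord[OF e]) (use that Ak in \<open>auto simp: n_def\<close>)
        then show ?thesis by (simp only: Y_def[abs_def] r_def i_def n_def)
      qed
      from deriv_cong_open[OF _ z this, where r=1] show ?thesis by simp
    qed
    also have "\<dots> = vcomp (jet_chart M k C) W A"
      using b(4)[OF C(1) g0] Ak by (simp add: n_def)
    finally show ?thesis .
  qed
  have q: "smooth_germ M (\<gamma> 0)" by (rule b(2))
  have "snd (jet_chart M k C) u = trunc (n * (k + 1)) (inf_jet n (\<lambda>t. snd C (\<gamma> 0 t)) 0)"
    unfolding b(1) n_def by (rule jet_chart_jet(2)[OF q C(1) g0])
  moreover have "n * Suc \<alpha> \<le> n * (k + 1)" using \<alpha> by (intro mult_le_mono2) simp
  ultimately have \<xi>: "theta C \<alpha> m A (snd (jet_chart M k C) u) = theta C \<alpha> m A (inf_jet n (\<lambda>t. snd C (\<gamma> 0 t)) 0)" for A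
    using depends_below_trunc[OF theta_depends_below] unfolding n_def by metis
  have "vcomp C X m = (cov_rhs C (\<gamma> 0) ^^ \<alpha>) (\<lambda>i s. vcomp C (V s) i) m 0" using it m by (simp add: X)
  also have "\<dots> = (\<Sum>A<n * Suc \<alpha>. theta C \<alpha> m A (inf_jet n (\<lambda>s. snd C (\<gamma> 0 s)) 0) * inf_jet n (\<lambda>s j. vcomp C (V s) j) 0 A)"
    unfolding n_def by (rule cov_rhs_iter[OF c Vs m z])
  also have "\<dots> = (\<Sum>A<n * Suc \<alpha>. theta C \<alpha> m A (snd (jet_chart M k C) u) * vcomp (jet_chart M k C) W A)"
    by (intro sum.cong refl) (use \<omega> \<xi> in auto)
  finally show "vcomp C X m =
      (\<Sum>A<mdim M * Suc \<alpha>. theta C \<alpha> m A (snd (jet_chart M k C) u) * vcomp (jet_chart M k C) W A)"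
    by (simp add: n_def)
qed

lemma pushforward_jet_base:
  assumes W: "W \<in> tspace (jet_bundle k M) u" and C: "C \<in> atlas M" "jet_base u \<in> fst C"
  shows "pushforward M jet_base W \<in> tspace M (jet_base u)"
    "m < mdim M \<Longrightarrow> vcomp C (pushforward M jet_base W) m = vcomp (jet_chart M k C) W m"
proof -
  note WD = tspaceD[OF W]
  have "u \<in> jets M k"
    using smooth_germ_carrier[OF WD(1)] WD(2) by (simp add: mcarrier_jet_bundle)
  then have C': "jet_chart M k C \<in> atlas (jet_bundle k M)" "rep W 0 \<in> fst (jet_chart M k C)"
    using C WD(2) by (auto simp: atlas_jet_bundle jet_chart_fst)
  obtain J where J: "0 \<in> J" "chart_smooth (jet_bundle k M) (jet_chart M k C) J (rep W)"
    by (rule smooth_germ_chart[OF WD(1) C'])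
  note JD = chart_smoothD[OF J(2)]
  have base: "jet_base (rep W t) \<in> fst C" if "t \<in> J" for t using JD(3)[OF that] by (simp add: jet_chart_fst)
  have eq: "snd C (jet_base (rep W t)) i = snd (jet_chart M k C) (rep W t) i" if "t \<in> J" "i < mdim M" for t i
    using fun_cong[OF jet_coord_base[OF C(1) base[OF that(1)], of k], of i] that(2) by (simp add: trunc_def)
  have cs: "chart_smooth M C J (\<lambda>t. jet_base (rep W t))"
    unfolding chart_smooth_def
  proof (intro conjI ballI allI impI C(1) JD(2) base)
    fix i assume i: "i < mdim M"
    then have "i < mdim (jet_bundle k M)" by simp
    from JD(4)[OF this] show "smooth1 J (\<lambda>t. snd C (jet_base (rep W t)) i)"
      by (rule smooth1_cong) (simp add: eq i)
  qed
  have q: "smooth_germ M (\<lambda>t. jet_base (rep W t))" by (rule smooth_germI[OF cs J(1)])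
  show "pushforward M jet_base W \<in> tspace M (jet_base u)"
    using jet_in_tspace[OF q] WD(2) by (simp add: pushforward_def)
  assume m: "m < mdim M"
  have "vcomp C (pushforward M jet_base W) m = deriv (\<lambda>t. snd C (jet_base (rep W t)) m) 0"
    unfolding pushforward_def by (rule vcomp_jet[OF q C(1) base[OF J(1)] m])
  also have "\<dots> = deriv (\<lambda>t. snd (jet_chart M k C) (rep W t) m) 0"
    using deriv_cong_open[OF JD(2) J(1) eq[OF _ m], where r=1] by simp
  finally show "vcomp C (pushforward M jet_base W) m = vcomp (jet_chart M k C) W m" by (simp add: vcomp_def)
qed

lemma K_map:
  assumes W: "W \<in> tspace (jet_bundle k M) u" and C: "C \<in> atlas M" "jet_base u \<in> fst C" and \<alpha>: "\<alpha> \<le> k"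
  shows "K_map M g k \<alpha> W \<in> tspace M (jet_base u)"
    "m < mdim M \<Longrightarrow> vcomp C (K_map M g k \<alpha> W) m = 1 / fact \<alpha> *
      (\<Sum>A<mdim M * Suc \<alpha>. theta C \<alpha> m A (snd (jet_chart M k C) u) * vcomp (jet_chart M k C) W A)"
proof -
  have pM: "jet_base u \<in> mcarrier M" using C by (auto simp: mcarrier_def)
  define X where "X = (let \<gamma> = (SOME \<gamma>. family_for M k W \<gamma>) in
    (cov_deriv M g (\<gamma> 0) ^^ \<alpha>) (\<lambda>t. velocity M (\<lambda>s. \<gamma> s t) 0) 0)"
  have \<gamma>: "family_for M k W (SOME \<gamma>. family_for M k W \<gamma>)" using family_exists[OF W] by (rule someI_ex)
  note X = K_map_family[OF W C \<gamma> \<alpha>, folded X_def[unfolded Let_def]]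
  have K: "K_map M g k \<alpha> W = (if \<alpha> = 0 then pushforward M jet_base W else scale_vec M (1 / fact \<alpha>) X)"
    by (simp add: K_map_def X_def Let_def)
  show "K_map M g k \<alpha> W \<in> tspace M (jet_base u)"
    using pushforward_jet_base(1)[OF W C] scale_vec(1)[OF X(1) pM] by (simp add: K)
  assume m: "m < mdim M"
  show "vcomp C (K_map M g k \<alpha> W) m = 1 / fact \<alpha> *
      (\<Sum>A<mdim M * Suc \<alpha>. theta C \<alpha> m A (snd (jet_chart M k C) u) * vcomp (jet_chart M k C) W A)"
  proof (cases "\<alpha> = 0")
    case True
    \<comment> \<open>For \<open>\<alpha> = 0\<close>, where \<open>K_map\<close> is a pushforward,
      \<open>theta\<close> is the identity, so the common formula covers this case as well.\<close>
    have "(\<Sum>A<mdim M. (if m = A then 1 else 0) * vcomp (jet_chart M k C) W A) = vcomp (jet_chart M k C) W m"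
      using m by (simp add: if_distrib[of "\<lambda>x. x * _"] cong: if_cong)
    then show ?thesis unfolding K using True pushforward_jet_base(2)[OF W C m] by simp
  next
    case False
    then show ?thesis unfolding K using scale_vec(2)[OF X(1) pM C m] X(2)[OF m] by simp
  qed
qed

end

subsection \<open>The Sasaki metric in coordinates\<close>

lemma posdef_nonneg: "posdef n A \<Longrightarrow> 0 \<le> (\<Sum>i<n. \<Sum>j<n. v i * v j * A i j)"
proof (cases "\<exists>i<n. v i \<noteq> 0")
  case True
  then show "posdef n A \<Longrightarrow> ?thesis" using posdefD[of n A _ v] by (auto intro: less_imp_le)
qed simp

lemma partial_sum:
  assumes "\<And>p. p \<in> Z \<Longrightarrow> smooth_on n S (f p)" "x \<in> S" "i < n"
  shows "partial i (\<lambda>y. \<Sum>p\<in>Z. f p y) x = (\<Sum>p\<in>Z. partial i (f p) x)"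
proof -
  have "((\<lambda>s. \<Sum>p\<in>Z. f p (x(i := s))) has_real_derivative (\<Sum>p\<in>Z. partial i (f p) x)) (at (x i))"
    by (intro DERIV_sum smooth_on_partial_deriv[OF assms(1) assms(2,3)])
  from DERIV_imp_deriv[OF this] show ?thesis unfolding partial_def .
qed

lemma partial_mult:
  assumes "smooth_on n S f" "smooth_on n S h" "x \<in> S" "i < n"
  shows "partial i (\<lambda>y. f y * h y) x = partial i f x * h x + f x * partial i h x"
proof -
  have "((\<lambda>s. f (x(i := s)) * h (x(i := s))) has_real_derivative
     partial i f x * h (x(i := x i)) + partial i h x * f (x(i := x i))) (at (x i))"
    by (rule DERIV_mult[OF smooth_on_partial_deriv[OF assms(1,3,4)] smooth_on_partial_deriv[OF assms(2,3,4)]])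
  from DERIV_imp_deriv[OF this] show ?thesis by (simp add: partial_def mult.commute)
qed

text \<open>The geodesic equation with lowered index, for the metric coefficients \<open>G\<close>, at a point with
  velocity \<open>v\<close> and second derivative \<open>a\<close>.\<close>

definition lowered_geodesic :: "nat \<Rightarrow> (nat \<Rightarrow> nat \<Rightarrow> (nat \<Rightarrow> real) \<Rightarrow> real) \<Rightarrow> (nat \<Rightarrow> real) \<Rightarrow>
    (nat \<Rightarrow> real) \<Rightarrow> (nat \<Rightarrow> real) \<Rightarrow> nat \<Rightarrow> real" where
  "lowered_geodesic n G x v a l = (\<Sum>m<n. G l m x * a m) +
     (\<Sum>i<n. \<Sum>j<n. (partial i (G l j) x - partial l (G i j) x / 2) * v i * v j)"

lemma lowered_geodesic_cong:
  assumes "openin (Euclidean_space n) S" "x \<in> S" "l < n"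
    "\<And>i j y. i < n \<Longrightarrow> j < n \<Longrightarrow> y \<in> S \<Longrightarrow> G i j y = G' i j y"
    "\<And>i. i < n \<Longrightarrow> v i = v' i" "\<And>i. i < n \<Longrightarrow> a i = a' i"
  shows "lowered_geodesic n G x v a l = lowered_geodesic n G' x v' a' l"
proof -
  have "partial k (G i j) x = partial k (G' i j) x" if "k < n" "i < n" "j < n" for k i j
    by (rule partial_cong[OF assms(1,2) that(1)]) (use assms(4) that in auto)
  then show ?thesis unfolding lowered_geodesic_def using assms by simp
qed

lemma lowered_geodesic_sum:
  assumes Q: "\<And>p i j. p \<in> Z \<Longrightarrow> i < n \<Longrightarrow> j < n \<Longrightarrow> smooth_on n S (Q p i j)" and x: "x \<in> S" and l: "l < n"
  shows "lowered_geodesic n (\<lambda>i j y. \<Sum>p\<in>Z. Q p i j y) x v a l = (\<Sum>p\<in>Z. lowered_geodesic n (Q p) x v a l)"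
proof -
  have p: "partial k (\<lambda>y. \<Sum>p\<in>Z. Q p i j y) x = (\<Sum>p\<in>Z. partial k (Q p i j) x)" if "k < n" "i < n" "j < n" for k i j
    by (rule partial_sum[OF Q x that(1)]) (use that in auto)
  have "(\<Sum>i<n. \<Sum>j<n. (partial i (\<lambda>y. \<Sum>p\<in>Z. Q p l j y) x - partial l (\<lambda>y. \<Sum>p\<in>Z. Q p i j y) x / 2) * v i * v j)
    = (\<Sum>i<n. \<Sum>j<n. \<Sum>p\<in>Z. (partial i (Q p l j) x - partial l (Q p i j) x / 2) * v i * v j)"
    by (intro sum.cong refl) (simp add: p l sum_subtractf[symmetric] sum_divide_distrib sum_distrib_right)
  also have "\<dots> = (\<Sum>p\<in>Z. \<Sum>i<n. \<Sum>j<n. (partial i (Q p l j) x - partial l (Q p i j) x / 2) * v i * v j)"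
    by (rule sum_move_first3[symmetric])
  finally have 1: "(\<Sum>i<n. \<Sum>j<n. (partial i (\<lambda>y. \<Sum>p\<in>Z. Q p l j y) x - partial l (\<lambda>y. \<Sum>p\<in>Z. Q p i j y) x / 2) * v i * v j)
    = (\<Sum>p\<in>Z. \<Sum>i<n. \<Sum>j<n. (partial i (Q p l j) x - partial l (Q p i j) x / 2) * v i * v j)" .
  have "(\<Sum>m<n. (\<Sum>p\<in>Z. Q p l m x) * a m) = (\<Sum>p\<in>Z. \<Sum>m<n. Q p l m x * a m)"
    unfolding sum_distrib_right by (rule sum.swap)
  with 1 show ?thesis by (simp add: lowered_geodesic_def sum.distrib)
qed

lemma lowered_geodesic_add:
  assumes "\<And>i j. i < n \<Longrightarrow> j < n \<Longrightarrow> smooth_on n S (Q i j)" "\<And>i j. i < n \<Longrightarrow> j < n \<Longrightarrow> smooth_on n S (R i j)"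
    and x: "x \<in> S" and l: "l < n"
  shows "lowered_geodesic n (\<lambda>i j y. Q i j y + R i j y) x v a l = lowered_geodesic n Q x v a l + lowered_geodesic n R x v a l"
proof -
  \<comment> \<open>The two coefficient families are indexed by the truth values, which reduces the
    claim to \<open>lowered_geodesic_sum\<close>.\<close>
  have "lowered_geodesic n (\<lambda>i j y. \<Sum>p\<in>{True, False}. (if p then Q else R) i j y) x v a l
     = (\<Sum>p\<in>{True, False}. lowered_geodesic n (if p then Q else R) x v a l)"
    by (rule lowered_geodesic_sum[OF _ x l]) (use assms in auto)
  then show ?thesis by simp
qed

text \<open>The rank one terms \<open>\<theta>\<^sub>1 \<theta>\<^sub>2\<close> of the metric do not contribute to the geodesic equation along a
  curve that annihilates the one-forms \<open>\<theta>\<^sub>1\<close> and \<open>\<theta>\<^sub>2\<close>.\<close>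

lemma lowered_geodesic_annihilated:
  assumes \<kappa>1: "\<And>A. A < N \<Longrightarrow> smooth_on N S (\<kappa>1 A)" and \<kappa>2: "\<And>A. A < N \<Longrightarrow> smooth_on N S (\<kappa>2 A)"
    and h: "smooth_on N S h" and x: "x \<in> S" and l: "l < N"
    and v1: "(\<Sum>A<N. \<kappa>1 A x * v A) = 0" and v2: "(\<Sum>A<N. \<kappa>2 A x * v A) = 0"
    and a2: "(\<Sum>A<N. \<kappa>2 A x * a A) + (\<Sum>i<N. \<Sum>j<N. partial i (\<kappa>2 j) x * v i * v j) = 0"
  shows "lowered_geodesic N (\<lambda>A B y. \<kappa>1 A y * \<kappa>2 B y * h y) x v a l = 0"
proof -
  have p: "partial k (\<lambda>y. \<kappa>1 i y * \<kappa>2 j y * h y) x =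
      partial k (\<kappa>1 i) x * \<kappa>2 j x * h x + \<kappa>1 i x * partial k (\<kappa>2 j) x * h x + \<kappa>1 i x * \<kappa>2 j x * partial k h x"
    if "k < N" "i < N" "j < N" for k i j
    unfolding partial_mult[OF smooth_on_mult[OF \<kappa>1[OF that(2)] \<kappa>2[OF that(3)]] h x that(1)]
      partial_mult[OF \<kappa>1[OF that(2)] \<kappa>2[OF that(3)] x that(1)] by (simp add: algebra_simps)
  have f2: "(\<Sum>j<N. c * \<kappa>2 j x * v j) = 0" for c
    using v2 by (simp add: sum_distrib_left[symmetric] mult.assoc)
  have f1: "(\<Sum>i<N. c * \<kappa>1 i x * v i) = 0" for c
    using v1 by (simp add: sum_distrib_left[symmetric] mult.assoc)
  \<comment> \<open>After the product rule every summand has a factor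
    \<open>\<kappa>2 j x * v j\<close> or \<open>\<kappa>1 i x * v i\<close> and drops out of the
    sum, except the one with \<open>partial i (\<kappa>2 j) x\<close>, which joins the acceleration
    term to form \<open>a2\<close>. A derivative of \<open>\<kappa>1\<close> always leaves the
    factor \<open>\<kappa>2 j x * v j\<close>; this explains why the second-order hypothesis
    concerns \<open>\<kappa>2\<close> alone.\<close>
  have "(\<Sum>i<N. \<Sum>j<N. (partial i (\<lambda>y. \<kappa>1 l y * \<kappa>2 j y * h y) x - partial l (\<lambda>y. \<kappa>1 i y * \<kappa>2 j y * h y) x / 2) * v i * v j)
    = (\<Sum>i<N. \<Sum>j<N. ((partial i (\<kappa>1 l) x * h x * v i + \<kappa>1 l x * partial i h x * v i
          - (partial l (\<kappa>1 i) x * h x + \<kappa>1 i x * partial l h x) * v i / 2) * \<kappa>2 j x * v j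
        + \<kappa>1 l x * h x * (partial i (\<kappa>2 j) x * v i * v j))
        - (h x * partial l (\<kappa>2 j) x * v j / 2) * \<kappa>1 i x * v i)"
  proof (intro sum.cong refl)
    fix i j assume "i \<in> {..<N}" "j \<in> {..<N}"
    then have ij: "i < N" "j < N" by auto
    show "(partial i (\<lambda>y. \<kappa>1 l y * \<kappa>2 j y * h y) x - partial l (\<lambda>y. \<kappa>1 i y * \<kappa>2 j y * h y) x / 2) * v i * v j
      = ((partial i (\<kappa>1 l) x * h x * v i + \<kappa>1 l x * partial i h x * v i
          - (partial l (\<kappa>1 i) x * h x + \<kappa>1 i x * partial l h x) * v i / 2) * \<kappa>2 j x * v j
        + \<kappa>1 l x * h x * (partial i (\<kappa>2 j) x * v i * v j))
        - (h x * partial l (\<kappa>2 j) x * v j / 2) * \<kappa>1 i x * v i"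
      unfolding p[OF ij(1) l ij(2)] p[OF l ij] by (simp add: field_simps)
  qed
  also have "\<dots> = (\<Sum>i<N. \<Sum>j<N. \<kappa>1 l x * h x * (partial i (\<kappa>2 j) x * v i * v j))
      - (\<Sum>i<N. \<Sum>j<N. (h x * partial l (\<kappa>2 j) x * v j / 2) * \<kappa>1 i x * v i)"
    by (simp only: sum_subtractf sum.distrib f2) simp
  also have "(\<Sum>i<N. \<Sum>j<N. (h x * partial l (\<kappa>2 j) x * v j / 2) * \<kappa>1 i x * v i)
     = (\<Sum>j<N. \<Sum>i<N. (h x * partial l (\<kappa>2 j) x * v j / 2) * \<kappa>1 i x * v i)"
    by (rule sum.swap)
  also have "\<dots> = 0" by (simp only: f1) simp
  finally have 1: "(\<Sum>i<N. \<Sum>j<N. (partial i (\<lambda>y. \<kappa>1 l y * \<kappa>2 j y * h y) x - partial l (\<lambda>y. \<kappa>1 i y * \<kappa>2 j y * h y) x / 2) * v i * v j)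
    = \<kappa>1 l x * h x * (\<Sum>i<N. \<Sum>j<N. partial i (\<kappa>2 j) x * v i * v j)"
    by (simp add: sum_distrib_left)
  have 2: "(\<Sum>m<N. \<kappa>1 l x * \<kappa>2 m x * h x * a m) = \<kappa>1 l x * h x * (\<Sum>m<N. \<kappa>2 m x * a m)"
    by (simp add: sum_distrib_left mult_ac)
  show ?thesis unfolding lowered_geodesic_def 1 2 distrib_left[symmetric] a2 by simp
qed

text \<open>For coefficients pulled back from the first \<open>N'\<close> coordinates, the entries
  with a larger index vanish, and so do the derivatives in the directions from \<open>N'\<close> on;
  all sums shorten to \<open>N'\<close>.\<close>

lemma lowered_geodesic_restrict:
  assumes le: "N' \<le> N" and l: "l < N'" and depends_below: "\<And>i j. depends_below N' (G i j)"
    and z: "\<And>i j. N' \<le> i \<or> N' \<le> j \<Longrightarrow> i < N \<Longrightarrow> j < N \<Longrightarrow> G i j = (\<lambda>_. 0)"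
  shows "lowered_geodesic N G x v a l = lowered_geodesic N' G (trunc N' x) v a l"
proof -
  have lN: "l < N" using l le by simp
  have 1: "(\<Sum>m<N. G l m x * a m) = (\<Sum>m<N'. G l m x * a m)"
    using le by (intro sum.mono_neutral_right) (auto simp: z lN)
  have pz: "partial i (\<lambda>_. 0) x = 0" for i by (simp add: partial_def)
  have "(\<Sum>j<N. (partial i (G l j) x - partial l (G i j) x / 2) * v i * v j)
      = (\<Sum>j<N'. (partial i (G l j) x - partial l (G i j) x / 2) * v i * v j)" if "i < N" for i
    using le that by (intro sum.mono_neutral_right) (auto simp: z lN pz)
  moreover have "(\<Sum>i<N. \<Sum>j<N'. (partial i (G l j) x - partial l (G i j) x / 2) * v i * v j)
      = (\<Sum>i<N'. \<Sum>j<N'. (partial i (G l j) x - partial l (G i j) x / 2) * v i * v j)"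
    using le by (intro sum.mono_neutral_right) (auto simp: z lN pz partial_outside[OF depends_below])
  ultimately show ?thesis
    unfolding lowered_geodesic_def 1 by (simp add: depends_below_trunc[OF depends_below order_refl] depends_below_trunc[OF depends_below_partial[OF depends_below] order_refl])
qed

section \<open>Geodesics through the lowered equation\<close>

context charted
begin

text \<open>Stated for any metric satisfying \<open>metric_chart\<close> in every chart, so that it
  serves source and target of the projection, be they jet bundles or \<open>M\<close>
  itself.\<close>

lemma geodesic_iff_lowered_geodesic:
  assumes c: "smooth_curve M I c" and mc: "\<forall>C\<in>atlas M. metric_chart M g C"
  shows "geodesic M g I c \<longleftrightarrow> (\<forall>t\<in>I. \<forall>C\<in>atlas M. c t \<in> fst C \<longrightarrow> (\<forall>l<mdim M.
    lowered_geodesic (mdim M) (metric_coeff M g C) (snd C (c t)) (\<lambda>i. deriv (\<lambda>s. snd C (c s) i) t)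
      (\<lambda>i. deriv (deriv (\<lambda>s. snd C (c s) i)) t) l = 0))"
proof -
  have I: "open I" using c by (simp add: smooth_curve_def)
  have "has_cov_deriv M g c (velocity M c) t (zero_vec M (c t)) \<longleftrightarrow> (\<forall>C\<in>atlas M. c t \<in> fst C \<longrightarrow> (\<forall>l<mdim M.
    lowered_geodesic (mdim M) (metric_coeff M g C) (snd C (c t)) (\<lambda>i. deriv (\<lambda>s. snd C (c s) i) t)
      (\<lambda>i. deriv (deriv (\<lambda>s. snd C (c s) i)) t) l = 0))" if t: "t \<in> I" for t
  proof -
    have cM: "c t \<in> mcarrier M" using c t by (simp add: smooth_curve_def)
    have ev: "\<forall>\<^sub>F s in nhds t. velocity M c s \<in> tspace M (c s)"
      using eventually_nhds_in_open[OF I t] by eventually_elim (rule velocity(1)[OF c])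
    have "(\<forall>m<mdim M. (\<lambda>s. vcomp C (velocity M c s) m) differentiable (at t) \<and>
           vcomp C (zero_vec M (c t)) m = deriv (\<lambda>s. vcomp C (velocity M c s) m) t +
             (\<Sum>i<mdim M. \<Sum>j<mdim M. christoffel M g C (snd C (c t)) m i j *
                vcomp C (velocity M c t) i * vcomp C (velocity M c t) j)) \<longleftrightarrow>
       (\<forall>l<mdim M. lowered_geodesic (mdim M) (metric_coeff M g C) (snd C (c t)) (\<lambda>i. deriv (\<lambda>s. snd C (c s) i) t)
          (\<lambda>i. deriv (deriv (\<lambda>s. snd C (c s) i)) t) l = 0)" (is "?L \<longleftrightarrow> ?R")
      if C: "C \<in> atlas M" "c t \<in> fst C" for C
    proof -
      obtain J where J: "t \<in> J" "J \<subseteq> I" "chart_smooth M C J c" by (rule smooth_curve_chart[OF c t C])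
      note JD = chart_smoothD[OF J(3)]
      have v: "vcomp C (velocity M c s) m = deriv (\<lambda>s. snd C (c s) m) s" if "s \<in> J" "m < mdim M" for s m
        using velocity(2)[OF c _ C(1) JD(3)[OF that(1)] that(2)] J(2) that(1) by blast
      have d: "deriv (\<lambda>s. vcomp C (velocity M c s) m) t = deriv (deriv (\<lambda>s. snd C (c s) m)) t" if "m < mdim M" for m
        using deriv_cong_open[OF JD(2) J(1) v[OF _ that], where r=1] by simp
      have "smooth1 J (\<lambda>s. vcomp C (velocity M c s) m)" if "m < mdim M" for m
        by (rule smooth1_cong[OF smooth1_deriv[OF JD(4)[OF that]]]) (simp add: v that)
      then have diff: "(\<lambda>s. vcomp C (velocity M c s) m) differentiable (at t)" if "m < mdim M" for m
        using smooth1_D[OF _ J(1)] that by (auto simp: real_differentiable_def)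
      have "?L \<longleftrightarrow> (\<forall>m<mdim M. deriv (deriv (\<lambda>s. snd C (c s) m)) t +
             (\<Sum>i<mdim M. \<Sum>j<mdim M. christoffel M g C (snd C (c t)) m i j *
                deriv (\<lambda>s. snd C (c s) i) t * deriv (\<lambda>s. snd C (c s) j) t) = 0)"
        using diff d v[OF J(1)] zero_vec(2)[OF cM C] by (auto simp: eq_commute[of 0])
      also have "\<dots> \<longleftrightarrow> ?R"
        unfolding lowered_geodesic_def
        by (rule geodesic_equation_lowered[OF bspec[OF mc C(1)] imageI[OF C(2)] christoffel_levi_civita[OF bspec[OF mc C(1)] imageI[OF C(2)]]])
      finally show ?thesis .
    qed
    then show ?thesis unfolding has_cov_deriv_def using ev zero_vec(1)[OF cM] by blast
  qed
  then show ?thesis unfolding geodesic_def using c by blast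
qed

end

section \<open>Coefficients of the Sasaki metrics and their positivity\<close>

context riem
begin

text \<open>The contribution of \<open>K_map\<close> with index \<open>\<alpha>\<close>; the two
  factors \<open>1 / fact \<alpha>\<close> stem from its scaling, one for each argument. Since
  \<open>k\<close> does not occur, the metrics of consecutive orders share these functions and
  differ by one summand.\<close>

definition sasaki_coeff :: "'a chart \<Rightarrow> nat \<Rightarrow> nat \<Rightarrow> nat \<Rightarrow> (nat \<Rightarrow> real) \<Rightarrow> real" where
  "sasaki_coeff C \<alpha> A B \<xi> = (\<Sum>m<mdim M. \<Sum>l<mdim M. theta C \<alpha> m A \<xi> * theta C \<alpha> l B \<xi> *
     (1 / fact \<alpha> * (1 / fact \<alpha>) * metric_coeff M g C m l (trunc (mdim M) \<xi>)))"

lemma theta_sum_extend: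
  assumes "\<alpha> \<le> k" "m < mdim M"
  shows "(\<Sum>A<mdim M * Suc \<alpha>. theta C \<alpha> m A \<xi> * w A) = (\<Sum>A<mdim M * (k + 1). theta C \<alpha> m A \<xi> * w A)"
proof (rule sum.mono_neutral_left)
  have "mdim M * Suc \<alpha> \<le> mdim M * (k + 1)" using assms(1) by (intro mult_le_mono2) simp
  then show "{..<mdim M * Suc \<alpha>} \<subseteq> {..<mdim M * (k + 1)}" by auto
  show "\<forall>A\<in>{..<mdim M * (k + 1)} - {..<mdim M * Suc \<alpha>}. theta C \<alpha> m A \<xi> * w A = 0"
    using theta_support[OF assms(2)] by auto
qed simp

lemma sasaki_expand:
  assumes C: "C \<in> atlas M" "jet_base u \<in> fst C"
    and W: "W \<in> tspace (jet_bundle k M) u" "W' \<in> tspace (jet_bundle k M) u"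
  defines "\<xi> \<equiv> snd (jet_chart M k C) u" and "w \<equiv> vcomp (jet_chart M k C) W" and "w' \<equiv> vcomp (jet_chart M k C) W'"
    and "N \<equiv> mdim M * (k + 1)"
  shows "sasaki k M g u W W' = (\<Sum>\<alpha>\<le>k. \<Sum>m<mdim M. \<Sum>l<mdim M. (\<Sum>A<N. theta C \<alpha> m A \<xi> * w A) * (\<Sum>B<N. theta C \<alpha> l B \<xi> * w' B) *
     (1 / fact \<alpha> * (1 / fact \<alpha>) * metric_coeff M g C m l (trunc (mdim M) \<xi>)))"
proof -
  have x: "snd C (jet_base u) = trunc (mdim M) \<xi>" unfolding \<xi>_def by (rule jet_coord_base[OF C, symmetric])
  have "g (jet_base u) (K_map M g k \<alpha> W) (K_map M g k \<alpha> W') = (\<Sum>m<mdim M. \<Sum>l<mdim M.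
      (\<Sum>A<N. theta C \<alpha> m A \<xi> * w A) * (\<Sum>B<N. theta C \<alpha> l B \<xi> * w' B) *
     (1 / fact \<alpha> * (1 / fact \<alpha>) * metric_coeff M g C m l (trunc (mdim M) \<xi>)))" if \<alpha>: "\<alpha> \<le> k" for \<alpha>
  proof -
    note K = K_map[OF W(1) C \<alpha>] and K' = K_map[OF W(2) C \<alpha>]
    have e: "vcomp C (K_map M g k \<alpha> W) m = 1 / fact \<alpha> * (\<Sum>A<N. theta C \<alpha> m A \<xi> * w A)"
      "vcomp C (K_map M g k \<alpha> W') m = 1 / fact \<alpha> * (\<Sum>A<N. theta C \<alpha> m A \<xi> * w' A)" if "m < mdim M" for m
      unfolding K(2)[OF that] K'(2)[OF that] \<xi>_def w_def w'_def N_def theta_sum_extend[OF \<alpha> that] by (rule refl)+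
    show ?thesis
      unfolding g_expand[OF C K(1) K'(1)] x by (intro sum.cong refl) (simp add: e)
  qed
  then show ?thesis unfolding sasaki_def by (intro sum.cong) auto
qed

lemma metric_coeff_sasaki:
  assumes C: "C \<in> atlas M" and \<xi>: "\<xi> \<in> jet_domain (mdim M) (snd C ` fst C) (mdim M * (k + 1))"
    and AB: "A < mdim M * (k + 1)" "B < mdim M * (k + 1)"
  shows "metric_coeff (jet_bundle k M) (sasaki k M g) (jet_chart M k C) A B \<xi> = (\<Sum>\<alpha>\<le>k. sasaki_coeff C \<alpha> A B \<xi>)"
proof -
  interpret JB: charted "jet_bundle k M" by (rule charted_jet_bundle)
  define C' where "C' = jet_chart M k C"
  have C': "C' \<in> atlas (jet_bundle k M)" using C by (auto simp: C'_def atlas_jet_bundle)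
  define u where "u = chart_inv C' \<xi>"
  have \<xi>': "\<xi> \<in> snd C' ` fst C'" using \<xi> jet_chart_image[OF C, of k] by (simp add: C'_def)
  have u: "u \<in> fst C'" "snd C' u = \<xi>"
    using JB.chart_inv_in[OF \<xi>'] JB.chart_chart_inv[OF \<xi>'] by (auto simp: u_def)
  have b: "jet_base u \<in> fst C" using u by (simp add: C'_def jet_chart_fst)
  have AB': "A < mdim (jet_bundle k M)" "B < mdim (jet_bundle k M)" using AB by simp_all
  note cA = JB.coord_vec[OF C' u(1) AB'(1)] and cB = JB.coord_vec[OF C' u(1) AB'(2)]
  have s: "(\<Sum>X<mdim M * (k + 1). theta C \<alpha> m X \<xi> * vcomp C' (coord_vec (jet_bundle k M) C' u Y) X) = theta C \<alpha> m Y \<xi>"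
    if Y: "Y < mdim M * (k + 1)" for \<alpha> m Y
  proof -
    have "(\<Sum>X<mdim M * (k + 1). theta C \<alpha> m X \<xi> * vcomp C' (coord_vec (jet_bundle k M) C' u Y) X)
      = (\<Sum>X<mdim M * (k + 1). if X = Y then theta C \<alpha> m Y \<xi> else 0)"
      using JB.coord_vec(2)[OF C' u(1), of Y] Y by (intro sum.cong) auto
    then show ?thesis using Y by simp
  qed
  show ?thesis
    unfolding metric_coeff_alt u_def[symmetric] C'_def[symmetric]
      sasaki_expand[OF C b cA(1) cB(1), folded C'_def, unfolded u(2)] s[OF AB(1)] s[OF AB(2)] sasaki_coeff_def by (rule refl)
qed

lemma sasaki_coeff_smooth_term:
  assumes C: "C \<in> atlas M" and m: "m < mdim M" "l < mdim M" and N: "mdim M * Suc \<alpha> \<le> N"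
  shows "smooth_on N (jet_domain (mdim M) (snd C ` fst C) N)
     (\<lambda>\<xi>. 1 / fact \<alpha> * (1 / fact \<alpha>) * metric_coeff M g C m l (trunc (mdim M) \<xi>))"
proof -
  have n: "mdim M \<le> N" using N by simp
  show ?thesis
    by (intro smooth_on_mult smooth_on_const openin_jet_domain[OF open_chart[OF C] n]
        smooth_on_jet_domain_trunc[OF metric_chartD(2)[OF metric_chart[OF C] m] n])
qed

lemma sasaki_coeff_smooth:
  assumes C: "C \<in> atlas M" and N: "mdim M * Suc \<alpha> \<le> N"
  shows "smooth_on N (jet_domain (mdim M) (snd C ` fst C) N) (sasaki_coeff C \<alpha> A B)"
proof -
  have n: "mdim M \<le> N" using N by simp
  show ?thesis unfolding sasaki_coeff_def[abs_def]
    by (intro smooth_on_sum[OF openin_jet_domain[OF open_chart[OF C] n]])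
      (intro smooth_on_mult[OF smooth_on_mult[OF theta_smooth[OF C _ N] theta_smooth[OF C _ N]] sasaki_coeff_smooth_term[OF C _ _ N]]; simp)
qed

text \<open>Together with \<open>sasaki_coeff_0\<close> this says that the summand is pulled back
  from the jets of order \<open>\<alpha>\<close>.\<close>

lemma sasaki_coeff_depends_below: "depends_below (mdim M * Suc \<alpha>) (sasaki_coeff C \<alpha> A B)"
proof -
  have c: "trunc (mdim M) \<xi> = trunc (mdim M) \<eta>" if "\<forall>j<mdim M * Suc \<alpha>. \<xi> j = \<eta> j" for \<xi> \<eta> :: "nat \<Rightarrow> real"
    using that by (auto simp: trunc_def fun_eq_iff)
  have t: "theta C \<alpha> m A \<xi> = theta C \<alpha> m A \<eta>" if "\<forall>j<mdim M * Suc \<alpha>. \<xi> j = \<eta> j" for \<xi> \<eta> :: "nat \<Rightarrow> real" and m A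
    using theta_depends_below that unfolding depends_below_def by blast
  show ?thesis unfolding depends_below_def
  proof (intro allI impI)
    fix \<xi> \<eta> :: "nat \<Rightarrow> real" assume e: "\<forall>j<mdim M * Suc \<alpha>. \<xi> j = \<eta> j"
    show "sasaki_coeff C \<alpha> A B \<xi> = sasaki_coeff C \<alpha> A B \<eta>"
      unfolding sasaki_coeff_def t[OF e] c[OF e] by (rule refl)
  qed
qed

lemma sasaki_coeff_0:
  assumes "mdim M * Suc \<alpha> \<le> A \<or> mdim M * Suc \<alpha> \<le> B"
  shows "sasaki_coeff C \<alpha> A B = (\<lambda>\<xi>. 0)"
proof
  fix \<xi> show "sasaki_coeff C \<alpha> A B \<xi> = 0"
    unfolding sasaki_coeff_def using assms by (intro sum.neutral ballI) (auto simp: theta_support)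
qed

text \<open>The quadratic form is a weighted sum over \<open>\<alpha>\<close> of values of the
  metric of \<open>M\<close> on the one-forms of order \<open>\<alpha>\<close>, hence nonnegative;
  the triangular shape of these forms makes one summand positive at a nonzero vector.\<close>

lemma metric_chart_sasaki:
  assumes C: "C \<in> atlas M"
  shows "metric_chart (jet_bundle k M) (sasaki k M g) (jet_chart M k C)"
proof -
  define n where "n = mdim M"
  define N where "N = n * (k + 1)"
  define S where "S = jet_domain n (snd C ` fst C) N"
  have dimN: "mdim (jet_bundle k M) = N" by (simp add: N_def n_def)
  have im: "snd (jet_chart M k C) ` fst (jet_chart M k C) = S"
    using jet_chart_image[OF C] by (simp only: S_def N_def n_def)
  have nN: "n * Suc \<alpha> \<le> N" if "\<alpha> \<le> k" for \<alpha> unfolding N_def using that by (intro mult_le_mono2) simp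
  have o: "openin (Euclidean_space N) S"
    unfolding S_def n_def by (rule openin_jet_domain[OF open_chart[OF C]]) (simp add: N_def n_def)
  define F where "F A B \<xi> = (\<Sum>\<alpha>\<le>k. sasaki_coeff C \<alpha> A B \<xi>)" for A B \<xi>
  have eq: "metric_coeff (jet_bundle k M) (sasaki k M g) (jet_chart M k C) A B \<xi> = F A B \<xi>"
    if "\<xi> \<in> S" "A < N" "B < N" for A B \<xi>
    using metric_coeff_sasaki[OF C] that unfolding S_def N_def n_def F_def by blast
  have smF: "smooth_on N S (F A B)" for A B
    unfolding F_def[abs_def] by (rule smooth_on_sum[OF o]) (use sasaki_coeff_smooth[OF C] nN in \<open>auto simp: S_def n_def\<close>)
  have pd: "posdef n (\<lambda>m l. metric_coeff M g C m l (trunc n \<xi>))" if "\<xi> \<in> S" for \<xi>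
    using metric_chartD(3)[OF metric_chart[OF C]] that by (auto simp: S_def jet_domain_def n_def)
  have gs: "metric_coeff M g C m l (trunc n \<xi>) = metric_coeff M g C l m (trunc n \<xi>)" if "\<xi> \<in> S" "m < n" "l < n" for m l \<xi>
    using metric_chartD(4)[OF metric_chart[OF C]] that by (auto simp: S_def jet_domain_def n_def)
  show ?thesis
    unfolding metric_chart_def dimN im
  proof (intro conjI allI impI ballI o)
    show "smooth_on N S (metric_coeff (jet_bundle k M) (sasaki k M g) (jet_chart M k C) A B)" if "A < N" "B < N" for A B
      by (rule smooth_on_cong[OF smF]) (simp add: eq that)
    fix \<xi> assume \<xi>: "\<xi> \<in> S"
    show "metric_coeff (jet_bundle k M) (sasaki k M g) (jet_chart M k C) A B \<xi> =
        metric_coeff (jet_bundle k M) (sasaki k M g) (jet_chart M k C) B A \<xi>" if "A < N" "B < N" for A B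
    proof -
      have "sasaki_coeff C \<alpha> A B \<xi> = sasaki_coeff C \<alpha> B A \<xi>" for \<alpha>
      proof -
        have "sasaki_coeff C \<alpha> A B \<xi> = (\<Sum>l<n. \<Sum>m<n. theta C \<alpha> m A \<xi> * theta C \<alpha> l B \<xi> *
           (1 / fact \<alpha> * (1 / fact \<alpha>) * metric_coeff M g C m l (trunc n \<xi>)))"
          unfolding sasaki_coeff_def n_def by (rule sum.swap)
        also have "\<dots> = sasaki_coeff C \<alpha> B A \<xi>"
          unfolding sasaki_coeff_def n_def[symmetric] using gs[OF \<xi>] by (intro sum.cong refl) (simp add: mult_ac)
        finally show ?thesis .
      qed
      then show ?thesis unfolding eq[OF \<xi> that] eq[OF \<xi> that(2,1)] F_def by simp
    qed
    show "posdef N (\<lambda>A B. metric_coeff (jet_bundle k M) (sasaki k M g) (jet_chart M k C) A B \<xi>)"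
      unfolding posdef_def
    proof (intro allI impI)
      fix w :: "nat \<Rightarrow> real" assume w: "\<exists>A<N. w A \<noteq> 0"
      define \<theta> where "\<theta> \<alpha> m = (\<Sum>A<N. theta C \<alpha> m A \<xi> * w A)" for \<alpha> m
      define T where "T \<alpha> = (\<Sum>m<n. \<Sum>l<n. \<theta> \<alpha> m * \<theta> \<alpha> l * metric_coeff M g C m l (trunc n \<xi>))" for \<alpha>
      have "(\<Sum>A<N. \<Sum>B<N. w A * w B * metric_coeff (jet_bundle k M) (sasaki k M g) (jet_chart M k C) A B \<xi>)
         = (\<Sum>A<N. \<Sum>B<N. \<Sum>\<alpha>\<le>k. w A * w B * sasaki_coeff C \<alpha> A B \<xi>)"
        by (simp add: eq[OF \<xi>] F_def sum_distrib_left)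
      also have "\<dots> = (\<Sum>\<alpha>\<le>k. \<Sum>A<N. \<Sum>B<N. w A * w B * sasaki_coeff C \<alpha> A B \<xi>)"
        by (rule sum_move_first3[symmetric])
      also have "\<dots> = (\<Sum>\<alpha>\<le>k. 1 / fact \<alpha> * (1 / fact \<alpha>) * T \<alpha>)"
      proof (intro sum.cong refl)
        fix \<alpha>
        have "(\<Sum>A<N. \<Sum>B<N. w A * w B * sasaki_coeff C \<alpha> A B \<xi>)
          = (\<Sum>A<N. \<Sum>B<N. \<Sum>m<n. \<Sum>l<n. (1 / fact \<alpha> * (1 / fact \<alpha>)) * ((theta C \<alpha> m A \<xi> * w A) * (theta C \<alpha> l B \<xi> * w B) * metric_coeff M g C m l (trunc n \<xi>)))"
          unfolding sasaki_coeff_def n_def[symmetric] sum_distrib_left by (intro sum.cong refl) (simp add: mult_ac)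
        also have "\<dots> = (\<Sum>B<N. \<Sum>m<n. \<Sum>l<n. \<Sum>A<N. (1 / fact \<alpha> * (1 / fact \<alpha>)) * ((theta C \<alpha> m A \<xi> * w A) * (theta C \<alpha> l B \<xi> * w B) * metric_coeff M g C m l (trunc n \<xi>)))"
          by (rule sum_move_first4)
        also have "\<dots> = (\<Sum>m<n. \<Sum>l<n. \<Sum>B<N. \<Sum>A<N. (1 / fact \<alpha> * (1 / fact \<alpha>)) * ((theta C \<alpha> m A \<xi> * w A) * (theta C \<alpha> l B \<xi> * w B) * metric_coeff M g C m l (trunc n \<xi>)))"
          by (rule sum_move_first3)
        also have "\<dots> = (\<Sum>m<n. \<Sum>l<n. (1 / fact \<alpha> * (1 / fact \<alpha>)) * (\<theta> \<alpha> m * \<theta> \<alpha> l * metric_coeff M g C m l (trunc n \<xi>)))"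
          unfolding \<theta>_def by (intro sum.cong refl) (simp add: sum_distrib_left sum_distrib_right mult_ac)
        finally show "(\<Sum>A<N. \<Sum>B<N. w A * w B * sasaki_coeff C \<alpha> A B \<xi>) = 1 / fact \<alpha> * (1 / fact \<alpha>) * T \<alpha>"
          unfolding T_def sum_distrib_left .
      qed
      also have "\<dots> > 0"
      proof (rule sum_pos2)
        \<comment> \<open>At the least index with \<open>w A \<noteq> 0\<close> the component
          \<open>A mod n\<close> of the form of order \<open>A div n\<close> reduces to
          \<open>w A\<close>: smaller indices have vanishing \<open>w\<close>, the rest of the block
          lies off the diagonal of an identity matrix, and higher orders do not enter.\<close>
        define A where "A = (LEAST A. w A \<noteq> 0)"
        have A: "w A \<noteq> 0" "A < N" "\<And>B. B < A \<Longrightarrow> w B = 0"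
        proof -
          show "w A \<noteq> 0" unfolding A_def by (rule LeastI_ex) (use w in blast)
          show "A < N" unfolding A_def using w by (auto intro: le_less_trans[OF Least_le])
          show "w B = 0" if "B < A" for B using not_less_Least[OF that[unfolded A_def]] by simp
        qed
        define \<alpha> where "\<alpha> = A div n"
        define i where "i = A mod n"
        have d: "\<alpha> \<le> k" "i < n" using div_index[of A n k] A(2) by (auto simp: N_def \<alpha>_def i_def)
        have Ai: "A = n * \<alpha> + i" by (simp add: \<alpha>_def i_def)
        have "\<theta> \<alpha> i = (\<Sum>B<N. if B = A then w A else 0)"
          unfolding \<theta>_def
        proof (intro sum.cong refl)
          fix B assume "B \<in> {..<N}"
          consider "B < A" | "B = A" | "A < B" "B < n * Suc \<alpha>" | "n * Suc \<alpha> \<le> B" by linarith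
          then show "theta C \<alpha> i B \<xi> * w B = (if B = A then w A else 0)"
          proof cases
            case 1 then show ?thesis using A(3) by simp
          next
            case 2 then show ?thesis using theta_leading[of i i C \<alpha> \<xi>] d Ai by (simp add: n_def)
          next
            case 3
            then have B: "B = n * \<alpha> + (B - n * \<alpha>)" "B - n * \<alpha> < n" "B - n * \<alpha> \<noteq> i" using Ai by auto
            have "theta C \<alpha> i (n * \<alpha> + (B - n * \<alpha>)) \<xi> = 0"
              using theta_leading[of i "B - n * \<alpha>" C \<alpha> \<xi>] d B by (simp add: n_def)
            then show ?thesis using B 3 by simp
          next
            case 4
            have "A < n * Suc \<alpha>" using Ai d by simp
            then show ?thesis using 4 theta_support[of i \<alpha> B C] d by (simp add: n_def)
          qed
        qed
        then have "\<theta> \<alpha> i \<noteq> 0" using A by simp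
        then have "T \<alpha> > 0" unfolding T_def using posdefD[OF pd[OF \<xi>] d(2), of "\<theta> \<alpha>"] by simp
        then show "0 < 1 / fact \<alpha> * (1 / fact \<alpha>) * T \<alpha>" by simp
        show "\<alpha> \<in> {..k}" using d by simp
        show "0 \<le> 1 / fact \<beta> * (1 / fact \<beta>) * T \<beta>" for \<beta>
          unfolding T_def using posdef_nonneg[OF pd[OF \<xi>], of "\<theta> \<beta>"] by simp
      qed simp
      finally show "0 < (\<Sum>A<N. \<Sum>B<N. w A * w B * metric_coeff (jet_bundle k M) (sasaki k M g) (jet_chart M k C) A B \<xi>)" .
    qed
  qed
qed

subsection \<open>Projection of horizontal geodesics\<close>

text \<open>The manifold \<open>T\<close> stands for the jet bundle of order \<open>k\<close>, or for \<open>M\<close> itself if \<open>k = 0\<close>.\<close>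

lemma geodesic_projection:
  fixes T :: "'b manifold" and h :: "'b metric" and f :: "'a chart \<Rightarrow> 'b chart" and c :: "real \<Rightarrow> 'b"
  assumes T: "charted T" "mdim T = mdim M * (k + 1)" "atlas T = f ` atlas M"
    and mc: "\<And>C. C \<in> atlas M \<Longrightarrow> metric_chart T h (f C)"
    and coeff: "\<And>C A B \<xi>. C \<in> atlas M \<Longrightarrow> A < mdim T \<Longrightarrow> B < mdim T \<Longrightarrow> \<xi> \<in> snd (f C) ` fst (f C) \<Longrightarrow>
      metric_coeff T h (f C) A B \<xi> = (\<Sum>\<alpha>\<le>k. sasaki_coeff C \<alpha> A B \<xi>)"
    and dom: "\<And>C t. C \<in> atlas M \<Longrightarrow> t \<in> I \<Longrightarrow> c t \<in> fst (f C) \<longleftrightarrow> jet_base (\<Gamma> t) \<in> fst C"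
    and coord: "\<And>C t. C \<in> atlas M \<Longrightarrow> t \<in> I \<Longrightarrow> jet_base (\<Gamma> t) \<in> fst C \<Longrightarrow>
      snd (f C) (c t) = trunc (mdim T) (snd (jet_chart M (Suc k) C) (\<Gamma> t))"
    and geo: "geodesic (jet_bundle (Suc k) M) (sasaki (Suc k) M g) I \<Gamma>"
    and hor: "k_horizontal M g (Suc k) I \<Gamma>"
  shows "geodesic T h I c"
proof -
  interpret T: charted T by (rule T(1))
  interpret JB: charted "jet_bundle (Suc k) M" by (rule charted_jet_bundle)
  define n where "n = mdim M"
  define N' where "N' = n * (k + 1)"
  define N where "N = n * (Suc k + 1)"
  have dims: "mdim T = N'" "mdim (jet_bundle (Suc k) M) = N" using T(2) by (simp_all add: N'_def N_def n_def)
  have NN: "N' \<le> N" by (simp add: N_def N'_def)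
  have \<Gamma>: "smooth_curve (jet_bundle (Suc k) M) I \<Gamma>" using geo by (simp add: geodesic_def)
  have I: "open I" using \<Gamma> by (simp add: smooth_curve_def)
  have jets: "\<Gamma> t \<in> jets M (Suc k)" if "t \<in> I" for t
    using \<Gamma> that mcarrier_jet_bundle unfolding smooth_curve_def by blast
  \<comment> \<open>The coordinates of \<open>c\<close> are the first coordinates of
    \<open>\<Gamma>\<close>, so \<open>c\<close> inherits smoothness on the same set of
    times.\<close>
  have chart: "\<exists>J. t \<in> J \<and> J \<subseteq> I \<and> chart_smooth (jet_bundle (Suc k) M) (jet_chart M (Suc k) C) J \<Gamma> \<and> chart_smooth T (f C) J c"
    if t: "t \<in> I" and C: "C \<in> atlas M" "jet_base (\<Gamma> t) \<in> fst C" for t C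
  proof -
    have C': "jet_chart M (Suc k) C \<in> atlas (jet_bundle (Suc k) M)" "\<Gamma> t \<in> fst (jet_chart M (Suc k) C)"
      using C jets[OF t] by (auto simp: atlas_jet_bundle jet_chart_fst)
    obtain J where J: "t \<in> J" "J \<subseteq> I" "chart_smooth (jet_bundle (Suc k) M) (jet_chart M (Suc k) C) J \<Gamma>"
      by (rule smooth_curve_chart[OF \<Gamma> t C'])
    note JD = chart_smoothD[OF J(3)]
    have b: "jet_base (\<Gamma> s) \<in> fst C" if "s \<in> J" for s using JD(3)[OF that] by (simp add: jet_chart_fst)
    have "chart_smooth T (f C) J c"
      unfolding chart_smooth_def
    proof (intro conjI ballI allI impI JD(2))
      show "f C \<in> atlas T" using C T(3) by auto
      show "c s \<in> fst (f C)" if "s \<in> J" for s using dom[OF C(1)] b[OF that] J(2) that by blast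
      fix i assume "i < mdim T"
      then have i: "i < N'" "i < mdim (jet_bundle (Suc k) M)" using NN by (simp_all only: dims)
      show "smooth1 J (\<lambda>t. snd (f C) (c t) i)"
      proof (rule smooth1_cong[OF JD(4)[OF i(2)]])
        fix s assume s: "s \<in> J"
        then have "s \<in> I" using J(2) by blast
        then show "snd (jet_chart M (Suc k) C) (\<Gamma> s) i = snd (f C) (c s) i"
          using coord[OF C(1) _ b[OF s]] i(1) by (simp add: trunc_def dims)
      qed
    qed
    then show ?thesis using J by blast
  qed
  have c: "smooth_curve T I c"
  proof (rule T.smooth_curveI[OF I])
    fix t assume t: "t \<in> I"
    obtain C where "C \<in> atlas M" "jet_base (\<Gamma> t) \<in> fst C"
      using smooth_germ_carrier[OF jetsE(1)[OF jets[OF t]]] by (auto simp: mcarrier_def jet_base_def)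
    from chart[OF t this] show "\<exists>C J. t \<in> J \<and> chart_smooth T C J c" by blast
  qed
  have mcT: "\<forall>D\<in>atlas T. metric_chart T h D" using mc T(3) by auto
  have mcJB: "\<forall>D\<in>atlas (jet_bundle (Suc k) M). metric_chart (jet_bundle (Suc k) M) (sasaki (Suc k) M g) D"
    using metric_chart_sasaki by (auto simp: atlas_jet_bundle)
  note geoJB = JB.geodesic_iff_lowered_geodesic[OF \<Gamma> mcJB, THEN iffD1, OF geo]
  show ?thesis
    unfolding T.geodesic_iff_lowered_geodesic[OF c mcT]
  proof (intro ballI impI allI)
    fix t D l assume t: "t \<in> I" and "D \<in> atlas T" and cD: "c t \<in> fst D" and "l < mdim T"
    then obtain C where C: "C \<in> atlas M" "D = f C" using T(3) by auto
    have l: "l < N'" "l < N" using \<open>l < mdim T\<close> NN by (simp_all only: dims)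
    have b: "jet_base (\<Gamma> t) \<in> fst C" using dom[OF C(1) t] cD C(2) by simp
    define C' where "C' = jet_chart M (Suc k) C"
    have C': "C' \<in> atlas (jet_bundle (Suc k) M)" "\<Gamma> t \<in> fst C'"
      using C b jets[OF t] by (auto simp: C'_def atlas_jet_bundle jet_chart_fst)
    obtain J where J: "t \<in> J" "J \<subseteq> I" "chart_smooth (jet_bundle (Suc k) M) C' J \<Gamma>" "chart_smooth T (f C) J c"
      using chart[OF t C(1) b] unfolding C'_def by blast
    note JD = chart_smoothD[OF J(3), unfolded dims]
    define S where "S = jet_domain n (snd C ` fst C) N"
    have im: "snd C' ` fst C' = S" unfolding C'_def S_def N_def n_def by (rule jet_chart_image[OF C(1)])
    have S: "openin (Euclidean_space N) S"
      unfolding S_def n_def by (rule openin_jet_domain[OF open_chart[OF C(1)]]) (simp add: N_def n_def)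
    define x where "x s = snd C' (\<Gamma> s)" for s
    define v where "v i = deriv (\<lambda>s. x s i) t" for i
    define a where "a i = deriv (deriv (\<lambda>s. x s i)) t" for i
    have xS: "x s \<in> S" if "s \<in> J" for s using JD(3)[OF that] im by (auto simp: x_def)
    have xs: "smooth1 J (\<lambda>s. x s i)" if "i < N" for i using JD(4)[OF that] by (simp add: x_def)
    have bJ: "jet_base (\<Gamma> s) \<in> fst C" if "s \<in> J" for s using JD(3)[OF that] by (simp add: C'_def jet_chart_fst)
    have thS: "smooth_on N S (theta C (Suc k) m A)" if "m < n" for m A
      unfolding S_def n_def by (rule theta_smooth[OF C(1)]) (use that in \<open>auto simp: n_def N_def\<close>)
    \<comment> \<open>Horizontality is recorded on all of \<open>J\<close> and not only at
      \<open>t\<close>, because it is differentiated next.\<close>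
    have hor0: "(\<Sum>A<N. theta C (Suc k) m A (x s) * deriv (\<lambda>s. x s A) s) = 0" if "s \<in> J" "m < n" for s m
    proof -
      have sI: "s \<in> I" using that J(2) by blast
      have pM: "jet_base (\<Gamma> s) \<in> mcarrier M" using C(1) bJ[OF that(1)] by (auto simp: mcarrier_def)
      have m: "m < mdim M" using that(2) by (simp add: n_def)
      note vel = JB.velocity[OF \<Gamma> sI]
      have "vcomp C (K_map M g (Suc k) (Suc k) (velocity (jet_bundle (Suc k) M) \<Gamma> s)) m = 0"
        using hor sI zero_vec(2)[OF pM C(1) bJ[OF that(1)] m] by (simp add: k_horizontal_def)
      then have "1 / fact (Suc k) * (\<Sum>A<N. theta C (Suc k) m A (x s) * vcomp C' (velocity (jet_bundle (Suc k) M) \<Gamma> s) A) = 0"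
        unfolding K_map(2)[OF vel(1) C(1) bJ[OF that(1)] order_refl m] x_def C'_def N_def n_def
        by (simp only: Suc_eq_plus1)
      then have "(\<Sum>A<N. theta C (Suc k) m A (x s) * vcomp C' (velocity (jet_bundle (Suc k) M) \<Gamma> s) A) = 0" by simp
      moreover have "vcomp C' (velocity (jet_bundle (Suc k) M) \<Gamma> s) A = deriv (\<lambda>s. x s A) s" if "A < N" for A
        using vel(2)[OF C'(1) JD(3)[OF \<open>s \<in> J\<close>]] that by (simp only: dims x_def)
      ultimately show ?thesis by simp
    qed
    \<comment> \<open>The time derivative of \<open>hor0\<close>; here the acceleration enters, in
      the shape demanded by \<open>lowered_geodesic_annihilated\<close>.\<close>
    have hor1: "(\<Sum>A<N. theta C (Suc k) m A (x t) * a A) + (\<Sum>i<N. \<Sum>j<N. partial i (theta C (Suc k) m j) (x t) * v i * v j) = 0"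
      if m: "m < n" for m
    proof -
      have D: "((\<lambda>s. \<Sum>A<N. theta C (Suc k) m A (x s) * deriv (\<lambda>s. x s A) s) has_real_derivative
         (\<Sum>A<N. (\<Sum>i<N. partial i (theta C (Suc k) m A) (x t) * v i) * v A + a A * theta C (Suc k) m A (x t))) (at t)"
        unfolding v_def a_def
        by (intro DERIV_sum DERIV_mult smooth1_chain[OF thS[OF m] JD(2) xs xS J(1)] smooth1_D[OF smooth1_deriv[OF xs] J(1)]) auto
      have "deriv (\<lambda>s. \<Sum>A<N. theta C (Suc k) m A (x s) * deriv (\<lambda>s. x s A) s) t = 0"
        using deriv_cong_open[OF JD(2) J(1) hor0[OF _ m], where r=1] by simp
      then have "(\<Sum>A<N. (\<Sum>i<N. partial i (theta C (Suc k) m A) (x t) * v i) * v A + a A * theta C (Suc k) m A (x t)) = 0"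
        using DERIV_imp_deriv[OF D] by simp
      moreover have "(\<Sum>A<N. (\<Sum>i<N. partial i (theta C (Suc k) m A) (x t) * v i) * v A)
        = (\<Sum>i<N. \<Sum>j<N. partial i (theta C (Suc k) m j) (x t) * v i * v j)"
        unfolding sum_distrib_right by (rule sum.swap)
      ultimately show ?thesis by (simp add: sum.distrib mult.commute)
    qed
    have xt: "x t \<in> S" by (rule xS[OF J(1)])
    define F where "F \<equiv> \<lambda>A B \<xi>. \<Sum>\<alpha>\<le>k. sasaki_coeff C \<alpha> A B \<xi>"
    have le: "n * Suc \<alpha> \<le> N" if "\<alpha> \<le> Suc k" for \<alpha> unfolding N_def using that by (intro mult_le_mono2) simp
    have sc: "smooth_on N S (sasaki_coeff C \<alpha> A B)" if "\<alpha> \<le> Suc k" for \<alpha> A B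
      unfolding S_def n_def by (rule sasaki_coeff_smooth[OF C(1) le[OF that, unfolded n_def]])
    have "lowered_geodesic N (sasaki_coeff C (Suc k)) (x t) v a l = 0"
    proof -
      \<comment> \<open>Splits the top summand into products of two one-forms, indexed by the pairs
        of components, each of which is annihilated by the velocity.\<close>
      define Q where "Q = (\<lambda>p A B \<xi>. theta C (Suc k) (fst p) A \<xi> * theta C (Suc k) (snd p) B \<xi> *
         (1 / fact (Suc k) * (1 / fact (Suc k)) * metric_coeff M g C (fst p) (snd p) (trunc n \<xi>)))"
      have Qeq: "sasaki_coeff C (Suc k) = (\<lambda>A B \<xi>. \<Sum>p\<in>{..<n} \<times> {..<n}. Q p A B \<xi>)"
        by (intro ext) (simp add: sasaki_coeff_def Q_def sum.cartesian_product case_prod_beta n_def)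
      have h: "smooth_on N S (\<lambda>\<xi>. 1 / fact (Suc k) * (1 / fact (Suc k)) * metric_coeff M g C m r (trunc n \<xi>))"
        if "m < n" "r < n" for m r
        unfolding S_def n_def by (rule sasaki_coeff_smooth_term[OF C(1) _ _ le[OF order_refl, unfolded n_def]]) (use that in \<open>auto simp: n_def\<close>)
      have "lowered_geodesic N (Q p) (x t) v a l = 0" if p: "p \<in> {..<n} \<times> {..<n}" for p
        unfolding Q_def using p
        by (intro lowered_geodesic_annihilated[OF thS thS h xt l(2) hor0[OF J(1), folded v_def] hor0[OF J(1), folded v_def] hor1]) auto
      moreover have "smooth_on N S (Q p A B)" if p: "p \<in> {..<n} \<times> {..<n}" for p A B
        unfolding Q_def using p by (intro smooth_on_mult[OF smooth_on_mult[OF thS thS] h]) auto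
      ultimately show ?thesis
        unfolding Qeq using lowered_geodesic_sum[OF _ xt l(2), of "{..<n} \<times> {..<n}" Q v a] by simp
    qed
    moreover have "lowered_geodesic N (\<lambda>A B \<xi>. F A B \<xi> + sasaki_coeff C (Suc k) A B \<xi>) (x t) v a l
       = lowered_geodesic N F (x t) v a l + lowered_geodesic N (sasaki_coeff C (Suc k)) (x t) v a l"
    proof (rule lowered_geodesic_add[OF _ sc[OF order_refl] xt l(2)])
      show "smooth_on N S (F A B)" for A B
        unfolding F_def by (rule smooth_on_sum[OF S]) (rule sc, simp)
    qed
    \<comment> \<open>The equation of order \<open>Suc k\<close> in its own chart, with the summand
      \<open>\<alpha> = Suc k\<close> split off.\<close>
    moreover have "lowered_geodesic N (\<lambda>A B \<xi>. F A B \<xi> + sasaki_coeff C (Suc k) A B \<xi>) (x t) v a l = 0"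
    proof -
      have "lowered_geodesic N (metric_coeff (jet_bundle (Suc k) M) (sasaki (Suc k) M g) C') (x t) v a l = 0"
        using geoJB t C' l(2) unfolding dims x_def v_def a_def by blast
      moreover have "lowered_geodesic N (metric_coeff (jet_bundle (Suc k) M) (sasaki (Suc k) M g) C') (x t) v a l
         = lowered_geodesic N (\<lambda>A B \<xi>. F A B \<xi> + sasaki_coeff C (Suc k) A B \<xi>) (x t) v a l"
      proof (rule lowered_geodesic_cong[OF S xt l(2)])
        fix A B y assume "A < N" "B < N" "y \<in> S"
        then show "metric_coeff (jet_bundle (Suc k) M) (sasaki (Suc k) M g) C' A B y = F A B y + sasaki_coeff C (Suc k) A B y"
          using metric_coeff_sasaki[OF C(1), of y "Suc k" A B] unfolding S_def N_def n_def C'_def F_def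
          by (simp only: sum.atMost_Suc)
      qed auto
      ultimately show ?thesis by simp
    qed
    ultimately have "lowered_geodesic N F (x t) v a l = 0" by simp
    \<comment> \<open>\<open>F\<close> depends only on the coordinates of order at most
      \<open>k\<close> and is supported in their indices, and \<open>l\<close> is one of
      these.\<close>
    moreover have "lowered_geodesic N F (x t) v a l = lowered_geodesic N' F (trunc N' (x t)) v a l"
    proof (rule lowered_geodesic_restrict[OF NN l(1)])
      have le': "n * Suc \<alpha> \<le> N'" if "\<alpha> \<le> k" for \<alpha> unfolding N'_def using that by (intro mult_le_mono2) simp
      have d: "depends_below N' (sasaki_coeff C \<alpha> i j)" if "\<alpha> \<le> k" for i j \<alpha>
        using depends_below_mono[OF sasaki_coeff_depends_below] le'[OF that] unfolding n_def by blast
      show "depends_below N' (F i j)" for i j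
        unfolding depends_below_def F_def
      proof (intro allI impI sum.cong refl)
        fix \<xi> \<eta> :: "nat \<Rightarrow> real" and \<alpha> assume "\<forall>j<N'. \<xi> j = \<eta> j" "\<alpha> \<in> {..k}"
        then show "sasaki_coeff C \<alpha> i j \<xi> = sasaki_coeff C \<alpha> i j \<eta>"
          using d[of \<alpha> i j] unfolding depends_below_def by simp
      qed
      show "F i j = (\<lambda>_. 0)" if "N' \<le> i \<or> N' \<le> j" for i j
      proof
        fix \<xi>
        have "sasaki_coeff C \<alpha> i j = (\<lambda>\<xi>. 0)" if "\<alpha> \<le> k" for \<alpha>
          using le'[OF that] \<open>N' \<le> i \<or> N' \<le> j\<close> by (intro sasaki_coeff_0) (auto simp: n_def)
        then show "F i j \<xi> = 0" unfolding F_def by (intro sum.neutral ballI) simp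
      qed
    qed
    moreover have "lowered_geodesic N' (metric_coeff T h D) (snd D (c t)) (\<lambda>i. deriv (\<lambda>s. snd D (c s) i) t)
      (\<lambda>i. deriv (deriv (\<lambda>s. snd D (c s) i)) t) l = lowered_geodesic N' F (trunc N' (x t)) v a l"
    proof -
      \<comment> \<open>The coordinates agree on all of \<open>J\<close>, so velocity and
        acceleration of the two curves agree in the first \<open>N'\<close> places.\<close>
      have e: "snd D (c s) = trunc N' (x s)" if "s \<in> J" for s
        using coord[OF C(1) _ bJ[OF that]] that J(2) C(2) unfolding x_def C'_def dims by blast
      have e1: "snd D (c s) i = x s i" if "s \<in> J" "i < N'" for s i using e[OF that(1)] that(2) by (simp add: trunc_def)
      show ?thesis
        unfolding e[OF J(1)]
      proof (rule lowered_geodesic_cong[OF metric_chartD(1)[OF mc[OF C(1)], unfolded dims] _ l(1)])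
        have "c t \<in> fst (f C)" using cD C(2) by simp
        then show "trunc N' (x t) \<in> snd (f C) ` fst (f C)" unfolding e[OF J(1), symmetric] C(2) by (rule imageI)
        show "metric_coeff T h D i j y = F i j y" if "i < N'" "j < N'" "y \<in> snd (f C) ` fst (f C)" for i j y
          unfolding C(2) F_def by (rule coeff[OF C(1)]) (use that in \<open>simp_all only: dims\<close>)
        show "deriv (\<lambda>s. snd D (c s) i) t = v i" if "i < N'" for i
          unfolding v_def using deriv_cong_open[OF JD(2) J(1) e1[OF _ that], where r=1] by simp
        show "deriv (deriv (\<lambda>s. snd D (c s) i)) t = a i" if "i < N'" for i
          unfolding a_def using deriv_cong_open[OF JD(2) J(1) e1[OF _ that], where r=2] by (simp add: numeral_2_eq_2)
      qed
    qed
    ultimately show "lowered_geodesic (mdim T) (metric_coeff T h D) (snd D (c t)) (\<lambda>i. deriv (\<lambda>s. snd D (c s) i) t)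
      (\<lambda>i. deriv (deriv (\<lambda>s. snd D (c s) i)) t) l = 0"
      unfolding dims by simp
  qed
qed

end

theorem proposition34:
  fixes M :: "'a manifold" and g :: "'a metric" and k :: nat
    and I :: "real set" and \<Gamma> :: "real \<Rightarrow> 'a jet"
  assumes "riemannian_manifold M g" and "k \<ge> 1"
    and "open I" and "is_interval I"
    and "geodesic (jet_bundle k M) (sasaki k M g) I \<Gamma>"
    and "k_horizontal M g k I \<Gamma>"
  shows "if k = 1 then geodesic M g I (\<lambda>t. jet_base (\<Gamma> t))
         else geodesic (jet_bundle (k - 1) M) (sasaki (k - 1) M g) I
                (\<lambda>t. jet_trunc M (k - 1) (\<Gamma> t))"
proof -
  interpret charted M
    using assms(1) smooth_manifold_charted by (auto simp: riemannian_manifold_def)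
  interpret riem M g
    by unfold_locales (use assms(1) in \<open>simp add: riemannian_manifold_def\<close>)
  obtain k' where k: "k = Suc k'" using assms(2) by (cases k) auto
  note geo = assms(5)[unfolded k] and hor = assms(6)[unfolded k]
  have jets: "\<Gamma> t \<in> jets M (Suc k')" if "t \<in> I" for t
    using geo that mcarrier_jet_bundle unfolding geodesic_def smooth_curve_def by blast
  show ?thesis
  proof (cases "k' = 0")
    case True
    \<comment> \<open>The bundle of order 0 is \<open>M\<close> itself, of another type, so the
      charts are taken unchanged. As \<open>theta\<close> of order 0 is the identity, the only
      summand is the given metric.\<close>
    have "geodesic M g I (\<lambda>t. jet_base (\<Gamma> t))"
    proof (rule geodesic_projection[where k=0 and f="\<lambda>C. C", OF charted_axioms _ _ metric_chart _ _ _ geo[unfolded True] hor[unfolded True]])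
      fix C A B \<xi> assume C: "C \<in> atlas M" and AB: "A < mdim M" "B < mdim M" and \<xi>: "\<xi> \<in> snd C ` fst C"
      have "\<xi> \<in> EE (mdim M)" using \<xi> chart_EE[OF C] by auto
      moreover have "(\<Sum>m<mdim M. \<Sum>l<mdim M. (if m = A then 1 else 0) * (if l = B then 1 else 0) * metric_coeff M g C m l \<xi>)
         = (\<Sum>m<mdim M. if m = A then metric_coeff M g C A B \<xi> else 0)"
        using AB by (intro sum.cong refl) (simp add: if_distrib[of "\<lambda>x. x * _"] cong: if_cong)
      ultimately show "metric_coeff M g C A B \<xi> = (\<Sum>\<alpha>\<le>0. sasaki_coeff C \<alpha> A B \<xi>)"
        using AB by (simp add: sasaki_coeff_def trunc_id)
    next
      fix C t assume C: "C \<in> atlas M" and "t \<in> I" and b: "jet_base (\<Gamma> t) \<in> fst C"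
      show "snd C (jet_base (\<Gamma> t)) = trunc (mdim M) (snd (jet_chart M (Suc 0) C) (\<Gamma> t))"
        by (rule jet_coord_base[OF C b, symmetric])
    qed simp_all
    then show ?thesis using k True by simp
  next
    case False
    have "geodesic (jet_bundle k' M) (sasaki k' M g) I (\<lambda>t. jet_trunc M k' (\<Gamma> t))"
    proof (rule geodesic_projection[where k=k' and f="jet_chart M k'", OF charted_jet_bundle _ atlas_jet_bundle metric_chart_sasaki _ _ _ geo hor])
      show "mdim (jet_bundle k' M) = mdim M * (k' + 1)" by simp
    next
      fix C A B \<xi> assume C: "C \<in> atlas M" and "A < mdim (jet_bundle k' M)" "B < mdim (jet_bundle k' M)"
        "\<xi> \<in> snd (jet_chart M k' C) ` fst (jet_chart M k' C)"
      then show "metric_coeff (jet_bundle k' M) (sasaki k' M g) (jet_chart M k' C) A B \<xi> = (\<Sum>\<alpha>\<le>k'. sasaki_coeff C \<alpha> A B \<xi>)"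
        using metric_coeff_sasaki[OF C] unfolding jet_chart_image[OF C] mdim_jet_bundle by blast
    next
      fix C t assume C: "C \<in> atlas M" and t: "t \<in> I"
      have "jet_base (jet_trunc M k' (\<Gamma> t)) = jet_base (\<Gamma> t)"
        using jet_base_jet[OF jetsE(1)[OF jets[OF t]]] by (simp add: jet_trunc_def jet_base_def)
      moreover have "jet_trunc M k' (\<Gamma> t) \<in> jets M k'"
        unfolding jet_trunc_def by (rule jet_in_jets[OF jetsE(1)[OF jets[OF t]]])
      ultimately show "jet_trunc M k' (\<Gamma> t) \<in> fst (jet_chart M k' C) \<longleftrightarrow> jet_base (\<Gamma> t) \<in> fst C"
        by (simp add: jet_chart_fst)
    next
      fix C t assume C: "C \<in> atlas M" and t: "t \<in> I" and b: "jet_base (\<Gamma> t) \<in> fst C"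
      show "snd (jet_chart M k' C) (jet_trunc M k' (\<Gamma> t)) = trunc (mdim (jet_bundle k' M)) (snd (jet_chart M (Suc k') C) (\<Gamma> t))"
        unfolding mdim_jet_bundle by (rule jet_trunc[OF jets[OF t] C b]) simp
    qed
    then show ?thesis using k False by simp
  qed
qed

end
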